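(* Suppose $\sigma_1=\sigma_2=0$. Then: 1. If $\alpha_0<0$, the second moment of the solution of the stochastic equation (S) is bounded. Moreover, for any $\alpha\in(\alpha_0,0)$ there exists a constant $C_1=C_1(\alpha)>0$ (with $|X(t)|\le C_1e^{\alpha t}$ for all $t\ge0$) such that $$|M(t)-M_1|\le\frac{C_1^2\sigma_0^2e^{2\alpha t}}{|2\alpha|},\qquad t\ge0,$$ where $$M_1=\lim_{t\to+\infty}M(t)=\sigma_0^2\int_0^{+\infty}X^2(s)\,ds\le\frac{C_1^2\sigma_0^2}{|2\alpha|}.$$ 2. If $\alpha_0>0$, the second moment of the solution of (S) is unbounded.
   Context: Let $a,b,\sigma_0,\sigma_1,\sigma_2\in\mathbb{R}$ be constants, with $\sigma_0,\sigma_1,\sigma_2$ not all zero. The delay kernel $K:[0,+\infty)\to[0,+\infty)$ is piecewise continuous with $\int_0^{+\infty}K(s)\,ds=1$, and there is $\mu>0$ with $\int_0^{+\infty}e^{\mu s}K(s)\,ds<+\infty$. $BC((-\infty,0],\mathbb{R})$ is the space of bounded continuous functions $\phi:(-\infty,0]\to\mathbb{R}$ with norm $\|\phi\|=\sup_{\theta\le 0}|\phi(\theta)|$; it is the space of initial functions. The stochastic equation (S), in the Itô sense, with $W_t$ a one-dimensional Wiener process, is $$dx(t)=\Big(ax(t)+b\int_0^{+\infty}K(s)x(t-s)\,ds\Big)dt+\Big(\sigma_0+\sigma_1x(t)+\sigma_2\int_0^{+\infty}K(s)x(t-s)\,ds\Big)dW_t .$$ $x(t;\phi)$ denotes its solution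 with initial function $\phi\in BC((-\infty,0],\mathbb{R})$, and $E$ denotes expectation. The unperturbed equation is $x'(t)=ax(t)+b\int_0^{+\infty}K(s)x(t-s)\,ds$. Its fundamental solution $X(t)$ is the solution for $t\ge0$ with $X(0)=1$ and $X(t)=0$ for $t<0$. With $\mathcal{L}(K)(\lambda)=\int_0^{+\infty}e^{-\lambda t}K(t)\,dt$, the characteristic function is $h(\lambda)=\lambda-a-b\,\mathcal{L}(K)(\lambda)$ (well defined and analytic for $\mathrm{Re}(\lambda)\ge-\mu$), and $\alpha_0=\sup\{\mathrm{Re}(\lambda):h(\lambda)=0,\ \lambda\in\mathbb{C}\}$. The second moment of $x(t;\phi)$ is $M(t)=E\big(|x(t;\phi)-E(x(t;\phi))|^2\big)$. The second moment of the solution of (S) is said to be bounded if there is a positive constant $\tilde R=\tilde R(\|\phi\|^2)$ such that $M(t)\le\tilde R$ for all $t\ge0$, for all $\phi\in BC((-\infty,0],\mathbb{R})$; otherwise it is said to be unbounded.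
   Formalization: If h has no root where its Laplace integral converges absolutely (so α0 = −∞), the exponential bounds are claimed only for α<0 at which that integral converges absolutely (or b=0); for arbitrary α<0 they can fail, e.g. K(s)=c·e^{-s}/(1+s²), a=−10, small b>0. *)

theory Defs
  imports "HOL-Probability.Probability"
begin

section \<open>Delay kernel and initial functions\<close>

text \<open>Functions on a half-line are total functions on the reals; values outside the half-line
  are never used.\<close>

definition piecewise_continuous_halfline :: "(real \<Rightarrow> real) \<Rightarrow> bool" where
  "piecewise_continuous_halfline K \<longleftrightarrow>
     (\<forall>T\<ge>0. finite {s \<in> {0..T}. \<not> continuous (at s within {0..}) K}) \<and>
     (\<forall>s\<ge>0. \<exists>l. (K \<longlongrightarrow> l) (at_right s)) \<and>
     (\<forall>s>0. \<exists>l. (K \<longlongrightarrow> l) (at_left s))"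

definition delay_kernel :: "(real \<Rightarrow> real) \<Rightarrow> bool" where
  "delay_kernel K \<longleftrightarrow>
     (\<forall>s\<ge>0. 0 \<le> K s) \<and>
     piecewise_continuous_halfline K \<and>
     set_integrable lborel {0..} K \<and>
     (LBINT s:{0..}. K s) = 1 \<and>
     (\<exists>\<mu>>0. set_integrable lborel {0..} (\<lambda>s. exp (\<mu> * s) * K s))"

definition delay_term :: "(real \<Rightarrow> real) \<Rightarrow> (real \<Rightarrow> real) \<Rightarrow> real \<Rightarrow> real" where
  "delay_term K y t = (LBINT s:{0..}. K s * y (t - s))"

definition BC_init :: "(real \<Rightarrow> real) set" where
  "BC_init = {\<phi>. continuous_on {..0} \<phi> \<and> bounded (\<phi> ` {..0})}"

definition init_norm :: "(real \<Rightarrow> real) \<Rightarrow> real" where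
  "init_norm \<phi> = (SUP \<theta>\<in>{..0}. \<bar>\<phi> \<theta>\<bar>)"


section \<open>The unperturbed equation\<close>

text \<open>At time 0 the derivative is one-sided, since the fundamental solution jumps there.\<close>

definition fundamental_solution ::
  "real \<Rightarrow> real \<Rightarrow> (real \<Rightarrow> real) \<Rightarrow> (real \<Rightarrow> real) \<Rightarrow> bool" where
  "fundamental_solution a b K X \<longleftrightarrow>
     X 0 = 1 \<and> (\<forall>t<0. X t = 0) \<and>
     (\<forall>t\<ge>0. (X has_real_derivative (a * X t + b * delay_term K X t)) (at t within {0..}))"

definition laplace :: "(real \<Rightarrow> real) \<Rightarrow> complex \<Rightarrow> complex" where
  "laplace K z = (LBINT t:{0..}. exp (- z * of_real t) * of_real (K t))"

definition char_fun :: "real \<Rightarrow> real \<Rightarrow> (real \<Rightarrow> real) \<Rightarrow> complex \<Rightarrow> complex" where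
  "char_fun a b K z = z - of_real a - of_real b * laplace K z"

text \<open>The integral defining the Laplace transform is 0 by convention where it does not converge,
  so zeros of the characteristic function only count where it is genuinely defined; for \<open>b = 0\<close>
  it is \<open>z - a\<close> on the whole plane.\<close>

definition char_domain :: "real \<Rightarrow> (real \<Rightarrow> real) \<Rightarrow> complex set" where
  "char_domain b K =
     {z. b = 0 \<or> set_integrable lborel {0..} (\<lambda>t. exp (- z * of_real t) * of_real (K t))}"

definition char_roots :: "real \<Rightarrow> real \<Rightarrow> (real \<Rightarrow> real) \<Rightarrow> complex set" where
  "char_roots a b K = {z \<in> char_domain b K. char_fun a b K z = 0}"

text \<open>The supremum is taken in the extended reals: it is \<open>-\<infinity>\<close> if there is no root.\<close>

definition spectral_abscissa :: "real \<Rightarrow> real \<Rightarrow> (real \<Rightarrow> real) \<Rightarrow> ereal" where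
  "spectral_abscissa a b K = (SUP z\<in>char_roots a b K. ereal (Re z))"


section \<open>Wiener process and It\^o integral\<close>

text \<open>Only the part of the filtration and of the processes at times \<open>t \<ge> 0\<close> matters.\<close>

definition wiener_process ::
  "'w measure \<Rightarrow> (real \<Rightarrow> 'w measure) \<Rightarrow> (real \<Rightarrow> 'w \<Rightarrow> real) \<Rightarrow> bool" where
  "wiener_process M F W \<longleftrightarrow>
     prob_space M \<and>
     filtration (space M) F \<and> (\<forall>t. subalgebra M (F t)) \<and>
     (\<forall>t\<ge>0. W t \<in> borel_measurable (F t)) \<and>
     (AE \<omega> in M. W 0 \<omega> = 0) \<and>
     (AE \<omega> in M. continuous_on {0..} (\<lambda>t. W t \<omega>)) \<and>
     (\<forall>s t. 0 \<le> s \<and> s < t \<longrightarrow>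
        distributed M lborel (\<lambda>\<omega>. W t \<omega> - W s \<omega>) (normal_density 0 (sqrt (t - s))) \<and>
        prob_space.indep_set M (sets (F s))
          (sets (vimage_algebra (space M) (\<lambda>\<omega>. W t \<omega> - W s \<omega>) borel)))"

text \<open>\<open>(n, \<tau>, \<xi>)\<close> stands for the step process that equals \<open>\<xi> i\<close> on \<open>(\<tau> i, \<tau> (i + 1)]\<close> for \<open>i < n\<close>.\<close>

type_synonym 'w step_process = "nat \<times> (nat \<Rightarrow> real) \<times> (nat \<Rightarrow> 'w \<Rightarrow> real)"

definition is_step_process ::
  "'w measure \<Rightarrow> (real \<Rightarrow> 'w measure) \<Rightarrow> 'w step_process \<Rightarrow> bool" where
  "is_step_process M F = (\<lambda>(n, \<tau>, \<xi>).
     0 \<le> \<tau> 0 \<and> (\<forall>i<n. \<tau> i \<le> \<tau> (Suc i)) \<and>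
     (\<forall>i<n. \<xi> i \<in> borel_measurable (F (\<tau> i))) \<and>
     (\<exists>B. \<forall>i<n. \<forall>\<omega>\<in>space M. \<bar>\<xi> i \<omega>\<bar> \<le> B))"

definition step_value :: "'w step_process \<Rightarrow> real \<Rightarrow> 'w \<Rightarrow> real" where
  "step_value = (\<lambda>(n, \<tau>, \<xi>) s \<omega>. \<Sum>i<n. \<xi> i \<omega> * indicator {\<tau> i<..\<tau> (Suc i)} s)"

definition step_integral ::
  "(real \<Rightarrow> 'w \<Rightarrow> real) \<Rightarrow> 'w step_process \<Rightarrow> real \<Rightarrow> 'w \<Rightarrow> real" where
  "step_integral W = (\<lambda>(n, \<tau>, \<xi>) t \<omega>.
     \<Sum>i<n. \<xi> i \<omega> * (W (min (\<tau> (Suc i)) t) \<omega> - W (min (\<tau> i) t) \<omega>))"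

definition ito_integrand ::
  "'w measure \<Rightarrow> (real \<Rightarrow> 'w measure) \<Rightarrow> real \<Rightarrow> (real \<Rightarrow> 'w \<Rightarrow> real) \<Rightarrow> bool" where
  "ito_integrand M F t H \<longleftrightarrow>
     (\<lambda>(s, \<omega>). H s \<omega>) \<in> borel_measurable (restrict_space lborel {0..t} \<Otimes>\<^sub>M M) \<and>
     (\<forall>s\<in>{0..t}. H s \<in> borel_measurable (F s)) \<and>
     (\<integral>\<^sup>+\<omega>. (\<integral>\<^sup>+s\<in>{0..t}. ennreal ((H s \<omega>)\<^sup>2) \<partial>lborel) \<partial>M) < \<infinity>"

text \<open>\<open>has_ito_integral M F W t H I\<close>: \<open>I\<close> is (a version of) the It\^o integral of \<open>H\<close> with respect to
  \<open>W\<close> over \<open>[0, t]\<close>, i.e. the mean-square limit of the integrals of step processes approximating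
  \<open>H\<close> in mean square.\<close>

definition has_ito_integral ::
  "'w measure \<Rightarrow> (real \<Rightarrow> 'w measure) \<Rightarrow> (real \<Rightarrow> 'w \<Rightarrow> real) \<Rightarrow> real \<Rightarrow>
   (real \<Rightarrow> 'w \<Rightarrow> real) \<Rightarrow> ('w \<Rightarrow> real) \<Rightarrow> bool" where
  "has_ito_integral M F W t H I \<longleftrightarrow>
     ito_integrand M F t H \<and> I \<in> borel_measurable M \<and>
     (\<exists>G. (\<forall>n::nat. is_step_process M F (G n)) \<and>
        ((\<lambda>n. \<integral>\<^sup>+\<omega>. (\<integral>\<^sup>+s\<in>{0..t}. ennreal ((step_value (G n) s \<omega> - H s \<omega>)\<^sup>2) \<partial>lborel) \<partial>M)
           \<longlonglongrightarrow> 0) \<and>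
        ((\<lambda>n. \<integral>\<^sup>+\<omega>. ennreal ((step_integral W (G n) t \<omega> - I \<omega>)\<^sup>2) \<partial>M) \<longlonglongrightarrow> 0))"


section \<open>The stochastic delay equation\<close>

definition sde_solution ::
  "real \<Rightarrow> real \<Rightarrow> real \<Rightarrow> real \<Rightarrow> real \<Rightarrow> (real \<Rightarrow> real) \<Rightarrow>
   'w measure \<Rightarrow> (real \<Rightarrow> 'w measure) \<Rightarrow> (real \<Rightarrow> 'w \<Rightarrow> real) \<Rightarrow>
   (real \<Rightarrow> real) \<Rightarrow> (real \<Rightarrow> 'w \<Rightarrow> real) \<Rightarrow> bool" where
  "sde_solution a b \<sigma>0 \<sigma>1 \<sigma>2 K M F W \<phi> x \<longleftrightarrow>
     (\<forall>t\<ge>0. x t \<in> borel_measurable (F t)) \<and>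
     (AE \<omega> in M. continuous_on {0..} (\<lambda>t. x t \<omega>)) \<and>
     (AE \<omega> in M. \<forall>\<theta>\<le>0. x \<theta> \<omega> = \<phi> \<theta>) \<and>
     (\<forall>t\<ge>0. \<exists>I.
        has_ito_integral M F W t
          (\<lambda>s \<omega>. \<sigma>0 + \<sigma>1 * x s \<omega> + \<sigma>2 * delay_term K (\<lambda>r. x r \<omega>) s) I \<and>
        (AE \<omega> in M. x t \<omega> =
           \<phi> 0 + (LBINT s:{0..t}. a * x s \<omega> + b * delay_term K (\<lambda>r. x r \<omega>) s) + I \<omega>))"

definition second_moment :: "'w measure \<Rightarrow> ('w \<Rightarrow> real) \<Rightarrow> real" where
  "second_moment M Y = (\<integral>\<omega>. \<bar>Y \<omega> - (\<integral>\<omega>'. Y \<omega>' \<partial>M)\<bar>\<^sup>2 \<partial>M)"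

text \<open>\<open>x \<phi>\<close> is the solution with initial function \<open>\<phi>\<close>. The integrability conditions say that the
  second moment is finite (a divergent Bochner integral would be 0); the bound may depend on
  the initial function only through the square of its norm.\<close>

definition second_moment_bounded ::
  "'w measure \<Rightarrow> ((real \<Rightarrow> real) \<Rightarrow> real \<Rightarrow> 'w \<Rightarrow> real) \<Rightarrow> bool" where
  "second_moment_bounded M x \<longleftrightarrow>
     (\<exists>R :: real \<Rightarrow> real. (\<forall>r. 0 < R r) \<and>
        (\<forall>\<phi>\<in>BC_init. \<forall>t\<ge>0.
           integrable M (x \<phi> t) \<and> integrable M (\<lambda>\<omega>. (x \<phi> t \<omega>)\<^sup>2) \<and>
           second_moment M (x \<phi> t) \<le> R ((init_norm \<phi>)\<^sup>2)))"

end

theory Submission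
  imports Defs "HOL-Complex_Analysis.Complex_Analysis"
begin

text \<open>With additive noise the stochastic integral is \<open>\<sigma>0 W\<close>, so the equation holds pathwise. The
  difference of two paths solves a linear renewal equation, whence
  \<open>x(t) = m(t) + \<sigma>0 N(t)\<close> with \<open>m\<close> deterministic and
  \<open>N(t) = W(t) + \<integral>\<^bsub>0\<^esub>\<^bsup>t\<^esup> X'(t - s) W(s) ds\<close>. From the covariance \<open>min s r\<close> of \<open>W\<close> one
  gets \<open>E N(t) = 0\<close> and \<open>E N(t)\<^sup>2 = \<integral>\<^bsub>0\<^esub>\<^bsup>t\<^esup> X(u)\<^sup>2 du\<close>, so \<open>M(t) = \<sigma>0\<^sup>2 \<integral>\<^bsub>0\<^esub>\<^bsup>t\<^esup> X(u)\<^sup>2 du\<close>.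

  The Laplace transform of \<open>X\<close> is \<open>1/h\<close>. If \<open>h\<close> has no zero with real part at least \<open>\<alpha>\<close>, then
  \<open>1/h(z) - 1/(z - \<alpha> + 1) = O(1/|z - \<alpha> + 1|\<^sup>2)\<close> uniformly on that half-plane; Fourier inversion on a vertical line
  far to the right, followed by shifting the line towards \<open>Re z = \<alpha>\<close>, gives
  \<open>|X(t)| \<le> C e\<^bsup>\<alpha>t\<^esup>\<close>. No margin beyond \<open>\<alpha>\<close> is needed, which covers the case where the transform of \<open>K\<close>
  converges on the line \<open>Re z = \<alpha>\<close> but not to its left. Conversely, if \<open>X\<close> were square integrable, then
  \<open>h(z) L(X)(z) = 1\<close> would hold for all \<open>Re z > 0\<close>, excluding zeros of \<open>h\<close> there.\<close>

section \<open>Convolution on the half-line and delay terms\<close>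

text \<open>Differences of paths are used because the initial function enters every path in the same
  way: the difference vanishes before time 0, so causal convolution calculus applies, and
  \<open>m\<close> needs no formula, since a variance does not see it. \<open>N\<close> is the Ito
  integral of X(t - s) after integration by parts; written with Lebesgue integrals of
  \<open>W\<close> only, it reduces the variance to calculus with \<open>min s r\<close>, and the
  one Ito integral that remains has a constant integrand.

  On the analytic side, \<open>1/h\<close> decays only like 1/|z|, because \<open>X\<close> jumps at
  0, and is therefore not integrable along vertical lines; a decaying exponential with the same jump
  is subtracted to gain one power. On the line Re z = \<alpha> the transform of \<open>K\<close> is
  only known to be continuous, so Cauchy's theorem is applied strictly to its right. The distance is
  chosen at most 1/t, which costs a factor e independent of t.\<close>

definition conv :: "(real \<Rightarrow> real) \<Rightarrow> (real \<Rightarrow> real) \<Rightarrow> real \<Rightarrow> real" where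
  "conv f g t = (LBINT s:{0..t}. f (t - s) * g s)"

lemma conv_commute: "conv f g t = conv g f t"
proof -
  have "conv f g t = (LBINT s. indicator {0..t} s * (f (t - s) * g s))"
    by (simp add: conv_def set_lebesgue_integral_def)
  also have "\<dots> = (LBINT s. indicator {0..t} (t - s) * (f s * g (t - s)))"
    by (subst lborel_integral_real_affine[where c="-1" and t=t]) simp_all
  also have "\<dots> = (LBINT s. indicator {0..t} s * (g (t - s) * f s))"
    by (rule Bochner_Integration.integral_cong) (auto simp: indicator_def)
  finally show ?thesis by (simp add: conv_def set_lebesgue_integral_def)
qed

text \<open>Boundedness of the middle factor dominates the kernel by \<open>B\<close> times a
  function of \<open>s\<close> times a function of \<open>r\<close>, which is integrable on the
  product space. This is the Fubini hypothesis behind associativity of \<open>conv\<close>.\<close>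

lemma integrable_convolution_kernel:
  fixes F H :: "real \<Rightarrow> 'a::{banach,second_countable_topology,real_normed_field}" and G :: "real \<Rightarrow> 'a"
  assumes F: "integrable lborel F" and H: "integrable lborel H"
    and G: "G \<in> borel_measurable borel" and B: "\<And>s. norm (G s) \<le> B"
  shows "integrable (lborel \<Otimes>\<^sub>M lborel) (\<lambda>(s, r). F (T - s) * (G (s - r) * H r))"
proof -
  have [measurable]: "F \<in> borel_measurable borel" "H \<in> borel_measurable borel"
      "G \<in> borel_measurable borel"
    using F H G by auto
  have FT: "integrable lborel (\<lambda>s. F (T - s))"
    using lborel_integrable_real_affine[OF F, of "-1" T] by simp
  have "integrable (lborel \<Otimes>\<^sub>M lborel) (\<lambda>(s, r). B *\<^sub>R (F (T - s) * H r))"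
  proof (rule lborel_pair.Fubini_integrable)
    show "(\<lambda>(s, r). B *\<^sub>R (F (T - s) * H r)) \<in> borel_measurable (lborel \<Otimes>\<^sub>M lborel)"
      by measurable
    show "integrable lborel (\<lambda>x. LBINT y. norm (case (x, y) of (s, r) \<Rightarrow> B *\<^sub>R (F (T - s) * H r)))"
      using FT by (simp add: norm_mult integrable_norm)
    show "AE x in lborel. integrable lborel (\<lambda>y. case (x, y) of (s, r) \<Rightarrow> B *\<^sub>R (F (T - s) * H r))"
      using H by simp
  qed
  then show ?thesis
  proof (rule Bochner_Integration.integrable_bound)
    show "(\<lambda>(s, r). F (T - s) * (G (s - r) * H r)) \<in> borel_measurable (lborel \<Otimes>\<^sub>M lborel)"
      by measurable
    have "0 \<le> B" using B[of 0] norm_ge_zero order_trans by blast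
    show "AE p in lborel \<Otimes>\<^sub>M lborel. norm (case p of (s, r) \<Rightarrow> F (T - s) * (G (s - r) * H r))
        \<le> norm (case p of (s, r) \<Rightarrow> B *\<^sub>R (F (T - s) * H r))"
    proof (intro AE_I2, clarify)
      fix s r
      have "norm (F (T - s)) * (norm (G (s - r)) * norm (H r)) \<le> norm (F (T - s)) * (B * norm (H r))"
        using B by (intro mult_left_mono mult_right_mono) auto
      then show "norm (F (T - s) * (G (s - r) * H r)) \<le> norm (B *\<^sub>R (F (T - s) * H r))"
        using \<open>0 \<le> B\<close> by (simp add: norm_mult mult.left_commute)
    qed
  qed
qed

text \<open>Cutting all three functions off outside [0, T] encodes the triangle 0 \<le> r \<le> s
  \<le> T: the product F(T - s) G(s - r) H(r) vanishes elsewhere. Both iterated convolutions thus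
  become iterated integrals over the plane, and Fubini exchanges them.\<close>

lemma conv_assoc:
  assumes T: "0 \<le> T" and f: "set_integrable lborel {0..T} f" and h: "set_integrable lborel {0..T} h"
    and g: "set_borel_measurable borel {0..T} g" and B: "\<And>s. s \<in> {0..T} \<Longrightarrow> \<bar>g s\<bar> \<le> B"
  shows "conv f (conv g h) T = conv (conv f g) h T"
proof -
  define F where "F s = indicator {0..T} s * f s" for s
  define G where "G s = indicator {0..T} s * g s" for s
  define H where "H s = indicator {0..T} s * h s" for s
  have "0 \<le> B" using B[of 0] T by auto
  have int: "integrable (lborel \<Otimes>\<^sub>M lborel) (\<lambda>(s, r). F (T - s) * (G (s - r) * H r))"
  proof (rule integrable_convolution_kernel)
    show "integrable lborel F" using f by (simp add: set_integrable_def F_def[abs_def])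
    show "integrable lborel H" using h by (simp add: set_integrable_def H_def[abs_def])
    show "G \<in> borel_measurable borel"
      using g by (simp add: set_borel_measurable_def G_def[abs_def])
    show "norm (G s) \<le> B" for s using B \<open>0 \<le> B\<close> by (auto simp: G_def indicator_def)
  qed
  have "conv f (conv g h) T = (LBINT s. LBINT r. F (T - s) * (G (s - r) * H r))"
    unfolding conv_def set_lebesgue_integral_def
  proof (rule Bochner_Integration.integral_cong[OF refl])
    fix s
    show "indicator {0..T} s *\<^sub>R (f (T - s) * (LBINT r. indicator {0..s} r *\<^sub>R (g (s - r) * h r)))
       = (LBINT r. F (T - s) * (G (s - r) * H r))"
    proof (cases "s \<in> {0..T}")
      case True
      have "(LBINT r. G (s - r) * H r) = (LBINT r. indicator {0..s} r *\<^sub>R (g (s - r) * h r))"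
        using True by (intro Bochner_Integration.integral_cong) (auto simp: G_def H_def indicator_def)
      then show ?thesis using True by (simp add: F_def)
    qed (auto simp: F_def)
  qed
  also have "\<dots> = (LBINT r. LBINT s. F (T - s) * (G (s - r) * H r))"
    using lborel_pair.Fubini_integral[OF int] by simp
  also have "\<dots> = conv (conv f g) h T"
    unfolding conv_def set_lebesgue_integral_def
  proof (rule Bochner_Integration.integral_cong[OF refl])
    fix r
    show "(LBINT s. F (T - s) * (G (s - r) * H r))
      = indicator {0..T} r *\<^sub>R ((LBINT s. indicator {0..T - r} s *\<^sub>R (f (T - r - s) * g s)) * h r)"
    proof (cases "r \<in> {0..T}")
      case True
      have "(LBINT s. F (T - s) * G (s - r)) = (LBINT s. F (T - (r + s)) * G s)"
        by (subst lborel_integral_real_affine[where c=1 and t=r]) (simp_all add: algebra_simps)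
      also have "\<dots> = (LBINT s. indicator {0..T - r} s *\<^sub>R (f (T - r - s) * g s))"
        using True by (intro Bochner_Integration.integral_cong)
          (auto simp: F_def G_def indicator_def algebra_simps)
      finally have e: "(LBINT s. F (T - s) * G (s - r)) = (LBINT s. indicator {0..T - r} s *\<^sub>R (f (T - r - s) * g s))" .
      have "(LBINT s. F (T - s) * (G (s - r) * H r)) = (LBINT s. (F (T - s) * G (s - r)) * H r)"
        by (simp add: mult.assoc)
      also have "\<dots> = (LBINT s. F (T - s) * G (s - r)) * H r"
        by simp
      finally show ?thesis using True e by (simp add: H_def)
    qed (auto simp: H_def)
  qed
  finally show ?thesis .
qed

text \<open>\<open>K\<close> is arbitrary on the negative axis, so only its truncation is known to
  be measurable; the indicator is attached to \<open>K\<close> before the product with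
  \<open>g\<close> is formed.\<close>

lemma measurable_weighted_kernel:
  fixes K :: "real \<Rightarrow> real" and g :: "real \<Rightarrow> 'a::{real_normed_field,second_countable_topology}"
  assumes K: "set_integrable lborel {0..} K" and g: "g \<in> borel_measurable borel"
  shows "(\<lambda>t. indicator {0..} t *\<^sub>R (g t * of_real (K t))) \<in> borel_measurable lborel"
proof -
  have "(\<lambda>t. indicator {0..} t *\<^sub>R K t) \<in> borel_measurable lborel"
    using K unfolding set_integrable_def by (rule borel_measurable_integrable)
  then have "(\<lambda>t. g t * of_real (indicator {0..} t *\<^sub>R K t)) \<in> borel_measurable lborel"
    using g by measurable
  also have "(\<lambda>t. g t * of_real (indicator {0..} t *\<^sub>R K t)) = (\<lambda>t. indicator {0..} t *\<^sub>R (g t * of_real (K t)))"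
    by (auto simp: indicator_def)
  finally show ?thesis .
qed

lemma set_integrable_dominated:
  fixes f :: "real \<Rightarrow> real" and g :: "real \<Rightarrow> 'a::{banach,second_countable_topology}"
  assumes "set_integrable lborel A f" "(\<lambda>s. indicator A s *\<^sub>R g s) \<in> borel_measurable lborel"
    and "\<And>s. s \<in> A \<Longrightarrow> norm (g s) \<le> f s"
  shows "set_integrable lborel A g"
  using assms by (intro set_integrable_bound[OF assms(1)] AE_I2)
    (auto simp: set_borel_measurable_def intro: order_trans[OF _ abs_ge_self])

section \<open>Integrability, continuity and size of the delay term\<close>

lemma integrable_delay:
  fixes y :: "real \<Rightarrow> real"
  assumes K: "set_integrable lborel {0..} K" and y: "y \<in> borel_measurable borel"
    and B: "\<And>u. u \<le> t \<Longrightarrow> \<bar>y u\<bar> \<le> B"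
  shows "set_integrable lborel {0..} (\<lambda>s. K s * y (t - s))"
proof (rule set_integrable_dominated)
  show "set_integrable lborel {0..} (\<lambda>s. B * \<bar>K s\<bar>)" using set_integrable_abs[OF K] by simp
  have "(\<lambda>s. y (t - s)) \<in> borel_measurable borel" using y by measurable
  then show "(\<lambda>s. indicator {0..} s *\<^sub>R (K s * y (t - s))) \<in> borel_measurable lborel"
    using measurable_weighted_kernel[OF K, of "\<lambda>s. y (t - s)"] by (simp add: mult.commute[of "K _"])
  show "norm (K s * y (t - s)) \<le> B * \<bar>K s\<bar>" if "s \<in> {0..}" for s
    using B[of "t - s"] that by (simp add: abs_mult mult.commute[of "\<bar>K s\<bar>"] mult_right_mono)
qed

text \<open>A jump of \<open>y\<close> at 0 does no harm: the integrand meets it only at s = t, a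
  null set. Bounds on left half-lines suffice for dominated convergence because a convergent
  sequence of times is bounded above.\<close>

lemma isCont_delay_term:
  fixes y :: "real \<Rightarrow> real"
  assumes K: "set_integrable lborel {0..} K" and y: "y \<in> borel_measurable borel"
    and cont: "\<And>u. u \<noteq> 0 \<Longrightarrow> isCont y u"
    and bdd: "\<And>T. \<exists>B. \<forall>u\<le>T. \<bar>y u\<bar> \<le> B"
  shows "isCont (delay_term K y) t"
  unfolding continuous_at_sequentially comp_def
proof (intro allI impI)
  fix u :: "nat \<Rightarrow> real" assume u: "u \<longlonglongrightarrow> t"
  then have "Bseq u" by (rule convergent_imp_Bseq[OF convergentI])
  then obtain T where T: "\<And>n. u n \<le> T" by (metis BseqD abs_le_D1 real_norm_def)
  then have tT: "t \<le> T" using u LIMSEQ_le_const2 by blast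
  obtain B where B: "\<And>v. v \<le> T \<Longrightarrow> \<bar>y v\<bar> \<le> B" using bdd by blast
  have m: "(\<lambda>s. indicator {0..} s *\<^sub>R (K s * y (v - s))) \<in> borel_measurable lborel" if "v \<le> T" for v
    using integrable_delay[OF K y, of v B] B that by (auto simp: set_integrable_def)
  show "(\<lambda>n. delay_term K y (u n)) \<longlonglongrightarrow> delay_term K y t"
    unfolding delay_term_def set_lebesgue_integral_def
  proof (rule integral_dominated_convergence[where w="\<lambda>s. \<bar>B\<bar> * \<bar>indicator {0..} s *\<^sub>R K s\<bar>"])
    show "integrable lborel (\<lambda>s. \<bar>B\<bar> * \<bar>indicator {0..} s *\<^sub>R K s\<bar>)"
      using K by (auto simp: set_integrable_def)
    have "AE s in lborel. s \<noteq> t" by (rule AE_lborel_singleton)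
    then show "AE s in lborel. (\<lambda>n. indicator {0..} s *\<^sub>R (K s * y (u n - s)))
        \<longlonglongrightarrow> indicator {0..} s *\<^sub>R (K s * y (t - s))"
    proof eventually_elim
      case (elim s)
      have "(\<lambda>n. y (u n - s)) \<longlonglongrightarrow> y (t - s)"
        by (rule isCont_tendsto_compose[OF cont]) (use elim u in \<open>auto intro!: tendsto_intros\<close>)
      then show ?case by (intro tendsto_intros)
    qed
    show "AE s in lborel. norm (indicator {0..} s *\<^sub>R (K s * y (u n - s)))
        \<le> \<bar>B\<bar> * \<bar>indicator {0..} s *\<^sub>R K s\<bar>" for n
    proof (rule AE_I2)
      fix s :: real
      show "norm (indicator {0..} s *\<^sub>R (K s * y (u n - s))) \<le> \<bar>B\<bar> * \<bar>indicator {0..} s *\<^sub>R K s\<bar>"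
      proof (cases "0 \<le> s")
        case True
        then have "\<bar>y (u n - s)\<bar> \<le> \<bar>B\<bar>" using B[of "u n - s"] T[of n] by fastforce
        then show ?thesis using True by (simp add: abs_mult mult.commute[of "\<bar>K s\<bar>"] mult_right_mono)
      qed simp
    qed
  qed (use m T tT in auto)
qed

lemma abs_delay_term_le:
  assumes K: "set_integrable lborel {0..} K" and y: "y \<in> borel_measurable borel"
    and B: "\<And>u. u \<le> t \<Longrightarrow> \<bar>y u\<bar> \<le> B"
  shows "\<bar>delay_term K y t\<bar> \<le> B * (LBINT s:{0..}. \<bar>K s\<bar>)"
proof -
  have "0 \<le> B" using B[of t] by auto
  have KA: "set_integrable lborel {0..} (\<lambda>s. \<bar>K s\<bar>)" by (rule set_integrable_abs[OF K])
  have i: "set_integrable lborel {0..} (\<lambda>s. K s * y (t - s))"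
    by (rule integrable_delay[OF K y B])
  have "\<bar>delay_term K y t\<bar> \<le> (LBINT s:{0..}. \<bar>K s * y (t - s)\<bar>)"
    unfolding delay_term_def using set_integral_norm_bound[OF i] by simp
  also have "\<dots> \<le> (LBINT s:{0..}. B * \<bar>K s\<bar>)"
  proof (rule set_integral_mono)
    show "set_integrable lborel {0..} (\<lambda>s. \<bar>K s * y (t - s)\<bar>)" by (rule set_integrable_abs[OF i])
    show "set_integrable lborel {0..} (\<lambda>s. B * \<bar>K s\<bar>)" using KA by simp
    show "\<bar>K s * y (t - s)\<bar> \<le> B * \<bar>K s\<bar>" if "s \<in> {0..}" for s
      using B[of "t - s"] that by (simp add: abs_mult mult.commute[of "\<bar>K s\<bar>"] mult_right_mono)
  qed
  finally show ?thesis by simp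
qed

lemma delay_term_causal:
  assumes "\<And>u. u < 0 \<Longrightarrow> y u = 0"
  shows "delay_term K y t = conv K y t"
proof -
  have "delay_term K y t = conv y K t"
    unfolding delay_term_def conv_def set_lebesgue_integral_def
    using assms by (intro Bochner_Integration.integral_cong) (auto simp: indicator_def)
  then show ?thesis by (simp add: conv_commute)
qed

section \<open>The fundamental solution and variation of constants\<close>

lemma conv_cong:
  assumes "\<And>s. s \<in> {0..t} \<Longrightarrow> f s = f' s" "\<And>s. s \<in> {0..t} \<Longrightarrow> g s = g' s"
  shows "conv f g t = conv f' g' t"
  unfolding conv_def by (rule set_lebesgue_integral_cong) (use assms in auto)

lemma continuous_on_Icc_bounded:
  fixes f :: "real \<Rightarrow> real"
  assumes "continuous_on {a..b} f"
  obtains B where "\<And>s. s \<in> {a..b} \<Longrightarrow> \<bar>f s\<bar> \<le> B"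
proof -
  have "bounded (f ` {a..b})"
    by (rule compact_imp_bounded[OF compact_continuous_image[OF assms compact_Icc]])
  then obtain B where "\<forall>x\<in>f ` {a..b}. \<bar>x\<bar> \<le> B" by (auto simp: bounded_real)
  then show ?thesis using that by blast
qed

lemma set_integrable_conv:
  fixes f g :: "real \<Rightarrow> real"
  assumes f: "set_integrable lborel {0..t} f" and g: "continuous_on {0..t} g"
  shows "set_integrable lborel {0..t} (\<lambda>s. f (t - s) * g s)"
proof -
  have "integrable lborel (\<lambda>s. indicator {0..t} (t - s) *\<^sub>R f (t - s))"
    using lborel_integrable_real_affine[OF f[unfolded set_integrable_def], of "-1" t] by simp
  also have "(\<lambda>s. indicator {0..t} (t - s) *\<^sub>R f (t - s)) = (\<lambda>s. indicator {0..t} s *\<^sub>R f (t - s))"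
    by (auto simp: indicator_def)
  finally have F: "set_integrable lborel {0..t} (\<lambda>s. f (t - s))"
    by (simp add: set_integrable_def)
  obtain B where B: "\<And>s. s \<in> {0..t} \<Longrightarrow> \<bar>g s\<bar> \<le> B"
    using continuous_on_Icc_bounded[OF g] by blast
  have gm: "(\<lambda>s. indicator {0..t} s * g s) \<in> borel_measurable lborel"
    using borel_measurable_continuous_on_indicator[OF _ g] by simp
  show ?thesis
  proof (rule set_integrable_dominated)
    show "set_integrable lborel {0..t} (\<lambda>s. B * \<bar>f (t - s)\<bar>)" using set_integrable_abs[OF F] by simp
    have "(\<lambda>s. (indicator {0..t} s *\<^sub>R f (t - s)) * (indicator {0..t} s * g s)) \<in> borel_measurable lborel"
      using F by (intro borel_measurable_times gm) (unfold set_integrable_def, rule borel_measurable_integrable)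
    then show "(\<lambda>s. indicator {0..t} s *\<^sub>R (f (t - s) * g s)) \<in> borel_measurable lborel"
      by (rule iffD1[OF measurable_cong, rotated]) (auto simp: indicator_def)
    show "norm (f (t - s) * g s) \<le> B * \<bar>f (t - s)\<bar>" if "s \<in> {0..t}" for s
      using B[OF that] by (simp add: abs_mult mult.commute[of "\<bar>f (t - s)\<bar>"] mult_right_mono)
  qed
qed

lemma conv_add_right:
  assumes "set_integrable lborel {0..t} f" "continuous_on {0..t} g" "continuous_on {0..t} h"
  shows "conv f (\<lambda>s. g s + h s) t = conv f g t + conv f h t"
  unfolding conv_def distrib_left
  by (intro set_integral_add set_integrable_conv assms)

lemma conv_cmult_right: "conv f (\<lambda>s. c * g s) t = c * conv f g t"
  by (simp add: conv_def mult.left_commute[of _ c])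

lemma conv_add_left:
  assumes "continuous_on {0..t} f" "continuous_on {0..t} g" "continuous_on {0..t} h"
  shows "conv (\<lambda>s. f s + g s) h t = conv f h t + conv g h t"
proof -
  have "set_integrable lborel {0..t} h" using assms(3) by (rule borel_integrable_atLeastAtMost')
  from conv_add_right[OF this assms(1,2)] show ?thesis by (simp add: conv_commute[of _ h])
qed

lemma conv_cmult_left: "conv (\<lambda>s. c * f s) g t = c * conv f g t"
  by (simp add: conv_def mult.assoc)

lemma conv_assoc_continuous:
  assumes T: "0 \<le> T" and f: "set_integrable lborel {0..T} f"
    and g: "continuous_on {0..T} g" and h: "continuous_on {0..T} h"
  shows "conv f (conv g h) T = conv (conv f g) h T"
proof -
  obtain B where B: "\<And>s. s \<in> {0..T} \<Longrightarrow> \<bar>g s\<bar> \<le> B"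
    using continuous_on_Icc_bounded[OF g] by blast
  show ?thesis
    by (rule conv_assoc[OF T f borel_integrable_atLeastAtMost'[OF h] _ B])
      (auto intro!: set_measurable_continuous_on g)
qed

abbreviation one_fun :: "real \<Rightarrow> real" where "one_fun \<equiv> \<lambda>_. 1"

text \<open>Supplies the hypotheses of \<open>isCont_delay_term\<close> for functions that start at
  time 0, possibly with a jump, such as \<open>X\<close>.\<close>

lemma continuous_causal_bounded:
  fixes y :: "real \<Rightarrow> real"
  assumes "continuous_on {0..} y" "\<And>u. u < 0 \<Longrightarrow> y u = 0"
  shows "y \<in> borel_measurable borel" "u \<noteq> 0 \<Longrightarrow> isCont y u" "\<exists>B. \<forall>u\<le>T. \<bar>y u\<bar> \<le> B"
proof -
  have "(\<lambda>s. indicator {0..} s *\<^sub>R y s) \<in> borel_measurable borel"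
    by (rule borel_measurable_continuous_on_indicator[OF _ assms(1)]) simp
  moreover have "(\<lambda>s. indicator {0..} s *\<^sub>R y s) = y"
    using assms(2) by (force simp: indicator_def)
  ultimately show "y \<in> borel_measurable borel" by simp
  show "isCont y u" if "u \<noteq> 0"
  proof (cases "0 < u")
    case True
    have "continuous_on {0<..} y" using assms(1) by (rule continuous_on_subset) auto
    then show ?thesis using True by (simp add: continuous_on_eq_continuous_at)
  next
    case False
    have "continuous_on {..<0} y"
      by (rule continuous_on_eq[where f="\<lambda>_. 0"]) (use assms(2) in auto)
    then show ?thesis using False that by (simp add: continuous_on_eq_continuous_at)
  qed
  have "continuous_on {0..T} y" using assms(1) by (rule continuous_on_subset) auto
  then obtain B where B: "\<And>s. s \<in> {0..T} \<Longrightarrow> \<bar>y s\<bar> \<le> B"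
    using continuous_on_Icc_bounded by blast
  have "\<bar>y u\<bar> \<le> \<bar>B\<bar>" if "u \<le> T" for u
    using B[of u] assms(2)[of u] that by (cases "u < 0") auto
  then show "\<exists>B. \<forall>u\<le>T. \<bar>y u\<bar> \<le> B" by blast
qed

lemma continuous_delay_term_causal:
  assumes "set_integrable lborel {0..} K" "continuous_on {0..} y" "\<And>u. u < 0 \<Longrightarrow> y u = (0::real)"
  shows "continuous_on S (delay_term K y)"
  using isCont_delay_term[OF assms(1) continuous_causal_bounded[OF assms(2,3)]]
  by (intro continuous_at_imp_continuous_on) auto

lemma set_integrable_kernel:
  "set_integrable lborel {0..} K \<Longrightarrow> set_integrable lborel {0..t::real} (K :: real \<Rightarrow> real)"
  by (rule set_integrable_subset) auto

text \<open>The primitive of \<open>K\<close> is the delay term of the unit step, so its continuity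
  is a case of \<open>continuous_delay_term_causal\<close>.\<close>

lemma continuous_conv_one:
  assumes K: "set_integrable lborel {0..} K"
  shows "continuous_on S (conv K one_fun)"
proof -
  have "continuous_on {0..} (indicator {0..} :: real \<Rightarrow> real)"
    by (rule continuous_on_eq[where f="\<lambda>_. 1"]) (auto simp: indicator_def)
  then have "continuous_on S (delay_term K (indicator {0..}))"
    by (intro continuous_delay_term_causal K) auto
  moreover have "delay_term K (indicator {0..}) t = conv K one_fun t" for t
    by (subst delay_term_causal) (auto simp: indicator_def intro!: conv_cong)
  then have "delay_term K (indicator {0..}) = conv K one_fun" by (rule ext)
  ultimately show ?thesis by simp
qed

text \<open>This is X' on the half-line, one-sided at 0. The right-hand side of the equation is used
  instead of a derivative operator, so that continuity follows from that of the delay term.\<close>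

definition fundamental_rate where
  "fundamental_rate a b K X t = a * X t + b * delay_term K X t"

text \<open>The kernel of the Volterra equation that results when the delay equation is integrated
  over [0, t] and the order of integration is exchanged. Its resolvent is X'.\<close>

definition integrated_kernel where
  "integrated_kernel a b K t = a + b * conv K one_fun t"

lemma fundamental_solution_continuous:
  assumes "fundamental_solution a b K X"
  shows "continuous_on {0..} X"
  using assms unfolding fundamental_solution_def
  by (intro DERIV_continuous_on[where D="\<lambda>t. a * X t + b * delay_term K X t"]) auto

lemma fundamental_solution_causal: "fundamental_solution a b K X \<Longrightarrow> u < 0 \<Longrightarrow> X u = 0"
  by (simp add: fundamental_solution_def)

lemma fundamental_solution_measurable:
  "fundamental_solution a b K X \<Longrightarrow> X \<in> borel_measurable borel"
  using continuous_causal_bounded(1)[OF fundamental_solution_continuous] fundamental_solution_causal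
  by blast

lemma continuous_fundamental_rate:
  assumes X: "fundamental_solution a b K X" and K: "set_integrable lborel {0..} K"
  shows "continuous_on {0..} (fundamental_rate a b K X)"
  unfolding fundamental_rate_def
  by (intro continuous_intros fundamental_solution_continuous[OF X]
      continuous_delay_term_causal[OF K] fundamental_solution_causal[OF X])

lemma fundamental_solution_deriv:
  assumes X: "fundamental_solution a b K X" and "0 \<le> s" "s \<le> u" "u \<le> t"
  shows "(X has_vector_derivative fundamental_rate a b K X u) (at u within {s..t})"
proof -
  have "(X has_real_derivative fundamental_rate a b K X u) (at u within {0..})"
    using assms by (simp add: fundamental_solution_def fundamental_rate_def)
  then have "(X has_real_derivative fundamental_rate a b K X u) (at u within {s..t})"
    by (rule DERIV_subset) (use assms in auto)
  then show ?thesis by (simp add: has_real_derivative_iff_has_vector_derivative)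
qed

lemma fundamental_solution_FTC:
  assumes X: "fundamental_solution a b K X" and K: "set_integrable lborel {0..} K"
    and "0 \<le> s" "s \<le> t"
  shows "(LBINT u:{s..t}. fundamental_rate a b K X u) = X t - X s"
  unfolding set_lebesgue_integral_def
proof (rule integral_FTC_atLeastAtMost)
  show "continuous_on {s..t} (fundamental_rate a b K X)"
    using continuous_fundamental_rate[OF X K] by (rule continuous_on_subset) (use assms in auto)
qed (use fundamental_solution_deriv[OF X] assms in auto)

text \<open>Substituting X = 1 + 1 * D into D = a X + b K * X and moving the constant function onto
  \<open>K\<close> by associativity turns the equation for \<open>X\<close> into the resolvent
  equation for its derivative.\<close>

lemma fundamental_rate_renewal:
  assumes X: "fundamental_solution a b K X" and K: "set_integrable lborel {0..} K"
    and t: "0 \<le> t"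
  defines "D \<equiv> fundamental_rate a b K X" and "R \<equiv> integrated_kernel a b K"
  shows "D t = R t + conv R D t"
proof -
  have D: "continuous_on {0..t} D"
    unfolding D_def using continuous_fundamental_rate[OF X K] by (rule continuous_on_subset) auto
  have cX: "continuous_on {0..t} X"
    using fundamental_solution_continuous[OF X] by (rule continuous_on_subset) auto
  have Xe: "X s = 1 + conv one_fun D s" if "s \<in> {0..t}" for s
    using fundamental_solution_FTC[OF X K, of 0 s] X that
    by (simp add: conv_def D_def fundamental_solution_def)
  have c1: "continuous_on {0..t} (conv one_fun D)"
    by (rule continuous_on_eq[where f="\<lambda>s. X s - 1"]) (use Xe cX in \<open>auto intro!: continuous_intros\<close>)
  note Kt = set_integrable_kernel[OF K, of t]
  have "conv K X t = conv K (\<lambda>s. 1 + conv one_fun D s) t"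
    by (rule conv_cong) (use Xe in auto)
  also have "\<dots> = conv K one_fun t + conv K (conv one_fun D) t"
    by (intro conv_add_right Kt c1 continuous_intros)
  also have "conv K (conv one_fun D) t = conv (conv K one_fun) D t"
    by (intro conv_assoc_continuous t Kt D continuous_intros)
  finally have "D t = a * (1 + conv one_fun D t) + b * (conv K one_fun t + conv (conv K one_fun) D t)"
    unfolding D_def fundamental_rate_def[of a b K X t]
    using delay_term_causal[of X K t] fundamental_solution_causal[OF X] Xe[of t] t
    by (simp add: D_def)
  moreover have "conv R D t = conv (\<lambda>_. a * 1) D t + conv (\<lambda>s. b * conv K one_fun s) D t"
    unfolding R_def integrated_kernel_def
    by (simp, intro conv_add_left D continuous_intros continuous_conv_one K)
  ultimately show ?thesis
    by (simp only: conv_cmult_left) (simp add: R_def integrated_kernel_def algebra_simps)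
qed

text \<open>In convolution notation, \<open>z = w + R * z\<close> and \<open>D = R + R * D\<close>; hence
  \<open>D * z = D * w + (D * R) * z\<close> gives \<open>R * z = (D - R * D) * z = D * w\<close>.\<close>

lemma variation_of_constants:
  assumes X: "fundamental_solution a b K X" and K: "set_integrable lborel {0..} K"
    and z: "continuous_on {0..} z" and z0: "\<And>u. u < 0 \<Longrightarrow> z u = 0"
    and w: "continuous_on {0..} w"
    and eq: "\<And>t. 0 \<le> t \<Longrightarrow> z t = w t + (LBINT s:{0..t}. a * z s + b * delay_term K z s)"
    and t: "0 \<le> t"
  shows "z t = w t + (LBINT s:{0..t}. fundamental_rate a b K X (t - s) * w s)"
proof -
  define D where "D = fundamental_rate a b K X"
  define R where "R = integrated_kernel a b K"
  have cont: "continuous_on {0..s} f" if "continuous_on {0..} f" for s and f :: "real \<Rightarrow> real"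
    using that by (rule continuous_on_subset) auto
  note int = borel_integrable_atLeastAtMost'
  have D: "continuous_on {0..} D"
    unfolding D_def by (rule continuous_fundamental_rate[OF X K])
  have R: "continuous_on S R" for S
    unfolding R_def integrated_kernel_def by (intro continuous_intros continuous_conv_one K)
  have zK: "continuous_on S (conv K z)" for S
  proof -
    have "delay_term K z = conv K z" by (rule ext) (rule delay_term_causal[OF z0])
    then show ?thesis using continuous_delay_term_causal[OF K z z0, of S] by simp
  qed
  have renewal: "z s = w s + conv R z s" if s: "0 \<le> s" for s
  proof -
    have "z s = w s + (LBINT r:{0..s}. a * z r + b * conv K z r)"
      using eq[OF s] delay_term_causal[of z K] z0 by simp
    also have "(LBINT r:{0..s}. a * z r + b * conv K z r)
        = conv one_fun (\<lambda>r. a * z r + b * conv K z r) s"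
      by (simp add: conv_def)
    also have "\<dots> = conv one_fun (\<lambda>r. a * z r) s + conv one_fun (\<lambda>r. b * conv K z r) s"
      by (intro conv_add_right int continuous_intros cont z zK)
    also have "\<dots> = a * conv one_fun z s + b * conv one_fun (conv K z) s"
      by (simp only: conv_cmult_right)
    \<comment> \<open>\<open>K\<close> is only integrable, while
      \<open>conv_assoc_continuous\<close> wants continuity of the middle and last factors; the
      commutations keep \<open>K\<close> in front.\<close>
    also have "conv one_fun (conv K z) s = conv (conv K z) one_fun s" by (rule conv_commute)
    also have "\<dots> = conv K (conv z one_fun) s"
      by (rule conv_assoc_continuous[symmetric])
        (intro s set_integrable_kernel K cont z continuous_intros)+
    also have "\<dots> = conv K (conv one_fun z) s"
      by (rule conv_cong) (auto simp: conv_commute)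
    also have "\<dots> = conv (conv K one_fun) z s"
      by (rule conv_assoc_continuous) (intro s set_integrable_kernel K cont z continuous_intros)+
    also have "a * conv one_fun z s + b * conv (conv K one_fun) z s
        = conv (\<lambda>_. a * 1) z s + conv (\<lambda>s. b * conv K one_fun s) z s"
      by (simp only: conv_cmult_left)
    also have "\<dots> = conv R z s"
      unfolding R_def integrated_kernel_def
      by (subst conv_add_left[symmetric]) (simp_all, (intro cont z continuous_intros continuous_conv_one K)+)
    finally show ?thesis .
  qed
  have DR: "D s = R s + conv R D s" if "0 \<le> s" for s
    unfolding D_def R_def by (rule fundamental_rate_renewal[OF X K that])
  \<comment> \<open>Continuity of this convolution, and of the next one, is read off the renewal
    equation that it satisfies.\<close>
  have cRz: "continuous_on {0..t} (conv R z)"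
    by (rule continuous_on_eq[where f="\<lambda>s. z s - w s"])
      (use renewal in \<open>auto intro!: continuous_intros cont z w\<close>)
  have cRD: "continuous_on {0..t} (conv R D)"
    by (rule continuous_on_eq[where f="\<lambda>s. D s - R s"])
      (use DR in \<open>auto intro!: continuous_intros cont D R\<close>)
  have "conv D z t = conv D (\<lambda>s. w s + conv R z s) t"
    by (rule conv_cong) (use renewal in auto)
  also have "\<dots> = conv D w t + conv D (conv R z) t"
    by (intro conv_add_right int cRz cont D w)
  also have "conv D (conv R z) t = conv (conv D R) z t"
    by (rule conv_assoc_continuous) (intro t int cont D z R)+
  also have "\<dots> = conv (conv R D) z t"
    by (rule conv_cong) (auto simp: conv_commute)
  finally have 1: "conv D z t = conv D w t + conv (conv R D) z t" .
  have "conv D z t = conv (\<lambda>s. R s + conv R D s) z t"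
    by (rule conv_cong) (use DR in auto)
  also have "\<dots> = conv R z t + conv (conv R D) z t"
    by (intro conv_add_left cRD cont z R)
  finally have "conv R z t = conv D w t" using 1 by simp
  then show ?thesis using renewal[OF t] by (simp add: conv_def D_def)
qed

text \<open>A weighted maximum replaces Gronwall's inequality. Let \<open>m\<close> be the maximum
  of |X(s)| exp(-c s) on [0, T]. The integrated equation gives m \<le> 1 + (c - 1) m / c, and the
  summand 1 in \<open>c\<close> makes the factor less than 1, so that m \<le> c for every T. The
  crude rate serves to make the Laplace transform of \<open>X\<close> converge far to the
  right.\<close>

lemma fundamental_solution_growth:
  assumes X: "fundamental_solution a b K X" and K: "set_integrable lborel {0..} K"
  shows "\<exists>c>0. \<forall>t\<ge>0. \<bar>X t\<bar> \<le> c * exp (c * t)"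
proof -
  define k where "k = (LBINT s:{0..}. \<bar>K s\<bar>)"
  define c where "c = \<bar>a\<bar> + \<bar>b\<bar> * k + 1"
  have "0 \<le> k" unfolding k_def set_lebesgue_integral_def by (rule integral_nonneg_AE) auto
  then have c: "1 \<le> c" by (simp add: c_def)
  have "\<bar>X T\<bar> \<le> c * exp (c * T)" if T: "0 \<le> T" for T
  proof -
    define g where "g s = \<bar>X s\<bar> * exp (- c * s)" for s
    have "continuous_on {0..T} g"
      unfolding g_def
      by (intro continuous_intros continuous_on_subset[OF fundamental_solution_continuous[OF X]]) auto
    then obtain p where p: "p \<in> {0..T}" "\<And>s. s \<in> {0..T} \<Longrightarrow> g s \<le> g p"
      using continuous_attains_sup[of "{0..T}" g] T by auto
    define m where "m = g p"
    have m0: "0 \<le> m" by (simp add: m_def g_def)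
    have Xm: "\<bar>X s\<bar> \<le> m * exp (c * s)" if "s \<le> T" for s
    proof (cases "s < 0")
      case True
      then show ?thesis using fundamental_solution_causal[OF X, of s] m0 by simp
    next
      case False
      then have "\<bar>X s\<bar> * exp (- c * s) \<le> m" using p(2)[of s] that by (simp add: m_def g_def)
      then show ?thesis by (simp add: exp_minus field_simps)
    qed
    have Dm: "\<bar>fundamental_rate a b K X s\<bar> \<le> (c - 1) * m * exp (c * s)" if s: "s \<le> T" for s
    proof -
      have "\<bar>delay_term K X s\<bar> \<le> m * exp (c * s) * k"
        unfolding k_def
      proof (rule abs_delay_term_le[OF K])
        show "X \<in> borel_measurable borel" by (rule fundamental_solution_measurable[OF X])
        fix u assume u: "u \<le> s"
        have "\<bar>X u\<bar> \<le> m * exp (c * u)" using Xm u s by simp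
        also have "\<dots> \<le> m * exp (c * s)" using u c m0 by (intro mult_left_mono) auto
        finally show "\<bar>X u\<bar> \<le> m * exp (c * s)" .
      qed
      then have "\<bar>a * X s + b * delay_term K X s\<bar> \<le> \<bar>a\<bar> * (m * exp (c * s)) + \<bar>b\<bar> * (m * exp (c * s) * k)"
        by (intro order_trans[OF abs_triangle_ineq] add_mono) (auto simp: abs_mult intro!: mult_left_mono Xm s)
      then show ?thesis by (simp add: fundamental_rate_def c_def algebra_simps)
    qed
    have cD: "set_integrable lborel {0..p} (fundamental_rate a b K X)"
      by (rule borel_integrable_atLeastAtMost'[OF continuous_on_subset[OF continuous_fundamental_rate[OF X K]]]) auto
    have cE: "set_integrable lborel {0..p} (\<lambda>s. (c - 1) * m * exp (c * s))"
      by (rule borel_integrable_atLeastAtMost') (intro continuous_intros)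
    have "X p = 1 + (LBINT s:{0..p}. fundamental_rate a b K X s)"
      using fundamental_solution_FTC[OF X K, of 0 p] p(1) X by (simp add: fundamental_solution_def)
    then have "\<bar>X p\<bar> \<le> 1 + \<bar>LBINT s:{0..p}. fundamental_rate a b K X s\<bar>" by linarith
    also have "\<bar>LBINT s:{0..p}. fundamental_rate a b K X s\<bar> \<le> (LBINT s:{0..p}. \<bar>fundamental_rate a b K X s\<bar>)"
      using set_integral_norm_bound[OF cD] by simp
    also have "\<dots> \<le> (LBINT s:{0..p}. (c - 1) * m * exp (c * s))"
      by (rule set_integral_mono[OF set_integrable_abs[OF cD] cE]) (use Dm p in auto)
    also have "\<dots> = (c - 1) * m / c * exp (c * p) - (c - 1) * m / c * exp (c * 0)"
      unfolding set_lebesgue_integral_def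
    proof (rule integral_FTC_atLeastAtMost)
      show "((\<lambda>s. (c - 1) * m / c * exp (c * s)) has_vector_derivative (c - 1) * m * exp (c * s)) (at s within {0..p})" for s
        unfolding has_real_derivative_iff_has_vector_derivative[symmetric]
        using c by (auto intro!: derivative_eq_intros simp: field_simps)
    qed (use p in \<open>auto intro!: continuous_intros\<close>)
    also have "\<dots> \<le> (c - 1) * m / c * exp (c * p)" using c m0 by simp
    finally have "\<bar>X p\<bar> \<le> 1 + (c - 1) * m / c * exp (c * p)" by simp
    then have "m * exp (c * p) \<le> 1 + (c - 1) * m / c * exp (c * p)"
      by (simp add: m_def g_def exp_minus field_simps)
    also have "\<dots> \<le> exp (c * p) + (c - 1) * m / c * exp (c * p)" using c p by simp
    finally have "m * exp (c * p) \<le> (1 + (c - 1) * m / c) * exp (c * p)" by (simp add: algebra_simps)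
    then have "m \<le> 1 + (c - 1) * m / c" by simp
    then have "m \<le> c" using c by (simp add: field_simps)
    then show ?thesis using Xm[of T] by (smt (verit) exp_gt_zero mult_right_mono)
  qed
  then show ?thesis using c by (intro exI[of _ c]) auto
qed

section \<open>The Laplace transform of the fundamental solution\<close>

lemma integral_convolution:
  fixes f g :: "real \<Rightarrow> complex"
  assumes f: "integrable lborel f" and g: "integrable lborel g"
  shows "integrable lborel (\<lambda>t. LBINT s. f s * g (t - s))"
    "(LBINT t. LBINT s. f s * g (t - s)) = (LBINT s. f s) * (LBINT t. g t)"
proof -
  have [measurable]: "f \<in> borel_measurable borel" "g \<in> borel_measurable borel" using f g by auto
  have shift: "integrable lborel (\<lambda>t. g (t - s))" "(LBINT t. g (t - s)) = (LBINT t. g t)"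
    "(LBINT t. norm (g (t - s))) = (LBINT t. norm (g t))" for s
  proof -
    show "integrable lborel (\<lambda>t. g (t - s))"
      using lborel_integrable_real_affine[OF g, of 1 "- s"] by (simp add: add.commute[of "- s"])
    show "(LBINT t. g (t - s)) = (LBINT t. g t)" "(LBINT t. norm (g (t - s))) = (LBINT t. norm (g t))"
      by (subst lborel_integral_real_affine[where c=1 and t=s]; simp)+
  qed
  have int: "integrable (lborel \<Otimes>\<^sub>M lborel) (\<lambda>(s, t). f s * g (t - s))"
  proof (rule lborel_pair.Fubini_integrable)
    show "integrable lborel (\<lambda>s. LBINT t. norm (case (s, t) of (s, t) \<Rightarrow> f s * g (t - s)))"
      using f by (simp add: norm_mult shift)
  qed (simp_all add: shift)
  show "integrable lborel (\<lambda>t. LBINT s. f s * g (t - s))"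
    using lborel_pair.integrable_snd[OF int] by simp
  show "(LBINT t. LBINT s. f s * g (t - s)) = (LBINT s. f s) * (LBINT t. g t)"
    using lborel_pair.Fubini_integral[OF int] by (simp add: shift)
qed

text \<open>A nonzero limit \<open>L\<close> would keep the norm above |L|/2 on intervals of every
  length. This disposes of the boundary term at infinity in
  \<open>laplace_fundamental_solution\<close>, where only integrability is at hand.\<close>

lemma integrable_halfline_tendsto_zero:
  fixes f :: "real \<Rightarrow> complex"
  assumes f: "set_integrable lborel {0..} f" and L: "(f \<longlongrightarrow> L) at_top"
  shows "L = 0"
proof (rule ccontr)
  assume "L \<noteq> 0"
  then have "\<forall>\<^sub>F t in at_top. norm L / 2 < norm (f t)"
    by (intro order_tendstoD(1)[OF tendsto_norm[OF L]]) simp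
  then obtain T0 where T0: "\<And>t. t \<ge> T0 \<Longrightarrow> norm L / 2 < norm (f t)"
    by (auto simp: eventually_at_top_linorder)
  define T where "T = max 0 T0"
  have fn: "set_integrable lborel {0..} (\<lambda>t. norm (f t))" by (rule set_integrable_norm[OF f])
  have "real n * (norm L / 2) \<le> (LBINT t:{0..}. norm (f t))" for n
  proof -
    have "real n * (norm L / 2) = (LBINT t. indicator {T..T + real n} t *\<^sub>R (norm L / 2))"
      by simp
    also have "\<dots> \<le> (LBINT t:{0..}. norm (f t))"
      unfolding set_lebesgue_integral_def
    proof (rule integral_mono)
      show "integrable lborel (\<lambda>t. indicator {T..T + real n} t *\<^sub>R (norm L / 2))"
        by (intro integrable_scaleR_left integrable_real_indicator) (auto simp: emeasure_lborel_Icc_eq)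
      show "integrable lborel (\<lambda>t. indicator {0..} t *\<^sub>R norm (f t))"
        using fn by (simp add: set_integrable_def)
      show "indicator {T..T + real n} t *\<^sub>R (norm L / 2) \<le> indicator {0..} t *\<^sub>R norm (f t)" for t
        using T0[of t] by (auto simp: indicator_def T_def)
    qed
    finally show ?thesis .
  qed
  moreover obtain n where "(LBINT t:{0..}. norm (f t)) < real n * (norm L / 2)"
    using reals_Archimedean3[of "norm L / 2"] \<open>L \<noteq> 0\<close> by auto
  ultimately show False by (meson not_le)
qed

text \<open>The modulus of the integrand depends on \<open>Re z\<close> alone. Measurability is
  transferred from the weighted function given in the hypothesis by inserting
  \<open>exp (Re z * t)\<close> to undo its weight.\<close>

lemma set_integrable_laplace:
  fixes k :: "real \<Rightarrow> real"
  assumes "set_integrable lborel {0..} (\<lambda>t. exp (- Re z * t) * k t)"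
  shows "set_integrable lborel {0..} (\<lambda>t. exp (- z * of_real t) * of_real (k t) :: complex)"
proof -
  have e: "exp (- z * of_real t) * of_real (exp (Re z * t)) * of_real (exp (- Re z * t) * k t)
      = exp (- z * of_real t) * complex_of_real (k t)" for t
    by (simp add: exp_minus flip: of_real_mult)
  have "(\<lambda>t. exp (- z * of_real t) * complex_of_real (exp (Re z * t))) \<in> borel_measurable borel"
    by measurable
  from measurable_weighted_kernel[OF assms this]
  have m: "(\<lambda>t. indicator {0..} t *\<^sub>R (exp (- z * of_real t) * complex_of_real (k t))) \<in> borel_measurable lborel"
    by (simp only: e)
  show ?thesis
    by (rule set_integrable_dominated[OF set_integrable_abs[OF assms] m]) (simp add: norm_mult abs_mult)
qed

text \<open>The derivative of exp(-z t) X(t) is integrated over [0, T] and T tends to infinity.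
  Convergence of the integral forces the boundary term to converge, and its integrability forces the
  limit 0. Since integrability is the only assumption on the growth of \<open>X\<close>, the same
  identity serves the decay estimate and, by contradiction, the instability.\<close>

lemma laplace_fundamental_solution:
  assumes X: "fundamental_solution a b K X" and K: "set_integrable lborel {0..} K"
    and Kz: "set_integrable lborel {0..} (\<lambda>t. exp (- Re z * t) * K t)"
    and Xz: "set_integrable lborel {0..} (\<lambda>t. exp (- Re z * t) * X t)"
  shows "char_fun a b K z * laplace X z = 1"
proof -
  define f where "f t = indicator {0..} t *\<^sub>R (exp (- z * of_real t) * complex_of_real (K t))" for t
  define g where "g t = indicator {0..} t *\<^sub>R (exp (- z * of_real t) * complex_of_real (X t))" for t
  define p where "p t = exp (- z * of_real t) * complex_of_real (delay_term K X t)" for t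
  have X0: "X 0 = 1" using X by (simp add: fundamental_solution_def)
  have f: "integrable lborel f"
    using set_integrable_laplace[OF Kz] by (simp add: set_integrable_def f_def[abs_def])
  have g: "integrable lborel g"
    using set_integrable_laplace[OF Xz] by (simp add: set_integrable_def g_def[abs_def])
  \<comment> \<open>The two exponentials multiply to one that does not depend on \<open>s\<close>,
    and the truncations restrict \<open>s\<close> to [0, t], beyond which X(t - s) vanishes
    anyway.\<close>
  have fg: "(LBINT s. f s * g (t - s)) = indicator {0..} t *\<^sub>R p t" for t
  proof (cases "0 \<le> t")
    case True
    have "(LBINT s. f s * g (t - s))
      = (LBINT s. exp (- z * of_real t) * complex_of_real (indicator {0..} s *\<^sub>R (K s * X (t - s))))"
    proof (rule Bochner_Integration.integral_cong[OF refl])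
      fix s
      show "f s * g (t - s) = exp (- z * of_real t) * complex_of_real (indicator {0..} s *\<^sub>R (K s * X (t - s)))"
        using fundamental_solution_causal[OF X, of "t - s"]
        by (cases "0 \<le> s"; cases "s \<le> t")
          (auto simp: f_def g_def exp_add[symmetric] algebra_simps simp flip: exp_add)
    qed
    also have "\<dots> = p t"
      by (simp only: integral_mult_right_zero integral_complex_of_real p_def delay_term_def
          set_lebesgue_integral_def)
    finally show ?thesis using True by simp
  next
    case False
    have "f s * g (t - s) = 0" for s using False by (auto simp: f_def g_def indicator_def)
    then have "(LBINT s. f s * g (t - s)) = 0" by (simp only: integral_zero)
    then show ?thesis using False by simp
  qed
  have p_int: "set_integrable lborel {0..} p"
    using integral_convolution(1)[OF f g] by (simp add: fg set_integrable_def)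
  have p_val: "(LBINT t:{0..}. p t) = laplace K z * laplace X z"
    using integral_convolution(2)[OF f g]
    by (simp only: fg) (simp add: set_lebesgue_integral_def laplace_def f_def g_def)
  \<comment> \<open>\<open>q\<close> is the derivative of exp(-z t) X(t), with X' replaced by the
    right-hand side of the equation.\<close>
  define q where "q t = (of_real a - z) * (exp (- z * of_real t) * complex_of_real (X t)) + of_real b * p t" for t
  have q_int: "set_integrable lborel {0..} q"
    unfolding q_def using set_integrable_laplace[OF Xz] p_int
    by (intro set_integral_add set_integrable_mult_right) auto
  have q_val: "(LBINT t:{0..}. q t) = (of_real a - z) * laplace X z + of_real b * (laplace K z * laplace X z)"
    unfolding q_def using set_integrable_laplace[OF Xz] p_int
    by (subst set_integral_add) (auto simp: p_val laplace_def)
  define \<Phi> where "\<Phi> t = exp (- z * of_real t) * complex_of_real (X t)" for t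
  have FTC: "(LBINT t:{0..T}. q t) = \<Phi> T - 1" if T: "0 \<le> T" for T
  proof -
    have "(LBINT t:{0..T}. q t) = \<Phi> T - \<Phi> 0"
      unfolding set_lebesgue_integral_def
    proof (rule integral_FTC_atLeastAtMost[OF T])
      show "continuous_on {0..T} q"
        unfolding q_def p_def
        by (intro continuous_intros continuous_on_subset[OF fundamental_solution_continuous[OF X]]
            continuous_delay_term_causal[OF K fundamental_solution_continuous[OF X]]
            fundamental_solution_causal[OF X]) auto
      fix t assume "0 \<le> t" "t \<le> T"
      then have "(X has_vector_derivative fundamental_rate a b K X t) (at t within {0..T})"
        by (intro fundamental_solution_deriv[OF X]) auto
      then have "((\<lambda>t. complex_of_real (X t)) has_vector_derivative of_real (fundamental_rate a b K X t)) (at t within {0..T})"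
        by (rule bounded_linear.has_vector_derivative[OF bounded_linear_of_real])
      moreover have "((\<lambda>t. exp (- z * of_real t)) has_vector_derivative - z * exp (- z * of_real t)) (at t within {0..T})"
      proof -
        have "((\<lambda>w. exp (- z * w)) has_field_derivative - z * exp (- z * of_real t)) (at (of_real t) within of_real ` {0..T})"
          by (auto intro!: derivative_eq_intros)
        moreover have "(complex_of_real has_vector_derivative of_real 1) (at t within {0..T})"
          by (rule bounded_linear.has_vector_derivative[OF bounded_linear_of_real has_vector_derivative_id])
        ultimately show ?thesis
          using field_vector_diff_chain_within[of complex_of_real "of_real 1" t "{0..T}"] by (simp add: comp_def)
      qed
      ultimately have "(\<Phi> has_vector_derivative
          (exp (- z * of_real t) * of_real (fundamental_rate a b K X t) + - z * exp (- z * of_real t) * of_real (X t))) (at t within {0..T})"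
        unfolding \<Phi>_def by (intro has_vector_derivative_mult)
      also have "exp (- z * of_real t) * of_real (fundamental_rate a b K X t) + - z * exp (- z * of_real t) * of_real (X t) = q t"
        by (simp add: q_def p_def fundamental_rate_def algebra_simps)
      finally show "(\<Phi> has_vector_derivative q t) (at t within {0..T})" .
    qed
    then show ?thesis by (simp add: \<Phi>_def X0)
  qed
  have "((\<lambda>T. (LBINT t:{0..T}. q t) + 1) \<longlongrightarrow> (LBINT t:{0..}. q t) + 1) at_top"
    by (intro tendsto_add tendsto_const tendsto_set_lebesgue_integral_at_top[OF _ q_int]) auto
  moreover have "\<forall>\<^sub>F T in at_top. (LBINT t:{0..T}. q t) + 1 = \<Phi> T"
    using eventually_ge_at_top[of 0] by eventually_elim (simp add: FTC)
  ultimately have "(\<Phi> \<longlongrightarrow> (LBINT t:{0..}. q t) + 1) at_top"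
    by (rule Lim_transform_eventually)
  moreover have "set_integrable lborel {0..} \<Phi>"
    using set_integrable_laplace[OF Xz] by (simp add: \<Phi>_def[abs_def])
  ultimately have "(LBINT t:{0..}. q t) + 1 = 0"
    using integrable_halfline_tendsto_zero by blast
  then show ?thesis by (simp add: q_val char_fun_def algebra_simps)
qed

section \<open>Fourier inversion and shifting of vertical lines\<close>

lemma std_normal_fourier:
  "(LBINT w. exp (\<i> * of_real (v * w)) * of_real (std_normal_density w)) = complex_of_real (exp (- v\<^sup>2 / 2))"
proof -
  have "(LBINT w. exp (\<i> * of_real (v * w)) * of_real (std_normal_density w)) = char std_normal_distribution v"
    unfolding char_def
    by (subst integral_density) (auto simp: normal_density_nonneg scaleR_conv_of_real mult.commute cis_conv_exp)
  then show ?thesis by (simp add: char_std_normal_distribution)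
qed

text \<open>Gaussian regularisation: \<open>L n\<close> averages \<open>f\<close> around
  \<open>t\<close> at scale \<open>e n\<close>. As the scale tends to 0 it converges to a multiple
  of f(t), by continuity at that point; rewritten on the Fourier side it converges to the inversion
  integral. Boundedness of \<open>f\<close> and integrability of its transform dominate the two
  limits.\<close>

lemma fourier_inversion:
  fixes f :: "real \<Rightarrow> complex"
  defines "fh \<equiv> \<lambda>w. LBINT s. f s * exp (- (\<i> * of_real (w * s)))"
  assumes f: "integrable lborel f" and C: "\<And>s. norm (f s) \<le> C" and cont: "isCont f t"
    and fh: "integrable lborel fh"
  shows "f t = (LBINT w. fh w * exp (\<i> * of_real (w * t))) / of_real (2 * pi)"
proof -
  have [measurable]: "f \<in> borel_measurable borel" using f by auto
  have [measurable]: "fh \<in> borel_measurable borel" using fh by auto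
  define e where "e n = inverse (real (Suc n))" for n
  have e: "0 < e n" for n by (simp add: e_def)
  have e0: "e \<longlonglongrightarrow> 0" unfolding e_def by (rule LIMSEQ_inverse_real_of_nat)
  define L where "L n = (LBINT v. f (t + e n * v) * of_real (exp (- v\<^sup>2 / 2)))" for n
  have gauss: "exp (- v\<^sup>2 / 2) = sqrt (2 * pi) * std_normal_density v" for v :: real
    by (simp add: std_normal_density_def)
  have gi: "integrable lborel (\<lambda>v::real. exp (- v\<^sup>2 / 2))"
    unfolding gauss by (intro integrable_mult_right integrable_normal_density) simp
  have L1: "L \<longlonglongrightarrow> (LBINT v. f t * of_real (exp (- v\<^sup>2 / 2)))"
    unfolding L_def
  proof (rule integral_dominated_convergence[where w="\<lambda>v. C * exp (- v\<^sup>2 / 2)"])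
    show "integrable lborel (\<lambda>v. C * exp (- v\<^sup>2 / 2))" using gi by simp
    show "AE v in lborel. (\<lambda>n. f (t + e n * v) * of_real (exp (- v\<^sup>2 / 2))) \<longlonglongrightarrow> f t * of_real (exp (- v\<^sup>2 / 2))"
    proof (intro AE_I2 tendsto_mult tendsto_const isCont_tendsto_compose[OF cont])
      fix v
      show "(\<lambda>n. t + e n * v) \<longlonglongrightarrow> t"
        using tendsto_add[OF tendsto_const[of t] tendsto_mult_left_zero[OF e0, of v]] by simp
    qed
    show "AE v in lborel. norm (f (t + e n * v) * of_real (exp (- v\<^sup>2 / 2))) \<le> C * exp (- v\<^sup>2 / 2)" for n
      using C by (auto simp: norm_mult intro!: mult_right_mono)
  qed simp_all
  \<comment> \<open>The Gaussian weight is replaced by its own Fourier integral, the integrations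
    are exchanged, and w is rescaled to -e n w.\<close>
  have L2: "L n = (LBINT w. of_real (std_normal_density (e n * w)) * (fh w * exp (\<i> * of_real (w * t))))" for n
  proof -
    define k where "k v w = f (t + e n * v) * (exp (\<i> * of_real (v * w)) * of_real (std_normal_density w))" for v w
    have fe: "integrable lborel (\<lambda>v. f (t + e n * v))"
      using lborel_integrable_real_affine[OF f, of "e n" t] e[of n] by simp
    have nk: "norm (k v w) = norm (f (t + e n * v)) * std_normal_density w" for v w
      by (simp add: k_def norm_mult normal_density_nonneg)
    have int: "integrable (lborel \<Otimes>\<^sub>M lborel) (\<lambda>(v, w). k v w)"
    proof (rule lborel_pair.Fubini_integrable)
      show "(\<lambda>(v, w). k v w) \<in> borel_measurable (lborel \<Otimes>\<^sub>M lborel)"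
        unfolding k_def by measurable
      show "integrable lborel (\<lambda>v. LBINT w. norm (case (v, w) of (v, w) \<Rightarrow> k v w))"
        using fe by (simp add: nk)
      show "AE v in lborel. integrable lborel (\<lambda>w. case (v, w) of (v, w) \<Rightarrow> k v w)"
      proof (rule AE_I2)
        fix v
        show "integrable lborel (\<lambda>w. case (v, w) of (v, w) \<Rightarrow> k v w)"
          by (rule Bochner_Integration.integrable_bound[of _ "\<lambda>w. norm (f (t + e n * v)) * std_normal_density w"])
            (auto simp: nk normal_density_nonneg, simp add: k_def)
      qed
    qed
    have "L n = (LBINT v. LBINT w. k v w)"
      by (simp only: L_def k_def integral_mult_right_zero std_normal_fourier)
    also have "\<dots> = (LBINT w. LBINT v. k v w)"
      using lborel_pair.Fubini_integral[OF int] by simp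
    also have "\<dots> = (LBINT w. of_real (std_normal_density w) * (fh (- w / e n) * exp (- (\<i> * of_real (w * t / e n))) / of_real (e n)))"
    proof (rule Bochner_Integration.integral_cong[OF refl])
      fix w
      have "(LBINT s. f s * exp (\<i> * of_real ((s - t) / e n * w))) = of_real (e n) * (LBINT v. f (t + e n * v) * exp (\<i> * of_real (v * w)))"
        by (subst lborel_integral_real_affine[where c="e n" and t=t]) (use e[of n] in \<open>simp_all add: scaleR_conv_of_real\<close>)
      moreover have "(LBINT s. f s * exp (\<i> * of_real ((s - t) / e n * w))) = fh (- w / e n) * exp (- (\<i> * of_real (w * t / e n)))"
      proof -
        have "f s * exp (\<i> * of_real ((s - t) / e n * w))
          = f s * exp (- (\<i> * of_real (- w / e n * s))) * exp (- (\<i> * of_real (w * t / e n)))" for s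
          by (simp add: mult.assoc exp_add[symmetric] algebra_simps diff_divide_distrib flip: exp_add)
        then show ?thesis by (simp only: fh_def integral_mult_left_zero)
      qed
      ultimately have "(LBINT v. f (t + e n * v) * exp (\<i> * of_real (v * w))) = fh (- w / e n) * exp (- (\<i> * of_real (w * t / e n))) / of_real (e n)"
        using e[of n] by (simp add: field_simps)
      moreover have "(LBINT v. k v w) = (LBINT v. f (t + e n * v) * exp (\<i> * of_real (v * w))) * of_real (std_normal_density w)"
        by (simp add: k_def mult.assoc[symmetric])
      ultimately show "(LBINT v. k v w) = of_real (std_normal_density w) * (fh (- w / e n) * exp (- (\<i> * of_real (w * t / e n))) / of_real (e n))"
        by simp
    qed
    also have "\<dots> = (LBINT w. of_real (std_normal_density (e n * w)) * (fh w * exp (\<i> * of_real (w * t))))"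
      using e[of n]
      by (subst lborel_integral_real_affine[where c="- e n" and t=0])
        (simp_all add: scaleR_conv_of_real std_normal_density_def)
    finally show ?thesis .
  qed
  have nd: "std_normal_density w \<le> std_normal_density 0" for w :: real
    by (simp add: std_normal_density_def divide_right_mono)
  have L3: "L \<longlonglongrightarrow> (LBINT w. of_real (std_normal_density 0) * (fh w * exp (\<i> * of_real (w * t))))"
    unfolding L2
  proof (rule integral_dominated_convergence[where w="\<lambda>w. std_normal_density 0 * norm (fh w)"])
    show "integrable lborel (\<lambda>w. std_normal_density 0 * norm (fh w))" using fh by simp
    show "AE w in lborel. (\<lambda>n. of_real (std_normal_density (e n * w)) * (fh w * exp (\<i> * of_real (w * t))))
        \<longlonglongrightarrow> of_real (std_normal_density 0) * (fh w * exp (\<i> * of_real (w * t)))"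
    proof (intro AE_I2 tendsto_mult tendsto_const tendsto_of_real)
      fix w
      have "isCont (std_normal_density) (0::real)" unfolding std_normal_density_def by simp
      moreover have "(\<lambda>n. e n * w) \<longlonglongrightarrow> 0" by (rule tendsto_mult_left_zero[OF e0])
      ultimately show "(\<lambda>n. std_normal_density (e n * w)) \<longlonglongrightarrow> std_normal_density 0"
        by (rule isCont_tendsto_compose)
    qed
    show "AE w in lborel. norm (of_real (std_normal_density (e n * w)) * (fh w * exp (\<i> * of_real (w * t))))
        \<le> std_normal_density 0 * norm (fh w)" for n
      using nd by (auto simp: norm_mult normal_density_nonneg intro!: mult_right_mono)
  qed simp_all
  have A: "(LBINT v. f t * of_real (exp (- v\<^sup>2 / 2))) = f t * of_real (sqrt (2 * pi))"
    unfolding gauss by simp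
  have B: "(LBINT w. of_real (std_normal_density 0) * (fh w * exp (\<i> * of_real (w * t))))
      = of_real (1 / sqrt (2 * pi)) * (LBINT w. fh w * exp (\<i> * of_real (w * t)))"
    by (simp add: std_normal_density_def)
  have "f t * of_real (sqrt (2 * pi)) = of_real (1 / sqrt (2 * pi)) * (LBINT w. fh w * exp (\<i> * of_real (w * t)))"
    by (rule trans[OF A[symmetric] trans[OF LIMSEQ_unique[OF L1 L3] B]])
  then have "f t * (of_real (sqrt (2 * pi)) * of_real (sqrt (2 * pi))) = (LBINT w. fh w * exp (\<i> * of_real (w * t)))"
    by (simp add: field_simps)
  moreover have "complex_of_real (sqrt (2 * pi)) * of_real (sqrt (2 * pi)) = of_real (2 * pi)"
    by (simp flip: of_real_mult)
  ultimately show ?thesis by (simp add: field_simps)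
qed

section \<open>Integrals along vertical lines\<close>

lemma integrable_inverse_one_plus_square: "integrable lborel (\<lambda>w::real. inverse (1 + w\<^sup>2))"
  using integrable_inverse_1_plus_square by (simp add: set_integrable_def)

lemma vertical_line_integrable:
  fixes H :: "complex \<Rightarrow> complex"
  assumes H: "continuous_on S H" "\<And>w. Complex p w \<in> S"
    and C: "\<And>w. norm (H (Complex p w)) \<le> C * inverse (1 + w\<^sup>2)"
  shows "integrable lborel (\<lambda>w. H (Complex p w))"
proof (rule Bochner_Integration.integrable_bound[of _ "\<lambda>w. C * inverse (1 + w\<^sup>2)"])
  have "continuous_on UNIV (\<lambda>w. H (Complex p w))"
    by (rule continuous_on_compose2[OF H(1)]) (use H(2) in \<open>auto intro!: continuous_intros\<close>)
  then show "(\<lambda>w. H (Complex p w)) \<in> borel_measurable lborel"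
    by (simp add: borel_measurable_continuous_onI)
  show "AE w in lborel. norm (H (Complex p w)) \<le> norm (C * inverse (1 + w\<^sup>2))"
    using C by (intro AE_I2) (smt (verit) real_norm_def)
qed (use integrable_inverse_one_plus_square in simp)

lemma tendsto_symmetric_integral:
  fixes f :: "real \<Rightarrow> complex"
  assumes f: "integrable lborel f"
  shows "(\<lambda>n. LBINT w:{- real n..real n}. f w) \<longlonglongrightarrow> (LBINT w. f w)"
  unfolding set_lebesgue_integral_def
proof (rule integral_dominated_convergence[where w="\<lambda>w. norm (f w)"])
  show "AE w in lborel. (\<lambda>n. indicator {- real n..real n} w *\<^sub>R f w) \<longlonglongrightarrow> f w"
  proof (intro AE_I2 tendsto_eventually)
    fix w
    show "\<forall>\<^sub>F n in sequentially. indicator {- real n..real n} w *\<^sub>R f w = f w"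
      using eventually_ge_at_top[of "nat \<lceil>\<bar>w\<bar>\<rceil>"]
    proof eventually_elim
      case (elim n)
      have "\<bar>w\<bar> \<le> real n"
        using real_nat_ceiling_ge[of "\<bar>w\<bar>"] elim by linarith
      then show ?case by (auto simp: indicator_def)
    qed
  qed
qed (use f in \<open>auto simp: indicator_def\<close>)

text \<open>Cauchy's theorem on the rectangle with vertical sides Re z = p and Re z = q and height
  2n. The bound on the strip plays two roles: it makes both line integrals converge absolutely, and
  it makes the horizontal sides, of fixed length q - p, contribute O(1/n^2).\<close>

lemma vertical_line_integral_shift:
  fixes H :: "complex \<Rightarrow> complex"
  assumes H: "H holomorphic_on {z. 0 < Re z}" and pq: "0 < p" "p < q"
    and C: "\<And>z. p \<le> Re z \<Longrightarrow> Re z \<le> q \<Longrightarrow> norm (H z) \<le> C * inverse (1 + (Im z)\<^sup>2)"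
  shows "(LBINT w. H (Complex p w)) = (LBINT w. H (Complex q w))"
proof -
  let ?S = "{z. 0 < Re z}"
  have cont: "continuous_on ?S H" by (rule holomorphic_on_imp_continuous_on[OF H])
  have S: "convex ?S" by (rule convex_halfspace_Re_gt)
  have int: "integrable lborel (\<lambda>w. H (Complex p w))" "integrable lborel (\<lambda>w. H (Complex q w))"
    using vertical_line_integrable[OF cont, of p C] vertical_line_integrable[OF cont, of q C]
      C[of "Complex p _"] C[of "Complex q _"] pq by auto
  define I where "I r n = (LBINT w:{- real n..real n}. H (Complex r w))" for r n
  have C0: "0 \<le> C" using order_trans[OF norm_ge_zero C[of "Complex p 0"]] pq by simp
  have bound: "norm (I q n - I p n) \<le> 2 * (q - p) * C * inverse (1 + (real n)\<^sup>2)" if n: "0 < n" for n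
  proof -
    define T where "T = real n"
    have T: "0 < T" using n by (simp add: T_def)
    let ?a = "Complex p (- T)" and ?b = "Complex q (- T)" and ?c = "Complex q T" and ?d = "Complex p T"
    let ?g = "linepath ?a ?b +++ linepath ?b ?c +++ linepath ?c ?d +++ linepath ?d ?a"
    have seg: "closed_segment u v \<subseteq> ?S" if "u \<in> ?S" "v \<in> ?S" for u v
      using closed_segment_subset[OF that S] .
    have "(H has_contour_integral 0) ?g"
      by (rule Cauchy_theorem_convex_simple[OF H S])
        (use pq seg in \<open>auto simp: path_image_join intro!: seg\<close>)
    then have z: "contour_integral ?g H = 0" by (rule contour_integral_unique)
    have ci: "H contour_integrable_on linepath u v" if "u \<in> ?S" "v \<in> ?S" for u v
      by (rule contour_integrable_continuous_linepath) (rule continuous_on_subset[OF cont seg[OF that]])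
    have sum: "contour_integral (linepath ?a ?b) H + contour_integral (linepath ?b ?c) H
      + contour_integral (linepath ?c ?d) H + contour_integral (linepath ?d ?a) H = 0"
      using z pq ci by (simp add: contour_integrable_joinI add.assoc)
    have I: "contour_integral (linepath (Complex r (- T)) (Complex r T)) H = \<i> * I r n" if r: "0 < r" for r
    proof -
      have "continuous_on {-T..T} (\<lambda>w. H (Complex r w))"
        by (rule continuous_on_compose2[OF cont]) (use r in \<open>auto intro!: continuous_intros\<close>)
      from set_borel_integral_eq_integral(2)[OF borel_integrable_atLeastAtMost'[OF this]]
      show ?thesis
        using contour_integral_linepath_same_Re[of "Complex r (-T)" r "Complex r T" "-T" T H] T
        by (simp add: I_def T_def)
    qed
    have "contour_integral (linepath ?d ?a) H = - contour_integral (linepath ?a ?d) H"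
      using contour_integral_reverse_linepath[of ?a ?d H] continuous_on_subset[OF cont seg[of ?a ?d]] pq
      by simp
    then have rev: "contour_integral (linepath ?d ?a) H = - (\<i> * I p n)"
      using I[of p] pq by simp
    \<comment> \<open>The condition \<open>y\<^sup>2 = T\<^sup>2\<close> treats the upper and the
      lower side together, in either direction of travel.\<close>
    have hor: "norm (contour_integral (linepath u v) H) \<le> C * inverse (1 + T\<^sup>2) * norm (v - u)"
      if uv: "p \<le> Re u" "Re u \<le> q" "p \<le> Re v" "Re v \<le> q" "Im u = y" "Im v = y" "y\<^sup>2 = T\<^sup>2" for u v y
    proof (rule contour_integral_bound_linepath)
      show "H contour_integrable_on linepath u v" using uv pq by (intro ci) auto
      show "0 \<le> C * inverse (1 + T\<^sup>2)" using C0 by simp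
      fix z assume z: "z \<in> closed_segment u v"
      have "closed_segment u v \<subseteq> {z. p \<le> Re z} \<inter> {z. Re z \<le> q} \<inter> {z. y \<le> Im z} \<inter> {z. Im z \<le> y}"
        by (rule closed_segment_subset)
          (use uv in \<open>auto intro!: convex_Int convex_halfspace_Re_ge convex_halfspace_Re_le convex_halfspace_Im_ge convex_halfspace_Im_le\<close>)
      then have "z \<in> {z. p \<le> Re z} \<inter> {z. Re z \<le> q} \<inter> {z. y \<le> Im z} \<inter> {z. Im z \<le> y}"
        using z by blast
      then have "p \<le> Re z" "Re z \<le> q" "Im z = y" by auto
      then show "norm (H z) \<le> C * inverse (1 + T\<^sup>2)" using C[of z] uv(7) by simp
    qed
    have "\<i> * (I q n - I p n) = - contour_integral (linepath ?a ?b) H - contour_integral (linepath ?c ?d) H"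
      using sum I[of q] rev pq by (simp add: algebra_simps add_eq_0_iff2)
    then have "norm (I q n - I p n) = norm (- contour_integral (linepath ?a ?b) H - contour_integral (linepath ?c ?d) H)"
      by (metis mult_1 norm_ii norm_mult)
    also have "\<dots> \<le> norm (contour_integral (linepath ?a ?b) H) + norm (contour_integral (linepath ?c ?d) H)"
      by (metis norm_minus_cancel norm_triangle_ineq4)
    also have "\<dots> \<le> C * inverse (1 + T\<^sup>2) * norm (?b - ?a) + C * inverse (1 + T\<^sup>2) * norm (?d - ?c)"
      by (intro add_mono hor[where y="-T"] hor[where y=T]) (use pq in auto)
    also have "norm (?b - ?a) = q - p" using pq by (simp add: cmod_def)
    also have "norm (?d - ?c) = q - p" using pq by (simp add: cmod_def)
    finally show ?thesis by (simp add: T_def algebra_simps)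
  qed
  have "(\<lambda>n. 2 * (q - p) * C * inverse (1 + (real n)\<^sup>2)) \<longlonglongrightarrow> 0"
  proof (intro tendsto_mult_right_zero tendsto_inverse_0_at_top)
    show "filterlim (\<lambda>n. 1 + (real n)\<^sup>2) at_top sequentially"
    proof (rule filterlim_at_top_mono[OF filterlim_real_sequentially], intro always_eventually allI)
      show "real n \<le> 1 + (real n)\<^sup>2" for n
        using zero_le_power2[of "real n - 1"] by (simp add: power2_eq_square algebra_simps)
    qed
  qed
  then have "(\<lambda>n. I q n - I p n) \<longlonglongrightarrow> 0"
    by (rule Lim_null_comparison[rotated])
      (rule eventually_mono[OF eventually_gt_at_top[of 0] bound])
  moreover have "(\<lambda>n. I q n - I p n) \<longlonglongrightarrow> (LBINT w. H (Complex q w)) - (LBINT w. H (Complex p w))"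
    unfolding I_def by (intro tendsto_diff tendsto_symmetric_integral int)
  ultimately show ?thesis using LIMSEQ_unique by fastforce
qed

section \<open>The characteristic function on a half-plane\<close>

lemma laplace_integrand_le:
  assumes "0 \<le> Re z" "0 \<le> t"
  shows "norm (exp (- z * of_real t) * complex_of_real (K t)) \<le> \<bar>K t\<bar>"
  using assms by (simp add: norm_mult mult_left_le_one_le)

lemma set_integrable_laplace_halfplane:
  assumes K: "set_integrable lborel {0..} K" and z: "0 \<le> Re z"
  shows "set_integrable lborel {0..} (\<lambda>t. exp (- Re z * t) * K t)"
proof (rule set_integrable_dominated[OF set_integrable_abs[OF K]])
  show "(\<lambda>t. indicator {0..} t *\<^sub>R (exp (- Re z * t) * K t)) \<in> borel_measurable lborel"
    using measurable_weighted_kernel[OF K, of "\<lambda>t. exp (- Re z * t)"] by simp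
  show "norm (exp (- Re z * t) * K t) \<le> \<bar>K t\<bar>" if "t \<in> {0..}" for t
    using z that by (simp add: abs_mult mult_left_le_one_le)
qed

lemma norm_laplace_le:
  assumes K: "set_integrable lborel {0..} K" and z: "0 \<le> Re z"
  shows "norm (laplace K z) \<le> (LBINT t:{0..}. \<bar>K t\<bar>)"
proof -
  have i: "set_integrable lborel {0..} (\<lambda>t. exp (- z * of_real t) * complex_of_real (K t))"
    by (rule set_integrable_laplace[OF set_integrable_laplace_halfplane[OF K z]])
  have "norm (laplace K z) \<le> (LBINT t:{0..}. norm (exp (- z * of_real t) * complex_of_real (K t)))"
    unfolding laplace_def by (rule set_integral_norm_bound[OF i])
  also have "\<dots> \<le> (LBINT t:{0..}. \<bar>K t\<bar>)"
    by (rule set_integral_mono[OF set_integrable_norm[OF i] set_integrable_abs[OF K]])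
      (use laplace_integrand_le[OF z] in auto)
  finally show ?thesis .
qed

text \<open>The closed half-plane matters: on the imaginary axis holomorphy is not at hand, but the
  minimum in \<open>char_fun_lower_bound\<close> is taken over a compact set that touches this
  axis.\<close>

lemma continuous_on_laplace:
  assumes K: "set_integrable lborel {0..} K"
  shows "continuous_on {z. 0 \<le> Re z} (laplace K)"
  unfolding continuous_on_sequentially comp_def
proof (intro allI ballI impI, elim conjE)
  fix u :: "nat \<Rightarrow> complex" and z assume z: "z \<in> {z. 0 \<le> Re z}" "\<forall>n. u n \<in> {z. 0 \<le> Re z}" and u: "u \<longlonglongrightarrow> z"
  show "(\<lambda>n. laplace K (u n)) \<longlonglongrightarrow> laplace K z"
    unfolding laplace_def set_lebesgue_integral_def
  proof (rule integral_dominated_convergence[where w="\<lambda>t. indicator {0..} t *\<^sub>R \<bar>K t\<bar>"])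
    show "integrable lborel (\<lambda>t. indicator {0..} t *\<^sub>R \<bar>K t\<bar>)"
      using set_integrable_abs[OF K] by (simp add: set_integrable_def)
    show "AE t in lborel. (\<lambda>n. indicator {0..} t *\<^sub>R (exp (- u n * of_real t) * complex_of_real (K t)))
        \<longlonglongrightarrow> indicator {0..} t *\<^sub>R (exp (- z * of_real t) * complex_of_real (K t))"
      by (intro AE_I2 tendsto_intros u)
    show "AE t in lborel. norm (indicator {0..} t *\<^sub>R (exp (- u n * of_real t) * complex_of_real (K t)))
        \<le> indicator {0..} t *\<^sub>R \<bar>K t\<bar>" for n
      using laplace_integrand_le[of "u n" _ K] z(2) by (intro AE_I2) (auto simp: indicator_def)
  qed (rule measurable_weighted_kernel[OF K], simp)+
qed

text \<open>The mean value inequality on the half-plane Re \<ge> \<sigma> gives the factor t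
  exp(-\<sigma> t), which is at most 1/\<sigma>. Uniformity in \<open>t\<close> is what lets the
  transform be differentiated under the integral with dominating function |K|/\<sigma>.\<close>

lemma exp_difference_quotient_bound:
  fixes w z :: complex
  assumes z: "0 < \<sigma>" "\<sigma> \<le> Re z" "\<sigma> \<le> Re w" and t: "0 \<le> t" and wz: "w \<noteq> z"
  shows "norm ((exp (- w * of_real t) - exp (- z * of_real t)) / (w - z)) \<le> 1 / \<sigma>"
proof -
  have "norm (exp (- w * of_real t) - exp (- z * of_real t)) \<le> (t * exp (- \<sigma> * t)) * norm (w - z)"
  proof (rule field_differentiable_bound)
    show "convex {z. \<sigma> \<le> Re z}" by (rule convex_halfspace_Re_ge)
    fix y assume y: "y \<in> {z. \<sigma> \<le> Re z}"
    show "((\<lambda>w. exp (- w * of_real t)) has_field_derivative (- of_real t * exp (- y * of_real t))) (at y within {z. \<sigma> \<le> Re z})"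
      by (auto intro!: derivative_eq_intros)
    show "norm (- of_real t * exp (- y * of_real t)) \<le> t * exp (- \<sigma> * t)"
      using y t by (auto simp: norm_mult intro!: mult_left_mono mult_right_mono)
  qed (use z in auto)
  also have "\<dots> \<le> (1 / \<sigma>) * norm (w - z)"
  proof (rule mult_right_mono)
    have "\<sigma> * t \<le> exp (\<sigma> * t)" using exp_ge_add_one_self[of "\<sigma> * t"] by linarith
    then show "t * exp (- \<sigma> * t) \<le> 1 / \<sigma>" using z by (simp add: exp_minus field_simps)
  qed simp
  finally show ?thesis using wz by (simp add: norm_divide field_simps)
qed

text \<open>Dominated convergence is applied to the difference quotients. The choice \<sigma> = Re z
  / 2 leaves room around \<open>z\<close>, which requires an interior point of the
  half-plane.\<close>

lemma laplace_holomorphic: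
  assumes K: "set_integrable lborel {0..} K"
  shows "laplace K holomorphic_on {z. 0 < Re z}"
proof (rule holomorphic_onI)
  fix z assume "z \<in> {z. 0 < Re z}"
  then have z: "0 < Re z" by simp
  define \<sigma> where "\<sigma> = Re z / 2"
  have \<sigma>: "0 < \<sigma>" "\<sigma> < Re z" using z by (auto simp: \<sigma>_def)
  define d where "d t = - of_real t * exp (- z * of_real t)" for t
  have "(laplace K has_field_derivative (LBINT t. indicator {0..} t *\<^sub>R (d t * complex_of_real (K t)))) (at z)"
    unfolding has_field_derivative_iff tendsto_at_iff_sequentially comp_def
  proof (intro allI impI)
    fix u :: "nat \<Rightarrow> complex" assume u0: "\<forall>n. u n \<in> UNIV - {z}" and u: "u \<longlonglongrightarrow> z"
    have "\<forall>\<^sub>F n in sequentially. \<sigma> < Re (u n)"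
      by (rule order_tendstoD(1)[OF tendsto_Re[OF u] \<sigma>(2)])
    then obtain m where m: "\<And>n. n \<ge> m \<Longrightarrow> \<sigma> < Re (u n)" by (auto simp: eventually_sequentially)
    \<comment> \<open>Dropping the first \<open>m\<close> terms puts the whole sequence into Re >
      \<sigma>, so that the dominating function works for every index.\<close>
    define v where "v n = u (n + m)" for n
    have v: "v \<longlonglongrightarrow> z" "\<And>n. v n \<noteq> z" "\<And>n. \<sigma> < Re (v n)"
      using u u0 m by (auto simp: v_def[abs_def] LIMSEQ_ignore_initial_segment)
    define Q where "Q n t = indicator {0..} t *\<^sub>R ((exp (- v n * of_real t) - exp (- z * of_real t)) / (v n - z) * complex_of_real (K t))" for n t
    have Qe: "Q n t = (indicator {0..} t *\<^sub>R (exp (- v n * of_real t) * complex_of_real (K t))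
        - indicator {0..} t *\<^sub>R (exp (- z * of_real t) * complex_of_real (K t))) / (v n - z)" for n t
      by (simp add: Q_def indicator_def field_simps)
    have Kv: "set_integrable lborel {0..} (\<lambda>t. exp (- y * of_real t) * complex_of_real (K t))" if "0 \<le> Re y" for y
      by (rule set_integrable_laplace[OF set_integrable_laplace_halfplane[OF K that]])
    have vp: "0 \<le> Re (v n)" for n using v(3)[of n] \<sigma>(1) by linarith
    have Qm: "Q n \<in> borel_measurable lborel" for n
      unfolding Qe[abs_def] by (intro borel_measurable_divide borel_measurable_diff borel_measurable_const measurable_weighted_kernel[OF K]) simp_all
    have lim: "(\<lambda>n. LBINT t. Q n t) \<longlonglongrightarrow> (LBINT t. indicator {0..} t *\<^sub>R (d t * complex_of_real (K t)))"
    proof (rule integral_dominated_convergence[where w="\<lambda>t. (1 / \<sigma>) * (indicator {0..} t *\<^sub>R \<bar>K t\<bar>)"])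
      show "integrable lborel (\<lambda>t. (1 / \<sigma>) * (indicator {0..} t *\<^sub>R \<bar>K t\<bar>))"
        using set_integrable_abs[OF K] by (simp add: set_integrable_def)
      have tend: "(\<lambda>n. Q n t) \<longlonglongrightarrow> indicator {0..} t *\<^sub>R (d t * complex_of_real (K t))" for t
      proof -
        have "((\<lambda>w. exp (- w * of_real t)) has_field_derivative d t) (at z)"
          unfolding d_def by (auto intro!: derivative_eq_intros)
        then have "(\<lambda>n. (exp (- v n * of_real t) - exp (- z * of_real t)) / (v n - z)) \<longlonglongrightarrow> d t"
          unfolding has_field_derivative_iff tendsto_at_iff_sequentially comp_def using v by auto
        then show ?thesis unfolding Q_def by (intro tendsto_intros)
      qed
      then show "AE t in lborel. (\<lambda>n. Q n t) \<longlonglongrightarrow> indicator {0..} t *\<^sub>R (d t * complex_of_real (K t))" by simp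
      show "(\<lambda>t. indicator {0..} t *\<^sub>R (d t * complex_of_real (K t))) \<in> borel_measurable lborel"
        by (rule borel_measurable_LIMSEQ_metric[OF Qm tend])
      show "AE t in lborel. norm (Q n t) \<le> (1 / \<sigma>) * (indicator {0..} t *\<^sub>R \<bar>K t\<bar>)" for n
      proof (rule AE_I2)
        fix t
        show "norm (Q n t) \<le> (1 / \<sigma>) * (indicator {0..} t *\<^sub>R \<bar>K t\<bar>)"
        proof (cases "0 \<le> t")
          case True
          have "norm (Q n t) = norm ((exp (- v n * of_real t) - exp (- z * of_real t)) / (v n - z)) * \<bar>K t\<bar>"
            using True by (simp add: Q_def norm_mult norm_divide)
          also have "\<dots> \<le> (1 / \<sigma>) * \<bar>K t\<bar>"
            by (intro mult_right_mono exp_difference_quotient_bound) (use \<sigma> v(2,3)[of n] True in auto)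
          finally show ?thesis using True by simp
        qed (simp add: Q_def)
      qed
    qed (rule Qm)
    have "(LBINT t. Q n t) = (laplace K (v n) - laplace K z) / (v n - z)" for n
      unfolding Qe laplace_def set_lebesgue_integral_def
      using Kv[OF vp[of n]] Kv[of z] z
      by (simp add: set_integrable_def Bochner_Integration.integral_diff)
    then have "(\<lambda>n. (laplace K (v n) - laplace K z) / (v n - z)) \<longlonglongrightarrow> (LBINT t. indicator {0..} t *\<^sub>R (d t * complex_of_real (K t)))"
      using lim by simp
    then show "(\<lambda>n. (laplace K (u n) - laplace K z) / (u n - z)) \<longlonglongrightarrow> (LBINT t. indicator {0..} t *\<^sub>R (d t * complex_of_real (K t)))"
      unfolding v_def by (rule LIMSEQ_offset)
  qed
  then show "laplace K field_differentiable (at z within {z. 0 < Re z})"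
    using field_differentiable_def field_differentiable_at_within by blast
qed

text \<open>Far out the term \<open>z\<close> dominates the bounded rest of \<open>char_fun\<close>;
  on the remaining half-disc the quotient is continuous on a compact set and its minimum is
  positive. Comparison with z + 1 instead of z avoids a zero at the origin.\<close>

lemma char_fun_lower_bound:
  assumes K: "set_integrable lborel {0..} K" and nz: "\<And>z. 0 \<le> Re z \<Longrightarrow> char_fun a b K z \<noteq> 0"
  shows "\<exists>m>0. \<forall>z. 0 \<le> Re z \<longrightarrow> m * norm (z + 1) \<le> norm (char_fun a b K z)"
proof -
  define k where "k = \<bar>a\<bar> + \<bar>b\<bar> * (LBINT t:{0..}. \<bar>K t\<bar>)"
  \<comment> \<open>\<open>k\<close> bounds a + b L(K) on the half-plane, and |z| \<ge> 2k + 1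
    implies |z| - k \<ge> (|z| + 1)/4.\<close>
  define R where "R = 2 * k + 1"
  have "0 \<le> (LBINT t:{0..}. \<bar>K t\<bar>)"
    unfolding set_lebesgue_integral_def by (rule integral_nonneg_AE) auto
  then have k: "0 \<le> k" by (simp add: k_def)
  have far: "(1/4) * norm (z + 1) \<le> norm (char_fun a b K z)" if z: "0 \<le> Re z" "R \<le> norm z" for z
  proof -
    have "norm (of_real a + of_real b * laplace K z) \<le> \<bar>a\<bar> + \<bar>b\<bar> * norm (laplace K z)"
      by (metis norm_mult norm_of_real norm_triangle_ineq)
    also have "\<dots> \<le> k" unfolding k_def by (intro add_left_mono mult_left_mono norm_laplace_le K z) simp
    finally have "norm z - k \<le> norm (z - (of_real a + of_real b * laplace K z))"
      using norm_triangle_ineq2[of z "of_real a + of_real b * laplace K z"] by linarith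
    then have "norm z - k \<le> norm (char_fun a b K z)" by (simp add: char_fun_def algebra_simps)
    moreover have "norm (z + 1) \<le> norm z + 1" using norm_triangle_ineq[of z 1] by simp
    ultimately show ?thesis using z k unfolding R_def by linarith
  qed
  define S where "S = {z::complex. 0 \<le> Re z} \<inter> cball 0 R"
  have p1: "z + 1 \<noteq> 0" if "0 \<le> Re z" for z :: complex
    using that by (auto simp: complex_eq_iff)
  have "compact S" unfolding S_def by (intro closed_Int_compact closed_halfspace_Re_ge compact_cball)
  moreover have "0 \<in> S" using k by (simp add: S_def R_def)
  moreover have "continuous_on S (\<lambda>z. norm (char_fun a b K z) / norm (z + 1))"
    unfolding char_fun_def
    by (intro continuous_intros continuous_on_subset[OF continuous_on_laplace[OF K]])
      (auto simp: S_def dest: p1)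
  ultimately obtain y where y: "y \<in> S" "\<And>z. z \<in> S \<Longrightarrow> norm (char_fun a b K y) / norm (y + 1) \<le> norm (char_fun a b K z) / norm (z + 1)"
    using continuous_attains_inf[of S "\<lambda>z. norm (char_fun a b K z) / norm (z + 1)"] by blast
  define m where "m = min (1/4) (norm (char_fun a b K y) / norm (y + 1))"
  have m4: "m \<le> 1/4" unfolding m_def by (rule min.cobounded1)
  have "0 < m" using y(1) nz[of y] p1[of y] by (auto simp: m_def S_def)
  moreover have "m * norm (z + 1) \<le> norm (char_fun a b K z)" if z: "0 \<le> Re z" for z
  proof (cases "z \<in> S")
    case True
    then have "m \<le> norm (char_fun a b K z) / norm (z + 1)" using y(2)[OF True] by (simp add: m_def)
    then show ?thesis using p1[OF z] by (simp add: field_simps)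
  next
    case False
    then have "(1/4) * norm (z + 1) \<le> norm (char_fun a b K z)" using far z by (simp add: S_def)
    moreover have "m * norm (z + 1) \<le> (1/4) * norm (z + 1)" by (rule mult_right_mono[OF m4]) simp
    ultimately show ?thesis by linarith
  qed
  ultimately show ?thesis by blast
qed

section \<open>Exponential bounds for the fundamental solution\<close>

lemma exp_decay_integral:
  assumes c: "(c::real) < 0"
  shows "set_integrable lborel {t..} (\<lambda>s. exp (c * s))" "(LBINT s:{t..}. exp (c * s)) = exp (c * t) / \<bar>c\<bar>"
proof -
  have "((\<lambda>s. exp (c * s) / c) \<longlongrightarrow> 0) at_top"
  proof -
    have "filterlim (\<lambda>s. c * s) at_bot at_top"
      using c by (simp add: filterlim_tendsto_neg_mult_at_bot[OF tendsto_const _ filterlim_ident])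
    then have "((\<lambda>s. exp (c * s)) \<longlongrightarrow> 0) at_top" by (rule filterlim_compose[OF exp_at_bot])
    then have "((\<lambda>s. exp (c * s) / c) \<longlongrightarrow> 0 / c) at_top" by (intro tendsto_divide tendsto_const) (use c in auto)
    then show ?thesis by simp
  qed
  then have "(\<integral>\<^sup>+s. ennreal (exp (c * s)) * indicator {t..} s \<partial>lborel) = 0 - exp (c * t) / c"
    by (intro nn_integral_FTC_atLeast[where F="\<lambda>s. exp (c * s) / c"])
      (use c in \<open>auto intro!: derivative_eq_intros\<close>)
  also have "(\<integral>\<^sup>+s. ennreal (exp (c * s)) * indicator {t..} s \<partial>lborel)
      = (\<integral>\<^sup>+s. ennreal (indicator {t..} s *\<^sub>R exp (c * s)) \<partial>lborel)"
    by (rule nn_integral_cong) (auto simp: indicator_def)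
  finally have "(\<integral>\<^sup>+s. ennreal (indicator {t..} s *\<^sub>R exp (c * s)) \<partial>lborel) = exp (c * t) / \<bar>c\<bar>"
    using c by simp
  then have "has_bochner_integral lborel (\<lambda>s. indicator {t..} s *\<^sub>R exp (c * s)) (exp (c * t) / \<bar>c\<bar>)"
    by (intro has_bochner_integral_nn_integral) auto
  then show "set_integrable lborel {t..} (\<lambda>s. exp (c * s))" "(LBINT s:{t..}. exp (c * s)) = exp (c * t) / \<bar>c\<bar>"
    by (auto simp: set_integrable_def set_lebesgue_integral_def has_bochner_integral_iff)
qed

text \<open>The cut-off exponential is itself the fundamental solution of x' = -x, so its transform
  is a case of \<open>laplace_fundamental_solution\<close> with zero kernel.\<close>

lemma laplace_exp:
  assumes z: "0 \<le> Re z"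
  defines "E \<equiv> \<lambda>t::real. if 0 \<le> t then exp (- t) else 0"
  shows "set_integrable lborel {0..} (\<lambda>t. exp (- Re z * t) * E t)" "laplace E z = 1 / (z + 1)"
proof -
  have "set_integrable lborel {0..} (\<lambda>t. exp ((- Re z - 1) * t))"
    by (rule exp_decay_integral) (use z in simp)
  then show i: "set_integrable lborel {0..} (\<lambda>t. exp (- Re z * t) * E t)"
    by (rule iffD1[OF set_integrable_cong, rotated -1]) (auto simp: E_def exp_add[symmetric] algebra_simps)
  have "fundamental_solution (-1) 0 (\<lambda>_. 0) E"
    unfolding fundamental_solution_def
  proof (intro conjI allI impI)
    fix t :: real assume t: "0 \<le> t"
    have "((\<lambda>t. exp (- t)) has_real_derivative - exp (- t)) (at t within {0..})"
      by (auto intro!: derivative_eq_intros)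
    then have "(E has_real_derivative - exp (- t)) (at t within {0..})"
      by (rule has_field_derivative_transform_within[OF _ zero_less_one]) (use t in \<open>auto simp: E_def\<close>)
    then show "(E has_real_derivative -1 * E t + 0 * delay_term (\<lambda>_. 0) E t) (at t within {0..})"
      using t by (simp add: E_def)
  qed (auto simp: E_def)
  from laplace_fundamental_solution[OF this _ _ i]
  have "(z + 1) * laplace E z = 1" by (simp add: char_fun_def set_integrable_def)
  then show "laplace E z = 1 / (z + 1)"
    by (metis mult_zero_left nonzero_mult_div_cancel_left zero_neq_one)
qed

text \<open>The case \<alpha> = 0, to which the general one reduces by an exponential weight.
  \<open>G\<close> is the transform of the difference between \<open>X\<close> and the cut-off
  exponential \<open>E\<close>, both equal to 1 at time 0; it is O(1/(1 + (Im z)^2)) uniformly on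
  the closed half-plane, so that its integral over the line Re z = p is bounded independently of
  p.\<close>

lemma fundamental_solution_bounded:
  assumes X: "fundamental_solution a b K X" and K: "set_integrable lborel {0..} K"
    and nz: "\<And>z. 0 \<le> Re z \<Longrightarrow> char_fun a b K z \<noteq> 0"
  shows "\<exists>B. \<forall>t\<ge>0. \<bar>X t\<bar> \<le> B"
proof -
  define k where "k = (LBINT t:{0..}. \<bar>K t\<bar>)"
  have k0: "0 \<le> k" unfolding k_def set_lebesgue_integral_def by (rule integral_nonneg_AE) auto
  obtain m where m: "0 < m" "\<And>z. 0 \<le> Re z \<Longrightarrow> m * norm (z + 1) \<le> norm (char_fun a b K z)"
    using char_fun_lower_bound[OF K nz] by blast
  obtain c where c: "0 < c" "\<And>t. 0 \<le> t \<Longrightarrow> \<bar>X t\<bar> \<le> c * exp (c * t)"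
    using fundamental_solution_growth[OF X K] by blast
  \<comment> \<open>One more than the growth rate \<open>c\<close>, so that exp(-\<sigma> s) |X(s)|
    \<le> c exp(-s) is both bounded and integrable.\<close>
  define \<sigma> where "\<sigma> = c + 1"
  define E where "E t = (if 0 \<le> t then exp (- t) else 0 :: real)" for t
  note E = laplace_exp[folded E_def]
  define G where "G z = 1 / char_fun a b K z - 1 / (z + 1)" for z
  \<comment> \<open>The numerator of \<open>G\<close> over the common denominator is z + 1 - h(z) =
    1 + a + b L(K)(z), which is bounded; \<open>m\<close> comes from the lower bound on h.\<close>
  define C where "C = (1 + \<bar>a\<bar> + \<bar>b\<bar> * k) / m"
  have p1: "z + 1 \<noteq> 0" if "0 \<le> Re z" for z :: complex
    using that by (auto simp: complex_eq_iff)
  have C0: "0 \<le> C" using m(1) k0 by (simp add: C_def)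
  have G_bound: "norm (G z) \<le> C * inverse (1 + (Im z)\<^sup>2)" if z: "0 \<le> Re z" for z
  proof -
    have "G z = (1 + of_real a + of_real b * laplace K z) / (char_fun a b K z * (z + 1))"
      using nz[OF z] p1[OF z] unfolding G_def by (simp add: diff_frac_eq) (simp add: char_fun_def algebra_simps)
    also have "norm \<dots> = norm (1 + of_real a + of_real b * laplace K z) / (norm (char_fun a b K z) * norm (z + 1))"
      by (simp add: norm_divide norm_mult)
    also have "\<dots> \<le> (1 + \<bar>a\<bar> + \<bar>b\<bar> * k) / (m * norm (z + 1) * norm (z + 1))"
    proof (rule frac_le)
      have "norm (1 + of_real a + of_real b * laplace K z) \<le> norm (1 + of_real a :: complex) + norm (of_real b * laplace K z)"
        by (rule norm_triangle_ineq)
      also have "norm (1 + of_real a :: complex) \<le> 1 + \<bar>a\<bar>"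
        using norm_triangle_ineq[of 1 "of_real a :: complex"] by simp
      also have "norm (of_real b * laplace K z) \<le> \<bar>b\<bar> * k"
        unfolding norm_mult norm_of_real k_def by (intro mult_left_mono norm_laplace_le[OF K z]) simp
      finally show "norm (1 + of_real a + of_real b * laplace K z) \<le> 1 + \<bar>a\<bar> + \<bar>b\<bar> * k" by simp
      show "0 < m * norm (z + 1) * norm (z + 1)" using m(1) p1[OF z] by simp
      show "m * norm (z + 1) * norm (z + 1) \<le> norm (char_fun a b K z) * norm (z + 1)"
        by (rule mult_right_mono[OF m(2)[OF z]]) simp
    qed (use k0 in simp)
    also have "\<dots> = C * inverse ((norm (z + 1))\<^sup>2)"
      by (simp add: C_def power2_eq_square field_simps)
    also have "\<dots> \<le> C * inverse (1 + (Im z)\<^sup>2)"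
    proof (intro mult_left_mono C0 le_imp_inverse_le)
      have "1 \<le> (Re z + 1)\<^sup>2" using z by (simp add: one_le_power)
      then show "1 + (Im z)\<^sup>2 \<le> (norm (z + 1))\<^sup>2" by (simp add: cmod_power2)
      show "0 < 1 + (Im z)\<^sup>2" by (smt (verit) zero_le_power2)
    qed
    finally show ?thesis .
  qed
  have G_holo: "G holomorphic_on {z. 0 < Re z}"
    unfolding G_def using nz p1
    by (intro holomorphic_intros)
      (auto simp: char_fun_def[abs_def] intro!: holomorphic_intros laplace_holomorphic[OF K])
  have X_decay: "\<bar>exp (- \<sigma> * s) * X s\<bar> \<le> c * exp (-1 * s)" if "0 \<le> s" for s
  proof -
    have "exp (- \<sigma> * s) * \<bar>X s\<bar> \<le> exp (- \<sigma> * s) * (c * exp (c * s))"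
      by (intro mult_left_mono c that) simp
    also have "\<dots> = c * exp (-1 * s)" by (simp add: \<sigma>_def exp_add[symmetric] algebra_simps flip: exp_add)
    finally show ?thesis by (simp add: abs_mult)
  qed
  have Xlap: "set_integrable lborel {0..} (\<lambda>t. exp (- \<sigma> * t) * X t)"
  proof (rule set_integrable_dominated)
    show "set_integrable lborel {0..} (\<lambda>t. c * exp (-1 * t))"
      by (intro set_integrable_mult_right exp_decay_integral) simp
    show "(\<lambda>t. indicator {0..} t *\<^sub>R (exp (- \<sigma> * t) * X t)) \<in> borel_measurable lborel"
      using fundamental_solution_measurable[OF X] by measurable
  qed (use X_decay in simp)
  have lapX: "laplace X z = 1 / char_fun a b K z" if "Re z = \<sigma>" for z
  proof -
    have "0 \<le> Re z" using c(1) that by (simp add: \<sigma>_def)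
    with laplace_fundamental_solution[OF X K set_integrable_laplace_halfplane[OF K]] Xlap that
    have "char_fun a b K z * laplace X z = 1" by simp
    then show ?thesis by (metis mult_zero_left nonzero_mult_div_cancel_left zero_neq_one)
  qed
  \<comment> \<open>The damped difference of \<open>X\<close> and \<open>E\<close>: its Fourier
    transform at \<open>w\<close> is \<open>G\<close> at \<sigma> + i w.\<close>
  define f where "f s = indicator {0..} s *\<^sub>R complex_of_real (exp (- \<sigma> * s) * X s - exp (- \<sigma> * s) * E s)" for s
  have \<sigma>: "0 < \<sigma>" using c(1) by (simp add: \<sigma>_def)
  have Elap: "set_integrable lborel {0..} (\<lambda>t. exp (- \<sigma> * t) * E t)"
    using E(1)[of "of_real \<sigma>"] \<sigma> by simp
  have f_int: "integrable lborel f"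
  proof -
    have "integrable lborel (\<lambda>s. complex_of_real (indicator {0..} s *\<^sub>R (exp (- \<sigma> * s) * X s - exp (- \<sigma> * s) * E s)))"
      using set_integral_diff(1)[OF Xlap Elap] unfolding set_integrable_def by (rule integrable_of_real)
    also have "(\<lambda>s. complex_of_real (indicator {0..} s *\<^sub>R (exp (- \<sigma> * s) * X s - exp (- \<sigma> * s) * E s))) = f"
      by (auto simp: f_def indicator_def)
    finally show ?thesis .
  qed
  have f_bound: "norm (f s) \<le> c + 1" for s
  proof (cases "0 \<le> s")
    case True
    have "c * exp (-1 * s) \<le> c" using True c(1) by simp
    then have 1: "\<bar>exp (- \<sigma> * s) * X s\<bar> \<le> c" using X_decay[OF True] by linarith
    have 2: "\<bar>exp (- \<sigma> * s) * E s\<bar> \<le> 1" using True \<sigma> by (simp add: E_def abs_mult mult_le_one)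
    have "norm (f s) = \<bar>exp (- \<sigma> * s) * X s - exp (- \<sigma> * s) * E s\<bar>"
      using True unfolding f_def by (simp only: indicator_simps scaleR_one norm_of_real atLeast_iff)
    then show ?thesis using 1 2 by linarith
  qed (use c(1) in \<open>simp add: f_def\<close>)
  have fh: "(LBINT s. f s * exp (- (\<i> * of_real (w * s)))) = G (Complex \<sigma> w)" for w
  proof -
    let ?z = "Complex \<sigma> w"
    note iX = set_integrable_laplace[of ?z X] and iE = set_integrable_laplace[of ?z E]
    have "f s * exp (- (\<i> * of_real (w * s)))
       = indicator {0..} s *\<^sub>R (exp (- ?z * of_real s) * of_real (X s)) - indicator {0..} s *\<^sub>R (exp (- ?z * of_real s) * of_real (E s))" for s
    proof -
      have "- ?z * of_real s = of_real (- \<sigma> * s) + - (\<i> * of_real (w * s))"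
        by (simp add: complex_eq_iff)
      then have "exp (- ?z * of_real s) = of_real (exp (- \<sigma> * s)) * exp (- (\<i> * of_real (w * s)))"
        by (simp only: exp_add exp_of_real)
      then show ?thesis
        unfolding f_def by (cases "0 \<le> s") (simp_all add: algebra_simps)
    qed
    then have "(LBINT s. f s * exp (- (\<i> * of_real (w * s)))) = laplace X ?z - laplace E ?z"
      using iX iE Xlap Elap
      by (simp add: laplace_def set_lebesgue_integral_def set_integrable_def Bochner_Integration.integral_diff)
    also have "\<dots> = G ?z" using lapX[of ?z] E(2)[of ?z] \<sigma> by (simp add: G_def)
    finally show ?thesis .
  qed
  define Q where "Q = (LBINT w::real. inverse (1 + w\<^sup>2))"
  have "\<bar>X t\<bar> \<le> 1 + C * exp 1 * Q / (2 * pi)" if t: "0 < t" for t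
  proof -
    \<comment> \<open>The abscissa depends on \<open>t\<close>: positive, hence inside the domain of
      holomorphy, but with p t \<le> 1, so that the exponential factor on the line is at most e. The
      second entry only ensures p < \<sigma>.\<close>
    define p where "p = min (1 / t) (\<sigma> / 2)"
    have p: "0 < p" "p < \<sigma>" "p * t \<le> 1" using t \<sigma> by (auto simp: p_def min_def field_simps)
    define H where "H z = G z * exp (z * of_real t)" for z
    have H_holo: "H holomorphic_on {z. 0 < Re z}"
      unfolding H_def by (intro holomorphic_intros G_holo)
    have H_bound: "norm (H z) \<le> C * exp (q * t) * inverse (1 + (Im z)\<^sup>2)" if z: "0 \<le> Re z" "Re z \<le> q" for z q
    proof -
      have "norm (H z) \<le> (C * inverse (1 + (Im z)\<^sup>2)) * exp (q * t)"
        unfolding H_def norm_mult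
        by (intro mult_mono G_bound z) (use z t C0 in auto)
      then show ?thesis by (simp add: algebra_simps)
    qed
    have shift: "(LBINT w. H (Complex p w)) = (LBINT w. H (Complex \<sigma> w))"
      by (rule vertical_line_integral_shift[OF H_holo p(1,2), of "C * exp (\<sigma> * t)"]) (rule H_bound; use p in simp)
    have int: "integrable lborel (\<lambda>w. H (Complex p w))"
      by (rule vertical_line_integrable[OF holomorphic_on_imp_continuous_on[OF H_holo], where C="C * exp (p * t)"])
        (use p H_bound[of "Complex p _" p] in auto)
    have G_int: "integrable lborel (\<lambda>w. G (Complex \<sigma> w))"
      by (rule vertical_line_integrable[OF holomorphic_on_imp_continuous_on[OF G_holo], where C=C])
        (use \<sigma> G_bound[of "Complex \<sigma> _"] in auto)
    have "isCont f t"
    proof -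
      have cX: "isCont X t"
        using continuous_causal_bounded(2)[OF fundamental_solution_continuous[OF X]] t
          fundamental_solution_causal[OF X] by simp
      have "isCont (\<lambda>s. complex_of_real (exp (- \<sigma> * s) * X s - exp (- \<sigma> * s) * exp (- s))) t"
        by (intro continuous_intros cX)
      moreover have "\<forall>\<^sub>F s in nhds t. f s = complex_of_real (exp (- \<sigma> * s) * X s - exp (- \<sigma> * s) * exp (- s))"
        using eventually_nhds_in_open[of "{0<..}" t] t
        by (auto elim!: eventually_mono simp: f_def E_def)
      ultimately show ?thesis by (subst isCont_cong)
    qed
    from fourier_inversion[OF f_int f_bound this, unfolded fh, OF G_int]
    have ft: "f t = (LBINT w. G (Complex \<sigma> w) * exp (\<i> * of_real (w * t))) / of_real (2 * pi)" .
    have "H (Complex \<sigma> w) = of_real (exp (\<sigma> * t)) * (G (Complex \<sigma> w) * exp (\<i> * of_real (w * t)))" for w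
    proof -
      have "Complex \<sigma> w * of_real t = of_real (\<sigma> * t) + \<i> * of_real (w * t)"
        by (simp add: complex_eq_iff)
      then have "exp (Complex \<sigma> w * of_real t) = of_real (exp (\<sigma> * t)) * exp (\<i> * of_real (w * t))"
        by (simp only: exp_add exp_of_real)
      then show ?thesis by (simp only: H_def) (simp only: mult_ac)
    qed
    then have "(LBINT w. H (Complex \<sigma> w)) = of_real (exp (\<sigma> * t)) * (LBINT w. G (Complex \<sigma> w) * exp (\<i> * of_real (w * t)))"
      by (simp only: integral_mult_right_zero)
    also have "\<dots> = of_real (exp (\<sigma> * t)) * (of_real (2 * pi) * f t)" using ft by simp
    also have "of_real (exp (\<sigma> * t)) * (of_real (2 * pi) * f t) = of_real (2 * pi * (X t - E t))"
      using t by (simp add: f_def exp_minus algebra_simps flip: of_real_mult of_real_diff)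
    finally have "2 * pi * \<bar>X t - E t\<bar> = norm (LBINT w. H (Complex p w))"
      using shift by (simp add: norm_mult flip: of_real_diff)
    also have "\<dots> \<le> (LBINT w. norm (H (Complex p w)))" by simp
    also have "\<dots> \<le> (LBINT w. C * exp 1 * inverse (1 + w\<^sup>2))"
    proof (rule integral_mono)
      show "integrable lborel (\<lambda>w. norm (H (Complex p w)))" using int by simp
      show "integrable lborel (\<lambda>w::real. C * exp 1 * inverse (1 + w\<^sup>2))"
        using integrable_inverse_one_plus_square by simp
      fix w :: real
      have "norm (H (Complex p w)) \<le> C * exp (p * t) * inverse (1 + w\<^sup>2)"
        using H_bound[of "Complex p w" p] p by simp
      also have "\<dots> \<le> C * exp 1 * inverse (1 + w\<^sup>2)"
        using p(3) C0 by (intro mult_right_mono mult_left_mono) auto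
      finally show "norm (H (Complex p w)) \<le> C * exp 1 * inverse (1 + w\<^sup>2)" .
    qed
    also have "\<dots> = C * exp 1 * Q" by (simp add: Q_def)
    finally have "\<bar>X t - E t\<bar> \<le> C * exp 1 * Q / (2 * pi)" by (simp add: field_simps)
    moreover have "\<bar>E t\<bar> \<le> 1" using t by (simp add: E_def)
    ultimately show ?thesis by linarith
  qed
  moreover have "\<bar>X 0\<bar> \<le> 1 + C * exp 1 * Q / (2 * pi)"
  proof -
    have "0 \<le> Q" unfolding Q_def by (rule integral_nonneg_AE) (auto intro!: AE_I2 simp: add_nonneg_nonneg)
    then show ?thesis using X C0 by (simp add: fundamental_solution_def)
  qed
  ultimately have "\<forall>t\<ge>0. \<bar>X t\<bar> \<le> 1 + C * exp 1 * Q / (2 * pi)"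
    by (metis order_le_less)
  then show ?thesis by blast
qed

text \<open>Weighting by exp(-\<alpha> t) keeps the form of the equation: \<open>a\<close> becomes a
  - \<alpha>, the kernel becomes \<open>L\<close>, and the characteristic function is translated by
  \<alpha>. The total mass of \<open>L\<close> need not be 1, which is why the preceding estimates
  are phrased with the integral of |K|.\<close>

lemma fundamental_solution_exp_bound:
  assumes X: "fundamental_solution a b K X"
    and K\<alpha>: "set_integrable lborel {0..} (\<lambda>t. exp (- \<alpha> * t) * K t)"
    and nz: "\<And>z. \<alpha> \<le> Re z \<Longrightarrow> char_fun a b K z \<noteq> 0"
  shows "\<exists>C>0. \<forall>t\<ge>0. \<bar>X t\<bar> \<le> C * exp (\<alpha> * t)"
proof -
  define L where "L t = exp (- \<alpha> * t) * K t" for t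
  define Y where "Y t = exp (- \<alpha> * t) * X t" for t
  have dl: "delay_term L Y t = exp (- \<alpha> * t) * delay_term K X t" for t
  proof -
    have "delay_term L Y t = (LBINT s:{0..}. exp (- \<alpha> * t) * (K s * X (t - s)))"
      unfolding delay_term_def L_def Y_def
      by (rule set_lebesgue_integral_cong) (auto simp: exp_add[symmetric] algebra_simps simp flip: exp_add)
    then show ?thesis by (simp add: delay_term_def)
  qed
  have Y: "fundamental_solution (a - \<alpha>) b L Y"
    unfolding fundamental_solution_def
  proof (intro conjI allI impI)
    fix t :: real assume t: "0 \<le> t"
    then have "(X has_real_derivative a * X t + b * delay_term K X t) (at t within {0..})"
      using X by (simp add: fundamental_solution_def)
    then have "(Y has_real_derivative - \<alpha> * exp (- \<alpha> * t) * X t + (a * X t + b * delay_term K X t) * exp (- \<alpha> * t)) (at t within {0..})"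
      unfolding Y_def by (auto intro!: derivative_eq_intros)
    then show "(Y has_real_derivative (a - \<alpha>) * Y t + b * delay_term L Y t) (at t within {0..})"
      by (simp add: dl Y_def algebra_simps)
  qed (use X in \<open>auto simp: Y_def fundamental_solution_def\<close>)
  have lap: "laplace L z = laplace K (z + of_real \<alpha>)" for z
    unfolding laplace_def L_def
    by (rule set_lebesgue_integral_cong)
      (auto simp: exp_of_real[symmetric] mult_exp_exp algebra_simps simp flip: mult.assoc)
  have "char_fun (a - \<alpha>) b L z = char_fun a b K (z + of_real \<alpha>)" for z
    by (simp add: char_fun_def lap)
  then have "char_fun (a - \<alpha>) b L z \<noteq> 0" if "0 \<le> Re z" for z
    using nz[of "z + of_real \<alpha>"] that by simp
  then obtain B where B: "\<And>t. 0 \<le> t \<Longrightarrow> \<bar>Y t\<bar> \<le> B"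
    using fundamental_solution_bounded[OF Y] K\<alpha> unfolding L_def by blast
  have "\<bar>X t\<bar> \<le> (\<bar>B\<bar> + 1) * exp (\<alpha> * t)" if "0 \<le> t" for t
  proof -
    have "\<bar>X t\<bar> = \<bar>Y t\<bar> * exp (\<alpha> * t)" by (simp add: Y_def abs_mult exp_minus)
    also have "\<dots> \<le> (\<bar>B\<bar> + 1) * exp (\<alpha> * t)"
      using B[OF that] by (intro mult_right_mono) auto
    finally show ?thesis .
  qed
  then show ?thesis by (intro exI[of _ "\<bar>B\<bar> + 1"]) auto
qed

section \<open>Moments of Wiener increments and the Ito isometry\<close>

lemma wiener_prob_space: "wiener_process M F W \<Longrightarrow> prob_space M"
  by (simp add: wiener_process_def)

lemma wiener_measurable_mono:
  assumes "wiener_process M F W" "s \<le> t" "Y \<in> borel_measurable (F s)"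
  shows "Y \<in> borel_measurable (F t)"
proof -
  interpret filtration "space M" F using assms(1) by (simp add: wiener_process_def)
  have "subalgebra (F t) (F s)"
    unfolding subalgebra_def using space_F sets_F_mono[OF assms(2)] by simp
  then show ?thesis using assms(3) measurable_from_subalg by blast
qed

lemma wiener_filtration_measurable:
  assumes "wiener_process M F W" "Y \<in> borel_measurable (F s)"
  shows "Y \<in> borel_measurable M"
  using assms measurable_from_subalg unfolding wiener_process_def by blast

lemma wiener_adapted: "wiener_process M F W \<Longrightarrow> 0 \<le> t \<Longrightarrow> W t \<in> borel_measurable (F t)"
  by (simp add: wiener_process_def)

lemma wiener_measurable: "wiener_process M F W \<Longrightarrow> 0 \<le> t \<Longrightarrow> W t \<in> borel_measurable M"
  using wiener_adapted wiener_filtration_measurable by blast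

text \<open>The definition provides a density only for s < t. The degenerate case s = t is included
  here because truncating step endpoints at \<open>t\<close> produces empty increments.\<close>

lemma wiener_increment_moments:
  assumes W: "wiener_process M F W" and st: "0 \<le> s" "s \<le> t"
  defines "\<Delta> \<equiv> \<lambda>w. W t w - W s w"
  shows "integrable M \<Delta>" (is ?A) and "(\<integral>w. \<Delta> w \<partial>M) = 0" (is ?B)
    and "integrable M (\<lambda>w. (\<Delta> w)\<^sup>2)" (is ?C) and "(\<integral>w. (\<Delta> w)\<^sup>2 \<partial>M) = t - s" (is ?D)
proof -
  interpret prob_space M by (rule wiener_prob_space[OF W])
  have m[measurable]: "\<Delta> \<in> borel_measurable M"
    unfolding \<Delta>_def using wiener_measurable[OF W] st by (intro borel_measurable_diff) auto
  have "?A \<and> ?B \<and> ?C \<and> ?D"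
  proof (cases "s = t")
    case True
    then show ?thesis by (simp add: \<Delta>_def)
  next
    case False
    define f where "f = normal_density 0 (sqrt (t - s))"
    have \<sigma>: "0 < sqrt (t - s)" using st False by simp
    have D: "distributed M lborel \<Delta> f"
      using W st False unfolding wiener_process_def \<Delta>_def f_def by simp
    have i2: "integrable lborel (\<lambda>x. f x * x\<^sup>2)"
      using integrable_normal_moment[OF \<sigma>, of 0 2] by (simp add: f_def)
    have "(\<integral>\<^sup>+w. ennreal ((\<Delta> w)\<^sup>2) \<partial>M) = (\<integral>\<^sup>+x. ennreal (f x) * ennreal (x\<^sup>2) \<partial>lborel)"
      by (rule distributed_nn_integral[OF D, symmetric]) simp
    also have "\<dots> = (\<integral>\<^sup>+x. ennreal (f x * x\<^sup>2) \<partial>lborel)"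
      by (simp add: ennreal_mult f_def normal_density_nonneg)
    also have "\<dots> < \<infinity>"
      using i2 by (subst nn_integral_eq_integral) (auto simp: f_def normal_density_nonneg)
    finally have sq: "integrable M (\<lambda>w. (\<Delta> w)\<^sup>2)"
      by (intro integrableI_bounded) auto
    have int: "integrable M \<Delta>"
      by (rule square_integrable_imp_integrable[OF m sq])
    have e: "expectation \<Delta> = 0"
      using normal_distributed_expectation[OF \<sigma>] D by (simp add: f_def)
    have "variance \<Delta> = (sqrt (t - s))\<^sup>2"
      using normal_distributed_variance[OF \<sigma>] D by (simp add: f_def)
    then show ?thesis using int sq e st by simp
  qed
  then show ?A ?B ?C ?D by auto
qed

lemma wiener_increment_indep:
  assumes W: "wiener_process M F W" and st: "0 \<le> s" "s < t"
    and Y: "Y \<in> borel_measurable (F s)"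
  shows "prob_space.indep_var M borel Y borel (\<lambda>w. W t w - W s w)"
proof -
  interpret prob_space M by (rule wiener_prob_space[OF W])
  define \<Delta> where "\<Delta> = (\<lambda>w. W t w - W s w)"
  have indep: "indep_set (sets (F s)) (sets (vimage_algebra (space M) \<Delta> borel))"
    using W st by (simp add: wiener_process_def \<Delta>_def)
  have YM: "Y \<in> borel_measurable M" by (rule wiener_filtration_measurable[OF W Y])
  have \<Delta>M: "\<Delta> \<in> borel_measurable M"
    unfolding \<Delta>_def using wiener_measurable[OF W] st by (intro borel_measurable_diff) auto
  have sp: "space (F s) = space M" using W by (auto simp: wiener_process_def subalgebra_def)
  have "sigma_sets (space M) {Y -` A \<inter> space M |A. A \<in> sets borel} \<subseteq> sets (F s)"
    using Y sp by (intro sets.sigma_sets_subset[of _ "F s", unfolded sp]) (auto simp: measurable_def)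
  moreover have "sigma_sets (space M) {\<Delta> -` A \<inter> space M |A. A \<in> sets borel}
      = sets (vimage_algebra (space M) \<Delta> borel)"
    by (simp add: sets_vimage_algebra)
  ultimately have "indep_set (sigma_sets (space M) {Y -` A \<inter> space M |A. A \<in> sets borel})
      (sigma_sets (space M) {\<Delta> -` A \<inter> space M |A. A \<in> sets borel})"
    using indep unfolding indep_sets2_eq by blast
  then show ?thesis using YM \<Delta>M by (simp add: indep_var_eq \<Delta>_def)
qed

text \<open>Independence of the increment from the past factorises both expectations. The first pair
  removes the cross terms of a step integral, the second evaluates the squares.\<close>

lemma wiener_increment_mult:
  assumes W: "wiener_process M F W" and st: "0 \<le> s" "s \<le> t"
    and Y: "Y \<in> borel_measurable (F s)" and iY: "integrable M Y"
  defines "\<Delta> \<equiv> \<lambda>w. W t w - W s w"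
  shows "integrable M (\<lambda>w. Y w * \<Delta> w)" (is ?A) and "(\<integral>w. Y w * \<Delta> w \<partial>M) = 0" (is ?B)
    and "integrable M (\<lambda>w. Y w * (\<Delta> w)\<^sup>2)" (is ?C)
    and "(\<integral>w. Y w * (\<Delta> w)\<^sup>2 \<partial>M) = (\<integral>w. Y w \<partial>M) * (t - s)" (is ?D)
proof -
  interpret prob_space M by (rule wiener_prob_space[OF W])
  have mom: "integrable M \<Delta>" "(\<integral>w. \<Delta> w \<partial>M) = 0"
    "integrable M (\<lambda>w. (\<Delta> w)\<^sup>2)" "(\<integral>w. (\<Delta> w)\<^sup>2 \<partial>M) = t - s"
    unfolding \<Delta>_def by (rule wiener_increment_moments[OF W st])+
  have "?A \<and> ?B \<and> ?C \<and> ?D"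
  proof (cases "s = t")
    case True
    then show ?thesis by (simp add: \<Delta>_def)
  next
    case False
    have ind: "indep_var borel Y borel \<Delta>"
      unfolding \<Delta>_def by (rule wiener_increment_indep[OF W _ _ Y]) (use st False in auto)
    have ind2: "indep_var borel Y borel (\<lambda>w. (\<Delta> w)\<^sup>2)"
      using indep_var_compose[OF ind, of "\<lambda>x. x" borel "\<lambda>x. x\<^sup>2" borel] by (simp add: comp_def)
    show ?thesis
      using indep_var_integrable[OF ind iY mom(1)] indep_var_lebesgue_integral[OF ind iY mom(1)]
        indep_var_integrable[OF ind2 iY mom(3)] indep_var_lebesgue_integral[OF ind2 iY mom(3)] mom(2,4)
      by simp
  qed
  then show ?A ?B ?C ?D by auto
qed

lemma wiener_square_integrable:
  assumes W: "wiener_process M F W" and "0 \<le> t"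
  shows "integrable M (\<lambda>w. (W t w)\<^sup>2)" "(\<integral>w. (W t w)\<^sup>2 \<partial>M) = t"
    "integrable M (W t)" "(\<integral>w. W t w \<partial>M) = 0"
proof -
  interpret prob_space M by (rule wiener_prob_space[OF W])
  note m = wiener_increment_moments[OF W order_refl assms(2)]
  have [measurable]: "W t \<in> borel_measurable M" "W 0 \<in> borel_measurable M"
    using wiener_measurable[OF W] assms(2) by auto
  have 0: "AE w in M. W 0 w = 0" using W by (simp add: wiener_process_def)
  then have a: "AE w in M. (W t w - W 0 w) = W t w" and b: "AE w in M. (W t w - W 0 w)\<^sup>2 = (W t w)\<^sup>2"
    by auto
  show "integrable M (\<lambda>w. (W t w)\<^sup>2)"
    using m(3) by (rule integrable_cong_AE_imp) (use b in auto)
  show "integrable M (W t)"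
    using m(1) by (rule integrable_cong_AE_imp) (use a in auto)
  show "(\<integral>w. W t w \<partial>M) = 0"
    using m(2) integral_cong_AE[OF _ _ a] by simp
  show "(\<integral>w. (W t w)\<^sup>2 \<partial>M) = t"
    using m(4) integral_cong_AE[OF _ _ b] by simp
qed

lemma wiener_covariance:
  assumes W: "wiener_process M F W" and "0 \<le> s" "0 \<le> t"
  shows "integrable M (\<lambda>w. W s w * W t w)" "(\<integral>w. W s w * W t w \<partial>M) = min s t"
proof -
  interpret prob_space M by (rule wiener_prob_space[OF W])
  have *: "integrable M (\<lambda>w. W s w * W t w) \<and> (\<integral>w. W s w * W t w \<partial>M) = s"
    if st: "0 \<le> s" "s \<le> t" for s t
  proof -
    have t: "0 \<le> t" using st by simp
    note m = wiener_increment_mult[OF W st wiener_adapted[OF W st(1)] wiener_square_integrable(3)[OF W st(1)]]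
    note sq = wiener_square_integrable[OF W st(1)]
    have eq: "(\<lambda>w. W s w * W t w) = (\<lambda>w. W s w * (W t w - W s w) + (W s w)\<^sup>2)"
      by (auto simp: algebra_simps power2_eq_square)
    show ?thesis
      unfolding eq using m(1,2) sq(1,2) by simp
  qed
  show "integrable M (\<lambda>w. W s w * W t w)" "(\<integral>w. W s w * W t w \<partial>M) = min s t"
    using *[of s t] *[of t s] assms(2,3)
    by (cases "s \<le> t"; simp add: min_def mult.commute[of "W t _" "W s _"])+
qed

section \<open>The Ito isometry for step processes and the integral of a constant\<close>

lemma is_step_processE:
  assumes "is_step_process M F G"
  obtains n \<tau> \<xi> B where "G = (n, \<tau>, \<xi>)" "\<And>i. i \<le> n \<Longrightarrow> 0 \<le> \<tau> i" "\<And>i. i < n \<Longrightarrow> \<tau> i \<le> \<tau> (Suc i)"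
    "\<And>i. i < n \<Longrightarrow> \<xi> i \<in> borel_measurable (F (\<tau> i))"
    "\<And>i w. i < n \<Longrightarrow> w \<in> space M \<Longrightarrow> \<bar>\<xi> i w\<bar> \<le> B"
proof -
  obtain n \<tau> \<xi> where G: "G = (n, \<tau>, \<xi>)" by (cases G) auto
  have 0: "0 \<le> \<tau> 0" and mono: "\<And>i. i < n \<Longrightarrow> \<tau> i \<le> \<tau> (Suc i)"
    and \<xi>: "\<And>i. i < n \<Longrightarrow> \<xi> i \<in> borel_measurable (F (\<tau> i))"
    using assms by (auto simp: is_step_process_def G)
  obtain B where "\<forall>i<n. \<forall>w\<in>space M. \<bar>\<xi> i w\<bar> \<le> B"
    using assms by (auto simp: is_step_process_def G)
  moreover have "0 \<le> \<tau> i" if "i \<le> n" for i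
    using that by (induction i) (use 0 mono in \<open>auto intro: order_trans\<close>)
  ultimately show ?thesis using that[of n \<tau> \<xi> B] G mono \<xi> by blast
qed

text \<open>Induction on the number of steps. The partial sum \<open>S k\<close> is measurable at
  time \<open>\<tau> k\<close>, hence independent of the next increment, and boundedness of the
  coefficients makes the cross term integrable, with expectation 0.\<close>

lemma step_integral_second_moment:
  assumes W: "wiener_process M F W" and step: "is_step_process M F (n, \<tau>, \<xi>)" and t: "0 \<le> t"
  shows "integrable M (\<lambda>w. (step_integral W (n, \<tau>, \<xi>) t w)\<^sup>2)"
    "(\<integral>w. (step_integral W (n, \<tau>, \<xi>) t w)\<^sup>2 \<partial>M)
       = (\<Sum>i<n. (\<integral>w. (\<xi> i w)\<^sup>2 \<partial>M) * (min (\<tau> (Suc i)) t - min (\<tau> i) t))"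
proof -
  interpret prob_space M by (rule wiener_prob_space[OF W])
  obtain B where pos: "\<And>i. i \<le> n \<Longrightarrow> 0 \<le> \<tau> i"
    and mono: "\<And>i. i < n \<Longrightarrow> \<tau> i \<le> \<tau> (Suc i)" and \<xi>: "\<And>i. i < n \<Longrightarrow> \<xi> i \<in> borel_measurable (F (\<tau> i))"
    and B: "\<And>i w. i < n \<Longrightarrow> w \<in> space M \<Longrightarrow> \<bar>\<xi> i w\<bar> \<le> B"
    by (rule is_step_processE[OF step]) auto
  define \<Delta> where "\<Delta> i w = W (min (\<tau> (Suc i)) t) w - W (min (\<tau> i) t) w" for i w
  define S where "S k w = (\<Sum>i<k. \<xi> i w * \<Delta> i w)" for k w
  have "S k \<in> borel_measurable (F (\<tau> k)) \<and> integrable M (\<lambda>w. (S k w)\<^sup>2) \<and>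
     (\<integral>w. (S k w)\<^sup>2 \<partial>M) = (\<Sum>i<k. (\<integral>w. (\<xi> i w)\<^sup>2 \<partial>M) * (min (\<tau> (Suc i)) t - min (\<tau> i) t))"
    if "k \<le> n" for k
    using that
  proof (induction k)
    case 0
    then show ?case by (simp add: S_def[abs_def])
  next
    case (Suc k)
    then have k: "k < n" and IH: "S k \<in> borel_measurable (F (\<tau> k))" "integrable M (\<lambda>w. (S k w)\<^sup>2)"
      "(\<integral>w. (S k w)\<^sup>2 \<partial>M) = (\<Sum>i<k. (\<integral>w. (\<xi> i w)\<^sup>2 \<partial>M) * (min (\<tau> (Suc i)) t - min (\<tau> i) t))"
      by auto
    have SS: "S (Suc k) = (\<lambda>w. S k w + \<xi> k w * \<Delta> k w)" by (auto simp: S_def)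
    note xk = \<xi>[OF k]
    have Sm: "S k \<in> borel_measurable M" and xm: "\<xi> k \<in> borel_measurable M"
      using wiener_filtration_measurable[OF W] IH(1) xk by blast+
    have W1: "W (min (\<tau> (Suc k)) t) \<in> borel_measurable (F (\<tau> (Suc k)))"
         "W (min (\<tau> k) t) \<in> borel_measurable (F (\<tau> (Suc k)))"
      using pos[of k] pos[of "Suc k"] mono[OF k] k t
      by (auto intro!: wiener_measurable_mono[OF W _ wiener_adapted[OF W]])
    have meas: "S (Suc k) \<in> borel_measurable (F (\<tau> (Suc k)))"
      unfolding SS \<Delta>_def
      by (intro borel_measurable_add borel_measurable_times borel_measurable_diff W1
          wiener_measurable_mono[OF W mono[OF k]] IH(1) xk)
    have iS: "integrable M (S k)" by (rule square_integrable_imp_integrable[OF Sm IH(2)])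
    have B': "AE w in M. \<bar>\<xi> k w\<bar> \<le> B" using B[OF k] by auto
    have iSx: "integrable M (\<lambda>w. S k w * \<xi> k w)"
    proof (rule Bochner_Integration.integrable_bound[of M "\<lambda>w. B * S k w"])
      show "AE w in M. norm (S k w * \<xi> k w) \<le> norm (B * S k w)"
        using B'
      proof eventually_elim
        case (elim w)
        then have "\<bar>\<xi> k w\<bar> \<le> \<bar>B\<bar>" by linarith
        then show ?case by (simp add: abs_mult mult.commute[of "\<bar>S k w\<bar>"] mult_right_mono)
      qed
    qed (use iS Sm xm in auto)
    have ixx: "integrable M (\<lambda>w. (\<xi> k w)\<^sup>2)"
    proof (rule integrable_const_bound[where B="B\<^sup>2"])
      show "AE w in M. norm ((\<xi> k w)\<^sup>2) \<le> B\<^sup>2"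
        using B' by eventually_elim (auto simp: abs_le_square_iff[symmetric])
    qed (use xm in auto)
    have D: "integrable M (\<lambda>w. S k w * \<xi> k w * \<Delta> k w) \<and> (\<integral>w. S k w * \<xi> k w * \<Delta> k w \<partial>M) = 0 \<and>
      integrable M (\<lambda>w. (\<xi> k w)\<^sup>2 * (\<Delta> k w)\<^sup>2) \<and>
      (\<integral>w. (\<xi> k w)\<^sup>2 * (\<Delta> k w)\<^sup>2 \<partial>M) = (\<integral>w. (\<xi> k w)\<^sup>2 \<partial>M) * (min (\<tau> (Suc k)) t - min (\<tau> k) t)"
    \<comment> \<open>For \<open>\<tau> k \<le> t\<close> the increment really starts at
      \<open>\<tau> k\<close>, the time at which the coefficient is known; otherwise both endpoints
      are truncated to \<open>t\<close> and the increment is 0.\<close>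
    proof (cases "\<tau> k \<le> t")
      case True
      have s: "min (\<tau> k) t = \<tau> k" "0 \<le> \<tau> k" "\<tau> k \<le> min (\<tau> (Suc k)) t"
        using True pos[of k] k mono[OF k] by auto
      have m1: "(\<lambda>w. S k w * \<xi> k w) \<in> borel_measurable (F (\<tau> k))"
        "(\<lambda>w. (\<xi> k w)\<^sup>2) \<in> borel_measurable (F (\<tau> k))"
        using IH(1) xk by auto
      show ?thesis
        using wiener_increment_mult(1,2)[OF W s(2,3) m1(1) iSx]
          wiener_increment_mult(3,4)[OF W s(2,3) m1(2) ixx]
        by (simp add: \<Delta>_def s(1))
    next
      case False
      then have "min (\<tau> k) t = t" "min (\<tau> (Suc k)) t = t" using mono[OF k] by auto
      then show ?thesis by (simp add: \<Delta>_def)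
    qed
    have eq: "(S (Suc k) w)\<^sup>2 = (S k w)\<^sup>2 + 2 * (S k w * \<xi> k w * \<Delta> k w) + (\<xi> k w)\<^sup>2 * (\<Delta> k w)\<^sup>2" for w
      by (simp add: SS power2_eq_square algebra_simps)
    show ?case
      unfolding eq using D IH meas by simp
  qed
  from this[OF order_refl]
  show "integrable M (\<lambda>w. (step_integral W (n, \<tau>, \<xi>) t w)\<^sup>2)"
    "(\<integral>w. (step_integral W (n, \<tau>, \<xi>) t w)\<^sup>2 \<partial>M)
       = (\<Sum>i<n. (\<integral>w. (\<xi> i w)\<^sup>2 \<partial>M) * (min (\<tau> (Suc i)) t - min (\<tau> i) t))"
    by (simp_all add: S_def \<Delta>_def step_integral_def)
qed

text \<open>The half-open intervals of a monotone partition are disjoint, so at most one summand is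
  nonzero and no cross products survive.\<close>

lemma step_value_square:
  assumes mono: "\<And>i. i < n \<Longrightarrow> \<tau> i \<le> \<tau> (Suc i)"
  shows "(step_value (n, \<tau>, \<xi>) s w)\<^sup>2 = (\<Sum>i<n. (\<xi> i w)\<^sup>2 * indicator {\<tau> i<..\<tau> (Suc i)} s)"
proof -
  have le: "\<tau> i \<le> \<tau> k" if "i \<le> k" "k \<le> n" for i k
    using that
  proof (induction k)
    case (Suc k)
    then show ?case using mono[of k] by (cases "i = Suc k") auto
  qed simp
  have "(\<Sum>i<k. \<xi> i w * indicator {\<tau> i<..\<tau> (Suc i)} s)\<^sup>2 = (\<Sum>i<k. (\<xi> i w)\<^sup>2 * indicator {\<tau> i<..\<tau> (Suc i)} s)"
    if "k \<le> n" for k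
    using that
  proof (induction k)
    case (Suc k)
    show ?case
    proof (cases "s \<in> {\<tau> k<..\<tau> (Suc k)}")
      case True
      have "indicator {\<tau> i<..\<tau> (Suc i)} s = (0::real)" if "i < k" for i
        using le[of "Suc i" k] that Suc.prems True by (auto simp: indicator_def)
      then show ?thesis using True by simp
    next
      case False
      then show ?thesis using Suc by simp
    qed
  qed simp
  then show ?thesis by (simp add: step_value_def)
qed

text \<open>Both sides reduce to the sum of the second moments of the coefficients, each multiplied
  by the length of its interval cut off at \<open>t\<close>. Nonnegative integrals are used to match
  the mean-square limits in \<open>has_ito_integral\<close>.\<close>

lemma ito_isometry_step:
  assumes W: "wiener_process M F W" and step: "is_step_process M F G" and t: "0 \<le> t"
  shows "(\<integral>\<^sup>+w. ennreal ((step_integral W G t w)\<^sup>2) \<partial>M)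
    = (\<integral>\<^sup>+w. (\<integral>\<^sup>+s\<in>{0..t}. ennreal ((step_value G s w)\<^sup>2) \<partial>lborel) \<partial>M)"
proof -
  interpret prob_space M by (rule wiener_prob_space[OF W])
  obtain n \<tau> \<xi> B where G: "G = (n, \<tau>, \<xi>)" and pos: "\<And>i. i \<le> n \<Longrightarrow> 0 \<le> \<tau> i"
    and mono: "\<And>i. i < n \<Longrightarrow> \<tau> i \<le> \<tau> (Suc i)" and \<xi>: "\<And>i. i < n \<Longrightarrow> \<xi> i \<in> borel_measurable (F (\<tau> i))"
    and B: "\<And>i w. i < n \<Longrightarrow> w \<in> space M \<Longrightarrow> \<bar>\<xi> i w\<bar> \<le> B"
    by (rule is_step_processE[OF step]) (rule that)
  define d where "d i = min (\<tau> (Suc i)) t - min (\<tau> i) t" for i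
  have d0: "0 \<le> d i" if "i < n" for i using mono[OF that] by (auto simp: d_def)
  have xm: "\<xi> i \<in> borel_measurable M" if "i < n" for i
    using wiener_filtration_measurable[OF W \<xi>[OF that]] .
  have ixx: "integrable M (\<lambda>w. (\<xi> i w)\<^sup>2)" if "i < n" for i
  proof (rule integrable_const_bound[where B="B\<^sup>2"])
    show "AE w in M. norm ((\<xi> i w)\<^sup>2) \<le> B\<^sup>2"
      using B[OF that] by (auto simp: abs_le_square_iff[symmetric] intro: order_trans[OF _ abs_ge_self])
  qed (use xm[OF that] in auto)
  have inner: "(\<integral>\<^sup>+s\<in>{0..t}. ennreal ((step_value G s w)\<^sup>2) \<partial>lborel) = ennreal (\<Sum>i<n. (\<xi> i w)\<^sup>2 * d i)" for w
  proof -
    have "(\<integral>\<^sup>+s\<in>{0..t}. ennreal ((step_value G s w)\<^sup>2) \<partial>lborel)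
       = (\<integral>\<^sup>+s. (\<Sum>i<n. ennreal ((\<xi> i w)\<^sup>2) * indicator {min (\<tau> i) t<..min (\<tau> (Suc i)) t} s) \<partial>lborel)"
    proof (rule nn_integral_cong)
      fix s
      have "ennreal ((step_value G s w)\<^sup>2) * indicator {0..t} s
         = (\<Sum>i<n. ennreal ((\<xi> i w)\<^sup>2 * indicator {\<tau> i<..\<tau> (Suc i)} s)) * indicator {0..t} s"
        unfolding G by (simp add: step_value_square[of n \<tau>, OF mono])
      also have "\<dots> = (\<Sum>i<n. ennreal ((\<xi> i w)\<^sup>2) * indicator {min (\<tau> i) t<..min (\<tau> (Suc i)) t} s)"
        unfolding sum_distrib_right
      proof (rule sum.cong[OF refl])
        fix i assume "i \<in> {..<n}"
        then have "0 \<le> min (\<tau> i) t" using pos[of i] t by simp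
        then show "ennreal ((\<xi> i w)\<^sup>2 * indicator {\<tau> i<..\<tau> (Suc i)} s) * indicator {0..t} s
            = ennreal ((\<xi> i w)\<^sup>2) * indicator {min (\<tau> i) t<..min (\<tau> (Suc i)) t} s"
          by (auto simp: indicator_def)
      qed
      finally show "ennreal ((step_value G s w)\<^sup>2) * indicator {0..t} s
         = (\<Sum>i<n. ennreal ((\<xi> i w)\<^sup>2) * indicator {min (\<tau> i) t<..min (\<tau> (Suc i)) t} s)" .
    qed
    also have "\<dots> = (\<Sum>i<n. ennreal ((\<xi> i w)\<^sup>2) * ennreal (d i))"
      using d0 by (subst nn_integral_sum) (auto simp: nn_integral_cmult d_def intro!: sum.cong)
    also have "\<dots> = ennreal (\<Sum>i<n. (\<xi> i w)\<^sup>2 * d i)"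
      using d0 by (subst sum_ennreal[symmetric]) (auto simp: ennreal_mult intro!: sum.cong)
    finally show ?thesis .
  qed
  have "(\<integral>\<^sup>+w. ennreal ((step_integral W G t w)\<^sup>2) \<partial>M) = ennreal (\<integral>w. (step_integral W G t w)\<^sup>2 \<partial>M)"
    unfolding G by (rule nn_integral_eq_integral[OF step_integral_second_moment(1)[OF W step[unfolded G] t]]) simp
  also have "(\<integral>w. (step_integral W G t w)\<^sup>2 \<partial>M) = (\<integral>w. (\<Sum>i<n. (\<xi> i w)\<^sup>2 * d i) \<partial>M)"
    unfolding G step_integral_second_moment(2)[OF W step[unfolded G] t] d_def[symmetric]
    using ixx by (subst Bochner_Integration.integral_sum) auto
  also have "ennreal \<dots> = (\<integral>\<^sup>+w. ennreal (\<Sum>i<n. (\<xi> i w)\<^sup>2 * d i) \<partial>M)"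
    using ixx d0 by (intro nn_integral_eq_integral[symmetric]) (auto intro!: sum_nonneg AE_I2)
  finally show ?thesis by (simp only: inner)
qed

text \<open>Lets the isometry be applied to the difference between a step process and a constant:
  only this difference is needed, so no common refinement of two general partitions has to be built.
  The values agree on (0, t] only, because step intervals are open on the left; s = 0 is a null
  set.\<close>

lemma step_process_subtract_const:
  assumes W: "wiener_process M F W" and step: "is_step_process M F G" and t: "0 \<le> t"
  shows "\<exists>G'. is_step_process M F G' \<and>
    (\<forall>w. step_integral W G' t w = step_integral W G t w - c * (W t w - W 0 w)) \<and>
    (\<forall>s w. 0 < s \<longrightarrow> s \<le> t \<longrightarrow> step_value G' s w = step_value G s w - c)"
proof -
  obtain n \<tau> \<xi> B where G: "G = (n, \<tau>, \<xi>)" and pos: "\<And>i. i \<le> n \<Longrightarrow> 0 \<le> \<tau> i"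
    and mono: "\<And>i. i < n \<Longrightarrow> \<tau> i \<le> \<tau> (Suc i)" and \<xi>: "\<And>i. i < n \<Longrightarrow> \<xi> i \<in> borel_measurable (F (\<tau> i))"
    and B: "\<And>i w. i < n \<Longrightarrow> w \<in> space M \<Longrightarrow> \<bar>\<xi> i w\<bar> \<le> B"
    by (rule is_step_processE[OF step]) (rule that)
  \<comment> \<open>One interval is added in front, from 0 to \<open>\<tau> 0\<close>, and one at
    the end, so that the constant is subtracted on all of (0, t]. The last endpoint is a maximum in
    order to keep the partition monotone when \<open>\<tau> n\<close> exceeds
    \<open>t\<close>.\<close>
  define \<tau>' where "\<tau>' i = (case i of 0 \<Rightarrow> 0 | Suc j \<Rightarrow> if j \<le> n then \<tau> j else max t (\<tau> n))" for i
  define \<xi>' where "\<xi>' i = (case i of 0 \<Rightarrow> (\<lambda>w. - c)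
    | Suc j \<Rightarrow> if j < n then (\<lambda>w. \<xi> j w - c) else (\<lambda>w. - c))" for i
  define G' where "G' = (Suc (Suc n), \<tau>', \<xi>')"
  have sum_split: "(\<Sum>i<Suc (Suc n). f i) = f 0 + (\<Sum>j<n. f (Suc j)) + f (Suc n)" for f :: "nat \<Rightarrow> real"
    using sum.lessThan_Suc_shift[of f n] by simp
  have [simp]: "\<tau>' 0 = 0" "j \<le> n \<Longrightarrow> \<tau>' (Suc j) = \<tau> j" "\<tau>' (Suc (Suc n)) = max t (\<tau> n)" for j
    by (auto simp: \<tau>'_def)
  have [simp]: "\<xi>' 0 = (\<lambda>w. - c)" "j < n \<Longrightarrow> \<xi>' (Suc j) = (\<lambda>w. \<xi> j w - c)" "\<xi>' (Suc n) = (\<lambda>w. - c)" for j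
    by (auto simp: \<xi>'_def)
  have "is_step_process M F G'"
    unfolding is_step_process_def G'_def prod.case
  proof (intro conjI allI impI exI[of _ "\<bar>B\<bar> + \<bar>c\<bar>"] ballI)
    fix i assume i: "i < Suc (Suc n)"
    show "\<tau>' i \<le> \<tau>' (Suc i)"
    proof (cases i)
      case 0 then show ?thesis using pos[of 0] by simp
    next
      case (Suc j)
      then show ?thesis using i mono[of j] by (cases "j < n") (auto simp: less_Suc_eq)
    qed
    show "\<xi>' i \<in> borel_measurable (F (\<tau>' i))"
    proof (cases i)
      case (Suc j)
      then show ?thesis using i \<xi>[of j] by (cases "j < n") (auto simp: less_Suc_eq)
    qed simp
    fix w assume w: "w \<in> space M"
    show "\<bar>\<xi>' i w\<bar> \<le> \<bar>B\<bar> + \<bar>c\<bar>"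
    proof (cases i)
      case (Suc j)
      then show ?thesis using i B[of j w] w by (cases "j < n") (auto simp: less_Suc_eq)
    qed simp
  qed simp
  moreover have "step_integral W G' t w = step_integral W G t w - c * (W t w - W 0 w)" for w
  proof -
    have tel: "(\<Sum>j<n. W (min (\<tau> (Suc j)) t) w - W (min (\<tau> j) t) w)
        = W (min (\<tau> n) t) w - W (min (\<tau> 0) t) w"
      by (rule sum_lessThan_telescope)
    have "step_integral W G' t w = - c * (W (min (\<tau> 0) t) w - W 0 w)
      + (\<Sum>j<n. (\<xi> j w - c) * (W (min (\<tau> (Suc j)) t) w - W (min (\<tau> j) t) w))
      + - c * (W t w - W (min (\<tau> n) t) w)"
      using t by (simp only: step_integral_def G'_def sum_split prod.case) (simp add: min_absorb2)
    also have "(\<Sum>j<n. (\<xi> j w - c) * (W (min (\<tau> (Suc j)) t) w - W (min (\<tau> j) t) w))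
      = step_integral W G t w - c * (W (min (\<tau> n) t) w - W (min (\<tau> 0) t) w)"
      by (simp add: step_integral_def G left_diff_distrib[of _ c] sum_subtractf[of _ "\<lambda>j. c * _ j"] sum_distrib_left[symmetric] tel)
    finally show ?thesis by (simp add: algebra_simps)
  qed
  moreover have "step_value G' s w = step_value G s w - c" if s: "0 < s" "s \<le> t" for s w
  proof -
    define h where "h u = (if s \<le> u then 1 else 0 :: real)" for u
    have h: "indicator {u<..v} s = h v - h u" if "u \<le> v" for u v
      using that by (auto simp: h_def indicator_def)
    have tel: "(\<Sum>j<n. indicator {\<tau> j<..\<tau> (Suc j)} s) = h (\<tau> n) - h (\<tau> 0)"
    proof -
      have "(\<Sum>j<n. indicator {\<tau> j<..\<tau> (Suc j)} s) = (\<Sum>j<n. h (\<tau> (Suc j)) - h (\<tau> j))"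
        by (rule sum.cong) (use h mono in auto)
      also have "\<dots> = h (\<tau> n) - h (\<tau> 0)"
        by (rule sum_lessThan_telescope[of "\<lambda>j. h (\<tau> j)"])
      finally show ?thesis .
    qed
    have "step_value G' s w = - c * indicator {0<..\<tau> 0} s
      + (\<Sum>j<n. (\<xi> j w - c) * indicator {\<tau> j<..\<tau> (Suc j)} s) + - c * indicator {\<tau> n<..max t (\<tau> n)} s"
      by (simp only: step_value_def G'_def sum_split prod.case) simp
    also have "(\<Sum>j<n. (\<xi> j w - c) * indicator {\<tau> j<..\<tau> (Suc j)} s)
      = step_value G s w - c * (h (\<tau> n) - h (\<tau> 0))"
      by (simp add: step_value_def G left_diff_distrib sum_subtractf sum_distrib_left[symmetric] tel)
    also have "indicator {0<..\<tau> 0} s = h (\<tau> 0)" using h[of 0 "\<tau> 0"] pos[of 0] s by (simp add: h_def)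
    also have "indicator {\<tau> n<..max t (\<tau> n)} s = 1 - h (\<tau> n)"
      using h[of "\<tau> n" "max t (\<tau> n)"] s by (simp add: h_def)
    finally show ?thesis by (simp add: algebra_simps)
  qed
  ultimately show ?thesis by blast
qed

lemma step_integral_measurable:
  assumes W: "wiener_process M F W" and step: "is_step_process M F G" and t: "0 \<le> t"
  shows "step_integral W G t \<in> borel_measurable M"
proof -
  obtain n \<tau> \<xi> where G: "G = (n, \<tau>, \<xi>)" and pos: "\<And>i. i \<le> n \<Longrightarrow> 0 \<le> \<tau> i"
    and \<xi>: "\<And>i. i < n \<Longrightarrow> \<xi> i \<in> borel_measurable (F (\<tau> i))"
    by (rule is_step_processE[OF step]) (rule that)
  have "(\<lambda>w. \<Sum>i<n. \<xi> i w * (W (min (\<tau> (Suc i)) t) w - W (min (\<tau> i) t) w)) \<in> borel_measurable M"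
    by (intro borel_measurable_sum borel_measurable_times borel_measurable_diff wiener_measurable[OF W]
        wiener_filtration_measurable[OF W \<xi>]) (use pos t in auto)
  then show ?thesis by (simp add: step_integral_def G)
qed

text \<open>The approximating step integrals tend to \<open>I\<close> in mean square by definition
  and to c (W(t) - W(0)) by the isometry. Mean-square limits agree almost everywhere, and W(0) = 0
  almost everywhere.\<close>

lemma ito_integral_const:
  assumes W: "wiener_process M F W" and t: "0 \<le> t"
    and I: "has_ito_integral M F W t (\<lambda>s w. c) I"
  shows "AE w in M. I w = c * W t w"
proof -
  interpret prob_space M by (rule wiener_prob_space[OF W])
  define V where "V w = c * (W t w - W 0 w)" for w
  have Im[measurable]: "I \<in> borel_measurable M" using I by (simp add: has_ito_integral_def)
  have [measurable]: "W t \<in> borel_measurable M" "W 0 \<in> borel_measurable M"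
    using wiener_measurable[OF W] t by auto
  have Vm[measurable]: "V \<in> borel_measurable M"
    unfolding V_def by measurable
  obtain G where G: "\<And>n::nat. is_step_process M F (G n)"
    and l1: "(\<lambda>n. \<integral>\<^sup>+w. (\<integral>\<^sup>+s\<in>{0..t}. ennreal ((step_value (G n) s w - c)\<^sup>2) \<partial>lborel) \<partial>M) \<longlonglongrightarrow> 0"
    and l2: "(\<lambda>n. \<integral>\<^sup>+w. ennreal ((step_integral W (G n) t w - I w)\<^sup>2) \<partial>M) \<longlonglongrightarrow> 0"
    using I by (auto simp: has_ito_integral_def)
  have Gm[measurable]: "step_integral W (G n) t \<in> borel_measurable M" for n
    by (rule step_integral_measurable[OF W G t])
  have iso: "(\<integral>\<^sup>+w. ennreal ((step_integral W (G n) t w - V w)\<^sup>2) \<partial>M)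
    = (\<integral>\<^sup>+w. (\<integral>\<^sup>+s\<in>{0..t}. ennreal ((step_value (G n) s w - c)\<^sup>2) \<partial>lborel) \<partial>M)" for n
  proof -
    obtain G' where G': "is_step_process M F G'"
      "\<And>w. step_integral W G' t w = step_integral W (G n) t w - c * (W t w - W 0 w)"
      "\<And>s w. 0 < s \<Longrightarrow> s \<le> t \<Longrightarrow> step_value G' s w = step_value (G n) s w - c"
      using step_process_subtract_const[OF W G[of n] t, of c] by blast
    have "(\<integral>\<^sup>+w. ennreal ((step_integral W (G n) t w - V w)\<^sup>2) \<partial>M)
      = (\<integral>\<^sup>+w. ennreal ((step_integral W G' t w)\<^sup>2) \<partial>M)"
      by (simp add: G'(2) V_def)
    also have "\<dots> = (\<integral>\<^sup>+w. (\<integral>\<^sup>+s\<in>{0..t}. ennreal ((step_value G' s w)\<^sup>2) \<partial>lborel) \<partial>M)"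
      by (rule ito_isometry_step[OF W G'(1) t])
    also have "\<dots> = (\<integral>\<^sup>+w. (\<integral>\<^sup>+s\<in>{0..t}. ennreal ((step_value (G n) s w - c)\<^sup>2) \<partial>lborel) \<partial>M)"
    proof (rule nn_integral_cong, rule nn_integral_cong_AE)
      fix w
      have "AE s in lborel. s \<noteq> (0::real)" by (rule AE_lborel_singleton)
      then show "AE s in lborel. ennreal ((step_value G' s w)\<^sup>2) * indicator {0..t} s
        = ennreal ((step_value (G n) s w - c)\<^sup>2) * indicator {0..t} s"
        by eventually_elim (auto simp: indicator_def G'(3))
    qed
    finally show ?thesis .
  qed
  have "(\<integral>\<^sup>+w. ennreal ((I w - V w)\<^sup>2) \<partial>M)
      \<le> 2 * (\<integral>\<^sup>+w. ennreal ((step_integral W (G n) t w - I w)\<^sup>2) \<partial>M)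
        + 2 * (\<integral>\<^sup>+w. ennreal ((step_integral W (G n) t w - V w)\<^sup>2) \<partial>M)" for n
  proof -
    \<comment> \<open>The parallelogram identity: the right-hand side exceeds the left by the square
      of 2w - u - v. It stands in for the triangle inequality of the mean-square norm.\<close>
    have "(u - v)\<^sup>2 \<le> 2 * (w - u)\<^sup>2 + 2 * (w - v)\<^sup>2" for u v w :: real
      using zero_le_power2[of "2 * w - u - v"] by (simp add: power2_eq_square algebra_simps)
    then have "(\<integral>\<^sup>+w. ennreal ((I w - V w)\<^sup>2) \<partial>M)
      \<le> (\<integral>\<^sup>+w. 2 * ennreal ((step_integral W (G n) t w - I w)\<^sup>2)
          + 2 * ennreal ((step_integral W (G n) t w - V w)\<^sup>2) \<partial>M)"
      by (intro nn_integral_mono)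
        (simp add: ennreal_numeral[symmetric] ennreal_mult[symmetric] ennreal_plus[symmetric] del: ennreal_numeral ennreal_plus)
    then show ?thesis
      by (subst (asm) nn_integral_add) (auto simp: nn_integral_cmult)
  qed
  moreover have "(\<lambda>n. 2 * (\<integral>\<^sup>+w. ennreal ((step_integral W (G n) t w - I w)\<^sup>2) \<partial>M)
        + 2 * (\<integral>\<^sup>+w. ennreal ((step_integral W (G n) t w - V w)\<^sup>2) \<partial>M)) \<longlonglongrightarrow> 2 * 0 + 2 * 0"
    by (intro tendsto_add ennreal_tendsto_cmult l2) (use l1 in \<open>auto simp: iso\<close>)
  ultimately have "(\<integral>\<^sup>+w. ennreal ((I w - V w)\<^sup>2) \<partial>M) \<le> 2 * 0 + 2 * 0"
    by (intro LIMSEQ_le_const) auto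
  then have "(\<integral>\<^sup>+w. ennreal ((I w - V w)\<^sup>2) \<partial>M) = 0" by simp
  then have "AE w in M. ennreal ((I w - V w)\<^sup>2) = 0"
    by (subst (asm) nn_integral_0_iff_AE) auto
  moreover have "AE w in M. W 0 w = 0" using W by (simp add: wiener_process_def)
  ultimately show ?thesis by eventually_elim (auto simp: V_def)
qed

section \<open>Moments of the stochastic convolution\<close>

lemma reflected_deriv:
  fixes X D :: "real \<Rightarrow> real"
  assumes X: "\<And>s. 0 \<le> s \<Longrightarrow> (X has_real_derivative D s) (at s within {0..})"
    and s: "s \<in> {0..t}" "u \<in> {0..t}"
  shows "((\<lambda>s. X (t - s)) has_real_derivative - D (t - s)) (at s within {u..t})"
    "((\<lambda>s. X (t - s)) has_real_derivative - D (t - s)) (at s within {0..u})"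
proof -
  have "(X has_real_derivative D (t - s)) (at (t - s) within (\<lambda>s. t - s) ` {0..t})"
    by (rule DERIV_subset[OF X]) (use s in auto)
  moreover have "((\<lambda>s. t - s) has_real_derivative - 1) (at s within {0..t})"
    by (auto intro!: derivative_eq_intros)
  ultimately have "(X \<circ> (\<lambda>s. t - s) has_real_derivative D (t - s) * - 1) (at s within {0..t})"
    by (rule DERIV_image_chain)
  then have d: "((\<lambda>s. X (t - s)) has_real_derivative - D (t - s)) (at s within {0..t})"
    by (simp add: comp_def)
  show "((\<lambda>s. X (t - s)) has_real_derivative - D (t - s)) (at s within {u..t})"
    "((\<lambda>s. X (t - s)) has_real_derivative - D (t - s)) (at s within {0..u})"
    by (rule DERIV_subset[OF d], use s in force)+
qed

lemma set_integral_FTC: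
  fixes f F :: "real \<Rightarrow> real"
  assumes "a \<le> b" "\<And>x. x \<in> {a..b} \<Longrightarrow> (F has_real_derivative f x) (at x within {a..b})"
    "continuous_on {a..b} f"
  shows "(LBINT x:{a..b}. f x) = F b - F a"
  unfolding set_lebesgue_integral_def
  by (rule integral_FTC_atLeastAtMost)
    (use assms in \<open>auto simp: has_real_derivative_iff_has_vector_derivative[symmetric]\<close>)

lemma set_integral_reflect:
  fixes f :: "real \<Rightarrow> real"
  shows "(LBINT s:{0..t}. f (t - s)) = (LBINT s:{0..t}. f s)"
proof -
  have "(LBINT s:{0..t}. f s) = (LBINT s. indicator {0..t} (t - s) *\<^sub>R f (t - s))"
    unfolding set_lebesgue_integral_def
    by (subst lborel_integral_real_affine[where c="-1" and t=t]) simp_all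
  also have "\<dots> = (LBINT s:{0..t}. f (t - s))"
    unfolding set_lebesgue_integral_def
    by (rule Bochner_Integration.integral_cong) (auto simp: indicator_def)
  finally show ?thesis by simp
qed

lemma set_integral_deriv:
  fixes f :: "real \<Rightarrow> real"
  assumes f: "continuous_on {0..t} f" and s: "s \<in> {0..t}"
  shows "((\<lambda>s. LBINT u:{0..s}. f u) has_real_derivative f s) (at s within {0..t})"
proof -
  have "(LBINT u:{0..r}. f u) = integral {0..r} f" if "r \<in> {0..t}" for r
    by (rule set_borel_integral_eq_integral(2)[OF borel_integrable_atLeastAtMost'])
      (rule continuous_on_subset[OF f], use that in auto)
  then show ?thesis
    by (intro has_field_derivative_transform_within[OF integral_has_real_derivative[OF f s] zero_less_one s]) auto
qed

text \<open>The form in which Fubini is used for processes: a uniform bound on first absolute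
  moments over a finite time interval permits expectation and time integral to be exchanged.\<close>

lemma integrable_pair_bounded_first_moment:
  fixes f :: "real \<Rightarrow> 'w \<Rightarrow> real"
  assumes "sigma_finite_measure M"
    and [measurable]: "(\<lambda>(s, w). f s w) \<in> borel_measurable (borel \<Otimes>\<^sub>M M)"
    and z: "\<And>s w. s \<notin> {0..t} \<Longrightarrow> f s w = 0"
    and i: "\<And>s. s \<in> {0..t} \<Longrightarrow> integrable M (f s)"
    and b: "\<And>s. s \<in> {0..t} \<Longrightarrow> (\<integral>w. \<bar>f s w\<bar> \<partial>M) \<le> C"
  shows "integrable (lborel \<Otimes>\<^sub>M M) (\<lambda>(s, w). f s w)"
proof -
  interpret sigma_finite_measure M by fact
  interpret P: pair_sigma_finite lborel M ..
  show ?thesis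
  proof (rule P.Fubini_integrable)
    show "AE s in lborel. integrable M (\<lambda>w. case (s, w) of (s, w) \<Rightarrow> f s w)"
    proof (rule AE_I2)
      fix s :: real
      have "f s = (\<lambda>_. 0)" if "s \<notin> {0..t}" using z[OF that] by auto
      then show "integrable M (\<lambda>w. case (s, w) of (s, w) \<Rightarrow> f s w)"
        using i[of s] by (cases "s \<in> {0..t}") auto
    qed
    have "integrable lborel (\<lambda>s. \<integral>w. \<bar>f s w\<bar> \<partial>M)"
    proof (rule Bochner_Integration.integrable_bound[of _ "\<lambda>s. C * indicator {0..t} s"])
      show "integrable lborel (\<lambda>s. C * indicator {0..t} s)"
        by (intro integrable_mult_right integrable_real_indicator) (auto simp: emeasure_lborel_Icc_eq)
      show "AE s in lborel. norm (\<integral>w. \<bar>f s w\<bar> \<partial>M) \<le> norm (C * indicator {0..t} s)"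
      proof (rule AE_I2)
        fix s :: real
        show "norm (\<integral>w. \<bar>f s w\<bar> \<partial>M) \<le> norm (C * indicator {0..t} s)"
          using b[of s] z[of s] by (cases "s \<in> {0..t}") auto
      qed
    qed measurable
    then show "integrable lborel (\<lambda>s. \<integral>w. norm (case (s, w) of (s, w) \<Rightarrow> f s w) \<partial>M)" by simp
  qed measurable
qed

text \<open>Rational approximation of \<open>s\<close> from below that takes countably many values
  as \<open>s\<close> varies. It serves both joint measurability of paths and the passage from
  rational to arbitrary times.\<close>

lemma floor_approximation:
  "(\<lambda>n. real_of_int \<lfloor>s * real (Suc n)\<rfloor> / real (Suc n)) \<longlonglongrightarrow> s"
proof (rule tendsto_sandwich)
  show "\<forall>\<^sub>F n in sequentially. s - 1 / real (Suc n) \<le> real_of_int \<lfloor>s * real (Suc n)\<rfloor> / real (Suc n)"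
  proof (intro always_eventually allI)
    fix n
    have "s * real (Suc n) - 1 \<le> real_of_int \<lfloor>s * real (Suc n)\<rfloor>" by linarith
    then have "(s * real (Suc n) - 1) / real (Suc n) \<le> real_of_int \<lfloor>s * real (Suc n)\<rfloor> / real (Suc n)"
      by (intro divide_right_mono) auto
    then show "s - 1 / real (Suc n) \<le> real_of_int \<lfloor>s * real (Suc n)\<rfloor> / real (Suc n)"
      by (simp add: diff_divide_distrib)
  qed
  show "\<forall>\<^sub>F n in sequentially. real_of_int \<lfloor>s * real (Suc n)\<rfloor> / real (Suc n) \<le> s"
    by (intro always_eventually allI) (simp add: field_simps)
  show "(\<lambda>n. s - 1 / real (Suc n)) \<longlonglongrightarrow> s"
    using tendsto_diff[OF tendsto_const[of s] LIMSEQ_inverse_real_of_nat] by (simp add: inverse_eq_divide)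
qed simp

text \<open>\<open>W\<close> is measurable at each fixed time and continuous only almost everywhere,
  which does not give joint measurability. The version \<open>V\<close> is set to 0 on a null set
  and frozen at \<open>W 0\<close> for negative times; with every path continuous, it is the
  pointwise limit of its values at rounded times.\<close>

lemma wiener_continuous_version:
  assumes W: "wiener_process M F W"
  obtains V where "(\<lambda>(s, w). V s w) \<in> borel_measurable (borel \<Otimes>\<^sub>M M)"
    "\<And>w. w \<in> space M \<Longrightarrow> continuous_on UNIV (\<lambda>s. V s w)"
    "AE w in M. \<forall>s\<ge>0. V s w = W s w"
proof -
  have "AE w in M. continuous_on {0..} (\<lambda>t. W t w)" using W by (simp add: wiener_process_def)
  then obtain A where A: "A \<in> sets M" "emeasure M A = 0"
      "{w \<in> space M. \<not> continuous_on {0..} (\<lambda>t. W t w)} \<subseteq> A"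
    by (auto elim!: AE_E)
  define V where "V s w = (if w \<in> A then 0 else W (max 0 s) w)" for s w
  have Vm[measurable]: "V s \<in> borel_measurable M" for s
  proof -
    have "W (max 0 s) \<in> borel_measurable M" by (rule wiener_measurable[OF W]) simp
    then show ?thesis unfolding V_def using A(1) by measurable
  qed
  have cont: "continuous_on UNIV (\<lambda>s. V s w)" if "w \<in> space M" for w
  proof (cases "w \<in> A")
    case False
    then have "continuous_on {0..} (\<lambda>t. W t w)" using A that by auto
    then have "continuous_on UNIV (\<lambda>s. W (max 0 s) w)"
      by (rule continuous_on_compose2) (auto intro!: continuous_intros)
    then show ?thesis using False by (simp add: V_def)
  qed (simp add: V_def)
  define g where "g n s = real_of_int \<lfloor>s * real (Suc n)\<rfloor> / real (Suc n)" for n s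
  have g: "(\<lambda>n. g n s) \<longlonglongrightarrow> s" for s
    unfolding g_def by (rule floor_approximation)
  have "(\<lambda>(s, w). V s w) \<in> borel_measurable (borel \<Otimes>\<^sub>M M)"
  proof (rule borel_measurable_LIMSEQ_real)
    show "(\<lambda>n. case p of (s, w) \<Rightarrow> V (g n s) w) \<longlonglongrightarrow> (case p of (s, w) \<Rightarrow> V s w)"
      if p: "p \<in> space (borel \<Otimes>\<^sub>M M)" for p
    proof -
      obtain s w where [simp]: "p = (s, w)" by (cases p)
      have "w \<in> space M" using p by (simp add: space_pair_measure)
      from cont[OF this] have "isCont (\<lambda>s. V s w) s" by (simp add: continuous_on_eq_continuous_at)
      from isCont_tendsto_compose[OF this g] show ?thesis by simp
    qed
    fix n
    \<comment> \<open>At each grid point \<open>V\<close> depends on the second coordinate only;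
      rounding selects among countably many such functions.\<close>
    have "(\<lambda>p. V (real_of_int i / real (Suc n)) (snd p)) \<in> borel_measurable (borel \<Otimes>\<^sub>M M)" for i :: int
      by measurable
    then have "(\<lambda>p. V (real_of_int \<lfloor>fst p * real (Suc n)\<rfloor> / real (Suc n)) (snd p)) \<in> borel_measurable (borel \<Otimes>\<^sub>M M)"
      by (rule measurable_compose_countable) measurable
    then show "(\<lambda>p. case p of (s, w) \<Rightarrow> V (g n s) w) \<in> borel_measurable (borel \<Otimes>\<^sub>M M)"
      by (simp add: g_def split_beta')
  qed
  moreover have "AE w in M. w \<notin> A" using A by (intro AE_not_in) (simp add: null_setsI)
  then have "AE w in M. \<forall>s\<ge>0. V s w = W s w"
    by eventually_elim (simp add: V_def max_def)
  ultimately show ?thesis using that cont by blast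
qed

lemma set_integral_singleton: "(LBINT u:{c..c::real}. f u) = (0::real)"
  unfolding set_lebesgue_integral_def
  by (rule integral_eq_zero_AE) (use AE_lborel_singleton[of c] in \<open>eventually_elim; simp\<close>)

text \<open>Cauchy-Schwarz against the constant 1, obtained by expanding the nonnegative integral of
  (t g - J)^2 / t, where \<open>J\<close> is the integral of \<open>g\<close>.\<close>

lemma square_set_integral_le:
  fixes g :: "real \<Rightarrow> real"
  assumes g: "continuous_on {0..t} g" and t: "0 \<le> t"
  shows "(LBINT s:{0..t}. g s)\<^sup>2 \<le> t * (LBINT s:{0..t}. (g s)\<^sup>2)"
proof (cases "t = 0")
  case True
  then show ?thesis using set_integral_singleton[of 0 g] by simp
next
  case False
  define J where "J = (LBINT s:{0..t}. g s)"
  have int: "set_integrable lborel {0..t} g" "set_integrable lborel {0..t} (\<lambda>s. (g s)\<^sup>2)"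
    "set_integrable lborel {0..t} (\<lambda>s. 2 * J * g s)" "set_integrable lborel {0..t} (\<lambda>s. J\<^sup>2 / t)"
    by (rule borel_integrable_atLeastAtMost', intro continuous_intros g)+
  have c: "(LBINT s:{0..t}. J\<^sup>2) / t = J\<^sup>2"
    unfolding set_lebesgue_integral_def using False t by simp
  have "0 \<le> (LBINT s:{0..t}. (t * g s - J)\<^sup>2 / t)"
    unfolding set_lebesgue_integral_def using t by (intro integral_nonneg_AE) auto
  also have "\<dots> = (LBINT s:{0..t}. t * (g s)\<^sup>2 - 2 * J * g s + J\<^sup>2 / t)"
    using False t by (intro set_lebesgue_integral_cong) (auto simp: field_simps power2_eq_square)
  also have "\<dots> = t * (LBINT s:{0..t}. (g s)\<^sup>2) - 2 * J * J + J\<^sup>2"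
    using int by (simp add: set_integral_add set_integral_diff c J_def[symmetric])
  finally show ?thesis by (simp add: J_def power2_eq_square)
qed

text \<open>\<open>c r\<close> is the covariance of W(r) and N(t) that the isometry predicts for
  \<open>N\<close> as an Ito integral of X(t - u). The two identities are the deterministic
  computations of E[W(r) N] and E[N^2] from the covariance of \<open>W\<close>.\<close>

lemma covariance_kernel_integrals:
  fixes X D :: "real \<Rightarrow> real"
  assumes X: "\<And>s. 0 \<le> s \<Longrightarrow> (X has_real_derivative D s) (at s within {0..})"
    and D: "continuous_on {0..} D" and X0: "X 0 = 1" and t: "0 \<le> t"
  defines "c \<equiv> \<lambda>r. LBINT u:{0..r}. X (t - u)"
  shows "r \<in> {0..t} \<Longrightarrow> r + (LBINT s:{0..t}. D (t - s) * min s r) = c r"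
    and "c t + (LBINT s:{0..t}. D (t - s) * c s) = (LBINT u:{0..t}. (X u)\<^sup>2)"
proof -
  have cX: "continuous_on {0..} X" by (rule DERIV_continuous_on[OF X]) auto
  have cXt: "continuous_on {0..t} (\<lambda>s. X (t - s))"
    by (rule continuous_on_compose2[OF cX]) (auto intro!: continuous_intros)
  have cDt: "continuous_on {0..t} (\<lambda>s. D (t - s))"
    by (rule continuous_on_compose2[OF D]) (auto intro!: continuous_intros)
  have dc: "(c has_real_derivative X (t - s)) (at s within {0..t})" if "s \<in> {0..t}" for s
    unfolding c_def by (rule set_integral_deriv[OF cXt that])
  have cc: "continuous_on {0..t} c" by (rule DERIV_continuous_on[OF dc])
  have zero: "(LBINT u:{0..0}. f u) = 0" for f :: "real \<Rightarrow> real"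
    by (rule set_integral_singleton)
  show "r + (LBINT s:{0..t}. D (t - s) * min s r) = c r" if r: "r \<in> {0..t}" for r
  proof -
    have i: "set_integrable lborel {u..v} (\<lambda>s. D (t - s) * min s r)" if "0 \<le> u" "v \<le> t" for u v
      by (rule borel_integrable_atLeastAtMost')
        (rule continuous_on_subset[of "{0..t}"], intro continuous_intros cDt, use that in auto)
    \<comment> \<open>The integral is split at the kink s = r of the minimum; each piece then has an
      explicit primitive.\<close>
    have "(LBINT s:{0..t}. D (t - s) * min s r)
       = (LBINT s:{0..r}. D (t - s) * min s r) + (LBINT s:{r<..t}. D (t - s) * min s r)"
    proof -
      have rt: "r \<le> t" using r by simp
      have "{0..t} = {0..r} \<union> {r<..t}" using r by auto
      moreover have "set_integrable lborel {r<..t} (\<lambda>s. D (t - s) * min s r)"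
        by (rule set_integrable_subset[OF i[of 0 t]]) (use r in auto)
      ultimately show ?thesis
        using set_integral_Un[of "{0..r}" "{r<..t}" lborel "\<lambda>s. D (t - s) * min s r"] ivl_disj_int_two(8)[of 0 r t] i[OF order_refl rt] by auto
    qed
    also have "(LBINT s:{r<..t}. D (t - s) * min s r) = (LBINT s:{r..t}. D (t - s) * min s r)"
      unfolding set_lebesgue_integral_def
    proof (rule integral_cong_AE)
      show "(\<lambda>s. indicator {r<..t} s *\<^sub>R (D (t - s) * min s r)) \<in> borel_measurable lborel"
      proof -
        have "set_integrable lborel {r<..t} (\<lambda>s. D (t - s) * min s r)"
          by (rule set_integrable_subset[OF i[of 0 t]]) (use r in auto)
        then show ?thesis unfolding set_integrable_def by (rule borel_measurable_integrable)
      qed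
      show "(\<lambda>s. indicator {r..t} s *\<^sub>R (D (t - s) * min s r)) \<in> borel_measurable lborel"
        using i[of r t] r by (auto simp: set_integrable_def)
      show "AE s in lborel. indicator {r<..t} s *\<^sub>R (D (t - s) * min s r) = indicator {r..t} s *\<^sub>R (D (t - s) * min s r)"
        using AE_lborel_singleton[of r] by eventually_elim (auto simp: indicator_def)
    qed
    also have "\<dots> = (LBINT s:{r..t}. r * D (t - s))"
      by (rule set_lebesgue_integral_cong) auto
    also have "\<dots> = - r * X (t - t) - - r * X (t - r)"
      by (rule set_integral_FTC)
        (use r in \<open>auto intro!: derivative_eq_intros reflected_deriv[OF X] continuous_intros continuous_on_subset[OF cDt]\<close>)
    also have "(LBINT s:{0..r}. D (t - s) * min s r) = (LBINT s:{0..r}. D (t - s) * s)"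
      by (rule set_lebesgue_integral_cong) auto
    also have "\<dots> = (c r - X (t - r) * r) - (c 0 - X (t - 0) * 0)"
    proof (rule set_integral_FTC)
      fix s assume s: "s \<in> {0..r}"
      have "(c has_real_derivative X (t - s)) (at s within {0..r})"
        by (rule DERIV_subset[OF dc]) (use s r in auto)
      then show "((\<lambda>s. c s - X (t - s) * s) has_real_derivative D (t - s) * s) (at s within {0..r})"
        using reflected_deriv(2)[OF X, of s t r] s r by (auto intro!: derivative_eq_intros)
    qed (use r in \<open>auto intro!: continuous_intros continuous_on_subset[OF cDt]\<close>)
    finally show ?thesis using X0 zero by (simp add: c_def)
  qed
  define q where "q s = (LBINT u:{0..s}. (X (t - u))\<^sup>2)" for s
  have dq: "(q has_real_derivative (X (t - s))\<^sup>2) (at s within {0..t})" if "s \<in> {0..t}" for s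
    unfolding q_def by (rule set_integral_deriv[OF _ that]) (intro continuous_intros cXt)
  \<comment> \<open>Integration by parts: differentiating X(t - s) c(s) leaves the extra term X(t -
    s)^2, which the primitive \<open>q\<close> absorbs.\<close>
  have "(LBINT s:{0..t}. D (t - s) * c s) = (q t - X (t - t) * c t) - (q 0 - X (t - 0) * c 0)"
  proof (rule set_integral_FTC[OF t])
    fix s assume s: "s \<in> {0..t}"
    show "((\<lambda>s. q s - X (t - s) * c s) has_real_derivative D (t - s) * c s) (at s within {0..t})"
      using reflected_deriv(2)[OF X, of s t t] dc[OF s] dq[OF s] s t
      by (auto intro!: derivative_eq_intros simp: power2_eq_square)
  qed (intro continuous_intros cDt cc)
  moreover have "q t = (LBINT u:{0..t}. (X u)\<^sup>2)"
    unfolding q_def by (rule set_integral_reflect)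
  ultimately show "c t + (LBINT s:{0..t}. D (t - s) * c s) = (LBINT u:{0..t}. (X u)\<^sup>2)"
    using X0 zero by (simp add: c_def q_def)
qed

text \<open>\<open>N\<close> is constructed from the jointly measurable version \<open>V\<close>,
  hence matches the expression in \<open>W\<close> only almost everywhere. All moments follow from
  one pairing formula for E[J Y], used with Y equal to 1, to \<open>V r\<close> and finally to
  \<open>N\<close> itself.\<close>

lemma stochastic_convolution_moments:
  fixes X D :: "real \<Rightarrow> real"
  assumes W: "wiener_process M F W"
    and X: "\<And>s. 0 \<le> s \<Longrightarrow> (X has_real_derivative D s) (at s within {0..})"
    and D: "continuous_on {0..} D" and X0: "X 0 = 1" and t: "0 \<le> t"
  obtains N where "AE w in M. N w = W t w + (LBINT s:{0..t}. D (t - s) * W s w)"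
    "integrable M N" "(\<integral>w. N w \<partial>M) = 0"
    "integrable M (\<lambda>w. (N w)\<^sup>2)" "(\<integral>w. (N w)\<^sup>2 \<partial>M) = (LBINT u:{0..t}. (X u)\<^sup>2)"
proof -
  interpret prob_space M by (rule wiener_prob_space[OF W])
  interpret P: pair_sigma_finite lborel M ..
  obtain V where Vm[measurable]: "(\<lambda>(s, w). V s w) \<in> borel_measurable (borel \<Otimes>\<^sub>M M)"
    and Vc: "\<And>w. w \<in> space M \<Longrightarrow> continuous_on UNIV (\<lambda>s. V s w)"
    and VW: "AE w in M. \<forall>s\<ge>0. V s w = W s w"
    using wiener_continuous_version[OF W] by blast
  have Vsm[measurable]: "V s \<in> borel_measurable M" for s
    using measurable_compose[OF _ Vm, of "\<lambda>w. (s, w)" M] by simp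
  have VAE: "AE w in M. V s w = W s w" if "0 \<le> s" for s
    using VW that by auto
  have EV: "integrable M (V s) \<and> (\<integral>w. V s w \<partial>M) = 0" if s: "0 \<le> s" for s
    using integrable_cong_AE[OF Vsm wiener_measurable[OF W s] VAE[OF s]]
      integral_cong_AE[OF Vsm wiener_measurable[OF W s] VAE[OF s]]
      wiener_square_integrable(3,4)[OF W s] by simp
  have EVV: "integrable M (\<lambda>w. V s w * V r w) \<and> (\<integral>w. V s w * V r w \<partial>M) = min s r"
    if s: "0 \<le> s" and r: "0 \<le> r" for s r
  proof -
    have m: "(\<lambda>w. W s w * W r w) \<in> borel_measurable M"
      using wiener_measurable[OF W] s r by auto
    have a: "AE w in M. V s w * V r w = W s w * W r w"
      using VAE[OF s] VAE[OF r] by eventually_elim simp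
    show ?thesis
      using integrable_cong_AE[OF _ m a] integral_cong_AE[OF _ m a] wiener_covariance[OF W s r] by simp
  qed
  define d where "d s = indicator {0..t} s * D (t - s)" for s
  have cDt: "continuous_on {0..t} (\<lambda>s. D (t - s))"
    by (rule continuous_on_compose2[OF D]) (auto intro!: continuous_intros)
  have dm[measurable]: "d \<in> borel_measurable borel"
    using borel_measurable_continuous_on_indicator[OF _ cDt] by (simp add: d_def[abs_def])
  obtain B where "\<And>s. s \<in> {0..t} \<Longrightarrow> \<bar>D (t - s)\<bar> \<le> B"
    using continuous_on_Icc_bounded[OF cDt] by blast
  then have B: "\<bar>d s\<bar> \<le> B" if "s \<in> {0..t}" for s using that by (simp add: d_def)
  have B0: "0 \<le> B" using B[of 0] t by auto
  define J where "J w = (LBINT s. d s * V s w)" for w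
  have Jm[measurable]: "J \<in> borel_measurable M" unfolding J_def by measurable
  define N where "N w = V t w + J w" for w
  have Nm[measurable]: "N \<in> borel_measurable M" unfolding N_def by measurable
  have NAE: "AE w in M. N w = W t w + (LBINT s:{0..t}. D (t - s) * W s w)"
    using VW
  proof eventually_elim
    case (elim w)
    have "J w = (LBINT s:{0..t}. D (t - s) * W s w)"
      unfolding J_def set_lebesgue_integral_def d_def
      by (rule Bochner_Integration.integral_cong) (use elim in \<open>auto simp: indicator_def\<close>)
    then show ?case using elim t by (simp add: N_def)
  qed
  \<comment> \<open>Expectation and time integral are exchanged; the bound |V Y| \<le> V^2 + Y^2
    makes the first moments uniformly bounded for square integrable \<open>Y\<close>.\<close>
  have pairing: "integrable M (\<lambda>w. J w * Y w) \<and>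
      (\<integral>w. J w * Y w \<partial>M) = (LBINT s. d s * (\<integral>w. V s w * Y w \<partial>M))"
    if [measurable]: "Y \<in> borel_measurable M" and sq: "integrable M (\<lambda>w. (Y w)\<^sup>2)" for Y
  proof -
    have iVY: "integrable M (\<lambda>w. V s w * Y w)" "(\<integral>w. \<bar>V s w * Y w\<bar> \<partial>M) \<le> t + (\<integral>w. (Y w)\<^sup>2 \<partial>M)"
      if s: "s \<in> {0..t}" for s
    proof -
      have V2: "integrable M (\<lambda>w. (V s w)\<^sup>2)" "(\<integral>w. (V s w)\<^sup>2 \<partial>M) = s"
        using EVV[of s s] s by (simp_all add: power2_eq_square)
      have le: "\<bar>V s w * Y w\<bar> \<le> (V s w)\<^sup>2 + (Y w)\<^sup>2" for w
        using sum_squares_bound[of "\<bar>V s w\<bar>" "\<bar>Y w\<bar>"] mult_nonneg_nonneg[of "\<bar>V s w\<bar>" "\<bar>Y w\<bar>"]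
        unfolding abs_mult by (simp del: mult_nonneg_nonneg)
      show i: "integrable M (\<lambda>w. V s w * Y w)"
        by (rule Bochner_Integration.integrable_bound[of M "\<lambda>w. (V s w)\<^sup>2 + (Y w)\<^sup>2"])
          (use V2 sq le in \<open>auto intro!: AE_I2 intro: order_trans\<close>)
      have "(\<integral>w. \<bar>V s w * Y w\<bar> \<partial>M) \<le> (\<integral>w. (V s w)\<^sup>2 + (Y w)\<^sup>2 \<partial>M)"
        by (rule integral_mono) (use i V2 sq le in auto)
      also have "\<dots> = s + (\<integral>w. (Y w)\<^sup>2 \<partial>M)" using V2 sq by simp
      finally show "(\<integral>w. \<bar>V s w * Y w\<bar> \<partial>M) \<le> t + (\<integral>w. (Y w)\<^sup>2 \<partial>M)" using s by simp
    qed
    define C where "C = B * (t + (\<integral>w. (Y w)\<^sup>2 \<partial>M))"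
    have int: "integrable (lborel \<Otimes>\<^sub>M M) (\<lambda>(s, w). d s * (V s w * Y w))"
    proof (rule integrable_pair_bounded_first_moment[where t=t and C=C])
      show "sigma_finite_measure M" ..
      show "d s * (V s w * Y w) = 0" if "s \<notin> {0..t}" for s w using that by (simp add: d_def)
      fix s assume s: "s \<in> {0..t}"
      show "integrable M (\<lambda>w. d s * (V s w * Y w))" using iVY(1)[OF s] by simp
      have "(\<integral>w. \<bar>d s * (V s w * Y w)\<bar> \<partial>M) = \<bar>d s\<bar> * (\<integral>w. \<bar>V s w * Y w\<bar> \<partial>M)"
        by (simp add: abs_mult)
      also have "\<dots> \<le> C"
        unfolding C_def by (rule mult_mono[OF B[OF s] iVY(2)[OF s] B0]) simp
      finally show "(\<integral>w. \<bar>d s * (V s w * Y w)\<bar> \<partial>M) \<le> C" .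
    qed measurable
    have e: "(LBINT s. d s * (V s w * Y w)) = J w * Y w" for w
      by (simp add: J_def mult.assoc[symmetric])
    show ?thesis
      using P.integrable_snd[OF int] P.Fubini_integral[OF int] by (simp add: e)
  qed
  \<comment> \<open>Square integrability of \<open>J\<close>, by Cauchy-Schwarz along each path,
    gives that of \<open>N\<close>, without which the pairing could not be used with Y = N.\<close>
  have J2: "integrable M (\<lambda>w. (J w)\<^sup>2)"
  proof (rule Bochner_Integration.integrable_bound)
    have int: "integrable (lborel \<Otimes>\<^sub>M M) (\<lambda>(s, w). (d s)\<^sup>2 * (V s w * V s w))"
    proof (rule integrable_pair_bounded_first_moment[where t=t and C="B\<^sup>2 * t"])
      show "sigma_finite_measure M" ..
      show "(d s)\<^sup>2 * (V s w * V s w) = 0" if "s \<notin> {0..t}" for s w using that by (simp add: d_def)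
      fix s assume s: "s \<in> {0..t}"
      show "integrable M (\<lambda>w. (d s)\<^sup>2 * (V s w * V s w))" using EVV[of s s] s by simp
      have "(\<integral>w. \<bar>(d s)\<^sup>2 * (V s w * V s w)\<bar> \<partial>M) = (d s)\<^sup>2 * s"
        using EVV[of s s] s by (simp add: abs_mult)
      also have "\<dots> \<le> B\<^sup>2 * t"
        by (rule mult_mono) (use B[OF s] s B0 in \<open>auto simp: abs_le_square_iff[symmetric]\<close>)
      finally show "(\<integral>w. \<bar>(d s)\<^sup>2 * (V s w * V s w)\<bar> \<partial>M) \<le> B\<^sup>2 * t" .
    qed measurable
    show "integrable M (\<lambda>w. t * (LBINT s. (d s)\<^sup>2 * (V s w * V s w)))"
      using P.integrable_snd[OF int] by simp
    show "AE w in M. norm ((J w)\<^sup>2) \<le> norm (t * (LBINT s. (d s)\<^sup>2 * (V s w * V s w)))"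
    proof (rule AE_I2)
      fix w assume w: "w \<in> space M"
      have "J w = (LBINT s:{0..t}. D (t - s) * V s w)"
        unfolding J_def set_lebesgue_integral_def d_def by (simp add: mult.assoc)
      moreover have "(LBINT s. (d s)\<^sup>2 * (V s w * V s w)) = (LBINT s:{0..t}. (D (t - s) * V s w)\<^sup>2)"
        unfolding set_lebesgue_integral_def d_def
        by (rule Bochner_Integration.integral_cong) (auto simp: indicator_def power2_eq_square)
      moreover have "(LBINT s:{0..t}. D (t - s) * V s w)\<^sup>2 \<le> t * (LBINT s:{0..t}. (D (t - s) * V s w)\<^sup>2)"
        by (rule square_set_integral_le[OF _ t])
          (intro continuous_intros cDt continuous_on_subset[OF Vc[OF w]], simp)
      ultimately show "norm ((J w)\<^sup>2) \<le> norm (t * (LBINT s. (d s)\<^sup>2 * (V s w * V s w)))"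
        by simp
    qed
  qed measurable
  have V2: "integrable M (\<lambda>w. (V s w)\<^sup>2)" if "0 \<le> s" for s
    using EVV[OF that that] by (simp add: power2_eq_square)
  have N2: "integrable M (\<lambda>w. (N w)\<^sup>2)"
  proof (rule Bochner_Integration.integrable_bound)
    show "integrable M (\<lambda>w. 2 * (V t w)\<^sup>2 + 2 * (J w)\<^sup>2)" using V2[OF t] J2 by simp
    show "AE w in M. norm ((N w)\<^sup>2) \<le> norm (2 * (V t w)\<^sup>2 + 2 * (J w)\<^sup>2)"
    proof (rule AE_I2)
      fix w
      have "(N w)\<^sup>2 \<le> 2 * (V t w)\<^sup>2 + 2 * (J w)\<^sup>2"
        using zero_le_power2[of "V t w - J w"] by (simp add: N_def power2_eq_square algebra_simps)
      then show "norm ((N w)\<^sup>2) \<le> norm (2 * (V t w)\<^sup>2 + 2 * (J w)\<^sup>2)" by simp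
    qed
  qed measurable
  have iN: "integrable M N" by (rule square_integrable_imp_integrable[OF Nm N2])
  have E0: "(\<integral>w. N w \<partial>M) = 0"
  proof -
    have "d s * (\<integral>w. V s w \<partial>M) = 0" for s
      using EV[of s] by (cases "s \<in> {0..t}") (auto simp: d_def)
    then have "(LBINT s. d s * (\<integral>w. V s w \<partial>M)) = 0" by (simp only: integral_zero)
    then show ?thesis
      using pairing[of "\<lambda>_. 1"] EV[OF t] unfolding N_def by simp
  qed
  define c where "c r = (LBINT u:{0..r}. X (t - u))" for r
  note kernel = covariance_kernel_integrals[OF X D X0 t, folded c_def]
  have ENV: "(\<integral>w. V r w * N w \<partial>M) = c r" if r: "r \<in> {0..t}" for r
  proof -
    note p = pairing[OF Vsm V2, of r]
    have "(\<integral>w. V r w * N w \<partial>M) = (\<integral>w. V t w * V r w + J w * V r w \<partial>M)"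
      by (simp add: N_def algebra_simps)
    also have "\<dots> = min t r + (LBINT s. d s * (\<integral>w. V s w * V r w \<partial>M))"
      using p EVV[OF t, of r] r by simp
    also have "(LBINT s. d s * (\<integral>w. V s w * V r w \<partial>M)) = (LBINT s:{0..t}. D (t - s) * min s r)"
      unfolding set_lebesgue_integral_def
      by (rule Bochner_Integration.integral_cong) (use EVV r in \<open>auto simp: d_def indicator_def\<close>)
    also have "min t r = r" using r by simp
    also have "r + (LBINT s:{0..t}. D (t - s) * min s r) = c r" by (rule kernel(1)[OF _ r])
    finally show ?thesis .
  qed
  have "(\<integral>w. (N w)\<^sup>2 \<partial>M) = (LBINT u:{0..t}. (X u)\<^sup>2)"
  proof -
    note p = pairing[OF Nm N2]
    have iVN: "integrable M (\<lambda>w. V t w * N w)"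
    proof -
      have "(\<lambda>w. V t w * N w) = (\<lambda>w. (N w)\<^sup>2 - J w * N w)"
        by (auto simp: N_def power2_eq_square algebra_simps)
      then show ?thesis using N2 p by simp
    qed
    have "(\<integral>w. (N w)\<^sup>2 \<partial>M) = (\<integral>w. V t w * N w + J w * N w \<partial>M)"
      by (simp add: N_def power2_eq_square algebra_simps)
    also have "\<dots> = c t + (LBINT s. d s * (\<integral>w. V s w * N w \<partial>M))"
      using p iVN ENV[of t] t by simp
    also have "(LBINT s. d s * (\<integral>w. V s w * N w \<partial>M)) = (LBINT s:{0..t}. D (t - s) * c s)"
      unfolding set_lebesgue_integral_def
      by (rule Bochner_Integration.integral_cong) (use ENV in \<open>auto simp: d_def indicator_def\<close>)
    also have "c t + \<dots> = (LBINT u:{0..t}. (X u)\<^sup>2)" by (rule kernel(2))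
    finally show ?thesis .
  qed
  then show ?thesis using that[OF NAE iN E0 N2] by blast
qed

section \<open>Solutions with additive noise\<close>

text \<open>History and path agree at 0, so they glue to a continuous function on the line, bounded
  on left half-lines because the history is bounded. These are the hypotheses of
  \<open>isCont_delay_term\<close>.\<close>

lemma BC_init_path:
  assumes \<phi>: "\<phi> \<in> BC_init" and y: "continuous_on {0..} y" "\<And>\<theta>. \<theta> \<le> 0 \<Longrightarrow> y \<theta> = \<phi> \<theta>"
  shows "continuous_on UNIV y" "\<exists>B. \<forall>u\<le>T. \<bar>y u\<bar> \<le> (B::real)"
proof -
  have "continuous_on {..0} y"
    by (rule continuous_on_eq[of _ \<phi>]) (use \<phi> y(2) in \<open>auto simp: BC_init_def\<close>)
  then have "continuous_on ({..0} \<union> {0..}) y"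
    by (intro continuous_on_closed_Un y(1)) auto
  moreover have "{..0} \<union> {0..} = (UNIV :: real set)" by auto
  ultimately show "continuous_on UNIV y" by simp
  obtain B1 where B1: "\<And>u. u \<le> 0 \<Longrightarrow> \<bar>\<phi> u\<bar> \<le> B1"
    using \<phi> by (auto simp: BC_init_def bounded_real)
  have "continuous_on {0..T} y" using y(1) by (rule continuous_on_subset) auto
  then obtain B2 where B2: "\<And>s. s \<in> {0..T} \<Longrightarrow> \<bar>y s\<bar> \<le> B2"
    using continuous_on_Icc_bounded by blast
  have "\<bar>y u\<bar> \<le> \<bar>B1\<bar> + \<bar>B2\<bar>" if "u \<le> T" for u
    using B1[of u] B2[of u] y(2)[of u] that by (cases "u \<le> 0") auto
  then show "\<exists>B. \<forall>u\<le>T. \<bar>y u\<bar> \<le> B" by blast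
qed

lemma additive_noise_integral_equation:
  assumes W: "wiener_process M F W"
    and sol: "sde_solution a b \<sigma>0 0 0 K M F W \<phi> x" and t: "0 \<le> t"
  shows "AE w in M. x t w = \<phi> 0 + (LBINT s:{0..t}. a * x s w + b * delay_term K (\<lambda>r. x r w) s) + \<sigma>0 * W t w"
proof -
  obtain I where I: "has_ito_integral M F W t (\<lambda>s w. \<sigma>0) I"
    and e: "AE w in M. x t w = \<phi> 0 + (LBINT s:{0..t}. a * x s w + b * delay_term K (\<lambda>r. x r w) s) + I w"
    using sol t by (auto simp: sde_solution_def)
  from e ito_integral_const[OF W t I] show ?thesis by eventually_elim simp
qed

text \<open>The equation holds for each time outside a null set that may depend on the time. Taking
  rational times leaves one null set, and continuity of both sides extends the equation to all
  times.\<close>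

lemma additive_noise_pathwise:
  assumes W: "wiener_process M F W" and K: "set_integrable lborel {0..} K" and \<phi>: "\<phi> \<in> BC_init"
    and sol: "sde_solution a b \<sigma>0 0 0 K M F W \<phi> x"
  shows "AE w in M. continuous_on {0..} (\<lambda>t. W t w) \<and> continuous_on {0..} (\<lambda>t. x t w) \<and>
    (\<forall>\<theta>\<le>0. x \<theta> w = \<phi> \<theta>) \<and>
    (\<forall>t\<ge>0. x t w = \<phi> 0 + (LBINT s:{0..t}. a * x s w + b * delay_term K (\<lambda>r. x r w) s) + \<sigma>0 * W t w)"
proof -
  define Q where "Q = \<rat> \<inter> {0::real..}"
  have "countable Q" unfolding Q_def by (intro countable_Int1 countable_rat)
  have "AE w in M. \<forall>t\<in>Q. x t w = \<phi> 0 + (LBINT s:{0..t}. a * x s w + b * delay_term K (\<lambda>r. x r w) s) + \<sigma>0 * W t w"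
    unfolding AE_ball_countable[OF \<open>countable Q\<close>]
    by (intro ballI additive_noise_integral_equation[OF W sol]) (simp add: Q_def)
  moreover have "AE w in M. continuous_on {0..} (\<lambda>t. W t w)" using W by (simp add: wiener_process_def)
  moreover have "AE w in M. continuous_on {0..} (\<lambda>t. x t w)" "AE w in M. \<forall>\<theta>\<le>0. x \<theta> w = \<phi> \<theta>"
    using sol by (auto simp: sde_solution_def)
  ultimately show ?thesis
  proof eventually_elim
    case (elim w)
    define y where "y t = x t w" for t
    have y: "continuous_on {0..} y" "\<And>\<theta>. \<theta> \<le> 0 \<Longrightarrow> y \<theta> = \<phi> \<theta>"
      unfolding y_def using elim(3,4) by blast+
    have yc: "continuous_on UNIV y" by (rule BC_init_path(1)[OF \<phi> y])
    have dc: "continuous_on S (delay_term K y)" for S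
      using isCont_delay_term[OF K borel_measurable_continuous_onI[OF yc]] BC_init_path(2)[OF \<phi> y] yc
      by (intro continuous_at_imp_continuous_on) (auto simp: continuous_on_eq_continuous_at)
    define g where "g t = y t - (\<phi> 0 + (LBINT s:{0..t}. a * y s + b * delay_term K y s) + \<sigma>0 * W t w)" for t
    have g0: "g t = 0" if t: "0 \<le> t" for t
    proof -
      have "continuous_on {0..t} (\<lambda>u. LBINT s:{0..u}. a * y s + b * delay_term K y s)"
        by (rule DERIV_continuous_on[OF set_integral_deriv])
          (intro continuous_intros dc continuous_on_subset[OF yc], auto)
      then have gc: "continuous_on {0..t} g"
        unfolding g_def
        by (intro continuous_intros continuous_on_subset[OF y(1)] continuous_on_subset[OF elim(2)]) auto
      \<comment> \<open>Rounding down keeps the approximating times rational, nonnegative and at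
        most \<open>t\<close>, where continuity of the defect \<open>g\<close> is available.\<close>
      define q where "q n = real_of_int \<lfloor>t * real (Suc n)\<rfloor> / real (Suc n)" for n
      have q: "q \<longlonglongrightarrow> t" unfolding q_def by (rule floor_approximation)
      have qQ: "q n \<in> Q" "q n \<in> {0..t}" for n
        using t by (auto simp: q_def Q_def field_simps)
      have "(\<lambda>n. g (q n)) \<longlonglongrightarrow> g t"
        by (rule continuous_on_tendsto_compose[OF gc q]) (use t qQ in auto)
      moreover have "g (q n) = 0" for n
        using bspec[OF elim(1) qQ(1)[of n]] unfolding g_def y_def by linarith
      ultimately show "g t = 0" by (simp only: LIMSEQ_const_iff)
    qed
    then have "x t w = \<phi> 0 + (LBINT s:{0..t}. a * x s w + b * delay_term K (\<lambda>r. x r w) s) + \<sigma>0 * W t w"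
      if "0 \<le> t" for t
      using g0[OF that] unfolding g_def y_def by linarith
    then show ?case using elim(2-4) by blast
  qed
qed

text \<open>A single good path \<open>w0\<close> serves as reference. Subtracting it cancels the
  history, so \<open>variation_of_constants\<close> expresses the difference through the difference
  of the two Wiener paths; everything that depends on \<open>w0\<close> is collected in
  \<open>m\<close>.\<close>

lemma additive_noise_representation:
  assumes W: "wiener_process M F W" and K: "set_integrable lborel {0..} K"
    and X: "fundamental_solution a b K X" and \<phi>: "\<phi> \<in> BC_init"
    and sol: "sde_solution a b \<sigma>0 0 0 K M F W \<phi> x"
  shows "\<exists>m. \<forall>t\<ge>0. AE w in M. x t w = m t + \<sigma>0 * (W t w + (LBINT s:{0..t}. fundamental_rate a b K X (t - s) * W s w))"
proof -
  interpret prob_space M by (rule wiener_prob_space[OF W])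
  define P where "P w \<longleftrightarrow> continuous_on {0..} (\<lambda>t. W t w) \<and> continuous_on {0..} (\<lambda>t. x t w) \<and>
    (\<forall>\<theta>\<le>0. x \<theta> w = \<phi> \<theta>) \<and>
    (\<forall>t\<ge>0. x t w = \<phi> 0 + (LBINT s:{0..t}. a * x s w + b * delay_term K (\<lambda>r. x r w) s) + \<sigma>0 * W t w)" for w
  have PD: "continuous_on {0..} (\<lambda>t. W t w)" "continuous_on {0..} (\<lambda>t. x t w)"
      "\<theta> \<le> 0 \<Longrightarrow> x \<theta> w = \<phi> \<theta>"
      "0 \<le> t \<Longrightarrow> x t w = \<phi> 0 + (LBINT s:{0..t}. a * x s w + b * delay_term K (\<lambda>r. x r w) s) + \<sigma>0 * W t w"
    if "P w" for w t \<theta>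
    using that unfolding P_def by blast+
  have AEP: "AE w in M. P w"
    unfolding P_def by (rule additive_noise_pathwise[OF W K \<phi> sol])
  \<comment> \<open>A probability space is not a null set, so a property that holds almost
    everywhere holds at some point.\<close>
  moreover have "ae_filter M \<noteq> bot" by (simp add: ae_filter_eq_bot_iff emeasure_space_1)
  ultimately obtain w0 where w0: "P w0" using eventually_happens' by blast
  define D where "D = fundamental_rate a b K X"
  define m where "m t = x t w0 - \<sigma>0 * (W t w0 + (LBINT s:{0..t}. D (t - s) * W s w0))" for t
  note int = borel_integrable_atLeastAtMost'
  have formula: "x t w = m t + \<sigma>0 * (W t w + (LBINT s:{0..t}. D (t - s) * W s w))" if P: "P w" and t: "0 \<le> t" for w t
  proof -
    have path: "continuous_on UNIV (\<lambda>t. x t \<eta>)" "\<exists>B. \<forall>u\<le>T. \<bar>x u \<eta>\<bar> \<le> B" if "P \<eta>" for \<eta> T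
      using BC_init_path[OF \<phi>, of "\<lambda>t. x t \<eta>"] PD(2,3)[OF that] by blast+
    have dl: "set_integrable lborel {0..} (\<lambda>s. K s * x (T - s) \<eta>)" if \<eta>: "P \<eta>" for \<eta> T
    proof -
      obtain B where B: "\<And>u. u \<le> T \<Longrightarrow> \<bar>x u \<eta>\<bar> \<le> B" using path(2)[OF \<eta>] by blast
      show ?thesis
        by (rule integrable_delay[OF K borel_measurable_continuous_onI[OF path(1)[OF \<eta>]] B])
    qed
    have dc: "continuous_on S (delay_term K (\<lambda>r. x r \<eta>))" if \<eta>: "P \<eta>" for \<eta> S
      using isCont_delay_term[OF K borel_measurable_continuous_onI[OF path(1)[OF \<eta>]]] path[OF \<eta>]
      by (intro continuous_at_imp_continuous_on) (auto simp: continuous_on_eq_continuous_at)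
    define z where "z t = x t w - x t w0" for t
    define v where "v t = \<sigma>0 * (W t w - W t w0)" for t
    have Wc: "continuous_on {0..} (\<lambda>t. W t w)" "continuous_on {0..} (\<lambda>t. W t w0)"
      using PD(1) P w0 by blast+
    have dz: "delay_term K z s = delay_term K (\<lambda>r. x r w) s - delay_term K (\<lambda>r. x r w0) s" for s
      unfolding delay_term_def z_def
      using set_integral_diff(2)[OF dl[OF P] dl[OF w0], of s s] by (simp add: right_diff_distrib)
    have "z t = v t + (LBINT s:{0..t}. fundamental_rate a b K X (t - s) * v s)"
    proof (rule variation_of_constants[OF X K _ _ _ _ t])
      show "continuous_on {0..} z" unfolding z_def by (intro continuous_intros PD(2) P w0)
      show "z u = 0" if "u < 0" for u using PD(3)[OF P, of u] PD(3)[OF w0, of u] that by (simp add: z_def)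
      show "continuous_on {0..} v" unfolding v_def by (intro continuous_intros Wc)
      fix r :: real assume r: "0 \<le> r"
      have i: "set_integrable lborel {0..r} (\<lambda>s. a * x s \<eta> + b * delay_term K (\<lambda>r. x r \<eta>) s)" if \<eta>: "P \<eta>" for \<eta>
        by (intro int continuous_intros dc[OF \<eta>] continuous_on_subset[OF path(1)[OF \<eta>]]) auto
      have "(LBINT s:{0..r}. a * z s + b * delay_term K z s)
        = (LBINT s:{0..r}. (a * x s w + b * delay_term K (\<lambda>r. x r w) s) - (a * x s w0 + b * delay_term K (\<lambda>r. x r w0) s))"
        by (rule set_lebesgue_integral_cong) (auto simp: dz z_def algebra_simps)
      also have "\<dots> = (LBINT s:{0..r}. a * x s w + b * delay_term K (\<lambda>r. x r w) s)
         - (LBINT s:{0..r}. a * x s w0 + b * delay_term K (\<lambda>r. x r w0) s)"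
        by (rule set_integral_diff(2)[OF i[OF P] i[OF w0]])
      finally show "z r = v r + (LBINT s:{0..r}. a * z s + b * delay_term K z s)"
        unfolding z_def v_def right_diff_distrib using PD(4)[OF P r] PD(4)[OF w0 r] by linarith
    qed
    moreover have "(LBINT s:{0..t}. D (t - s) * v s)
       = \<sigma>0 * ((LBINT s:{0..t}. D (t - s) * W s w) - (LBINT s:{0..t}. D (t - s) * W s w0))"
    proof -
      have cD: "continuous_on {0..t} (\<lambda>s. D (t - s))"
        unfolding D_def by (rule continuous_on_compose2[OF continuous_fundamental_rate[OF X K]])
          (auto intro!: continuous_intros)
      have i: "set_integrable lborel {0..t} (\<lambda>s. D (t - s) * W s \<eta>)" if "continuous_on {0..} (\<lambda>t. W t \<eta>)" for \<eta>
        by (intro int continuous_intros cD continuous_on_subset[OF that]) auto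
      have "(LBINT s:{0..t}. D (t - s) * v s) = (LBINT s:{0..t}. \<sigma>0 * (D (t - s) * W s w - D (t - s) * W s w0))"
        by (rule set_lebesgue_integral_cong) (auto simp: v_def algebra_simps)
      also have "\<dots> = \<sigma>0 * (LBINT s:{0..t}. D (t - s) * W s w - D (t - s) * W s w0)"
        by (rule set_integral_mult_right)
      also have "(LBINT s:{0..t}. D (t - s) * W s w - D (t - s) * W s w0)
          = (LBINT s:{0..t}. D (t - s) * W s w) - (LBINT s:{0..t}. D (t - s) * W s w0)"
        by (rule set_integral_diff(2)[OF i[OF Wc(1)] i[OF Wc(2)]])
      finally show ?thesis .
    qed
    ultimately show ?thesis
      unfolding m_def z_def v_def D_def[symmetric] right_diff_distrib distrib_left by linarith
  qed
  have "AE w in M. x t w = m t + \<sigma>0 * (W t w + (LBINT s:{0..t}. D (t - s) * W s w))" if "0 \<le> t" for t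
    by (rule eventually_mono[OF AEP]) (rule formula[OF _ that])
  then show ?thesis unfolding D_def by blast
qed

lemma additive_noise_second_moment:
  assumes W: "wiener_process M F W" and K: "set_integrable lborel {0..} K"
    and X: "fundamental_solution a b K X" and \<phi>: "\<phi> \<in> BC_init"
    and sol: "sde_solution a b \<sigma>0 0 0 K M F W \<phi> x" and t: "0 \<le> t"
  shows "integrable M (x t)" "integrable M (\<lambda>w. (x t w)\<^sup>2)"
    "second_moment M (x t) = \<sigma>0\<^sup>2 * (LBINT u:{0..t}. (X u)\<^sup>2)"
proof -
  interpret prob_space M by (rule wiener_prob_space[OF W])
  obtain N where NAE: "AE w in M. N w = W t w + (LBINT s:{0..t}. fundamental_rate a b K X (t - s) * W s w)"
    and N: "integrable M N" "(\<integral>w. N w \<partial>M) = 0"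
    "integrable M (\<lambda>w. (N w)\<^sup>2)" "(\<integral>w. (N w)\<^sup>2 \<partial>M) = (LBINT u:{0..t}. (X u)\<^sup>2)"
  proof (rule stochastic_convolution_moments[OF W _ continuous_fundamental_rate[OF X K] _ t])
    show "(X has_real_derivative fundamental_rate a b K X s) (at s within {0..})" if "0 \<le> s" for s
      using X that by (simp add: fundamental_solution_def fundamental_rate_def)
    show "X 0 = 1" using X by (simp add: fundamental_solution_def)
  qed blast
  obtain m where m: "AE w in M. x t w = m t + \<sigma>0 * (W t w + (LBINT s:{0..t}. fundamental_rate a b K X (t - s) * W s w))"
    using additive_noise_representation[OF W K X \<phi> sol] t by blast
  have xN: "AE w in M. m t + \<sigma>0 * N w = x t w" using m NAE by eventually_elim simp
  have xm[measurable]: "x t \<in> borel_measurable M"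
    using sol t wiener_filtration_measurable[OF W] by (auto simp: sde_solution_def)
  have Nm[measurable]: "N \<in> borel_measurable M" using N by auto
  have i: "integrable M (\<lambda>w. m t + \<sigma>0 * N w)" using N by simp
  show "integrable M (x t)" by (rule integrable_cong_AE_imp[OF i xm xN])
  have Ex: "(\<integral>w. x t w \<partial>M) = m t"
    using integral_cong_AE[OF _ xm xN] N by (simp add: prob_space)
  have eq2: "(m t + \<sigma>0 * N w)\<^sup>2 = (m t)\<^sup>2 + 2 * m t * \<sigma>0 * N w + \<sigma>0\<^sup>2 * (N w)\<^sup>2" for w
    by (simp add: power2_eq_square algebra_simps)
  have i2: "integrable M (\<lambda>w. (m t + \<sigma>0 * N w)\<^sup>2)" unfolding eq2 using N by simp
  show "integrable M (\<lambda>w. (x t w)\<^sup>2)"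
    by (rule integrable_cong_AE_imp[OF i2]) (use xN in auto)
  have "second_moment M (x t) = (\<integral>w. \<sigma>0\<^sup>2 * (N w)\<^sup>2 \<partial>M)"
    unfolding second_moment_def Ex
  proof (rule integral_cong_AE)
    show "AE w in M. \<bar>x t w - m t\<bar>\<^sup>2 = \<sigma>0\<^sup>2 * (N w)\<^sup>2"
      using xN
    proof eventually_elim
      case (elim w)
      then have "x t w - m t = \<sigma>0 * N w" by linarith
      then show ?case by (simp add: power_mult_distrib)
    qed
  qed measurable
  then show "second_moment M (x t) = \<sigma>0\<^sup>2 * (LBINT u:{0..t}. (X u)\<^sup>2)" using N(4) by simp
qed

section \<open>Stability and instability\<close>

text \<open>Absolute convergence at \<open>w\<close> propagates to the right. The case b = 0 is
  excluded because there \<open>char_domain\<close> is the whole plane by convention and carries no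
  information on \<open>K\<close>.\<close>

lemma char_domain_halfplane:
  assumes K: "set_integrable lborel {0..} K" and w: "w \<in> char_domain b K" "b \<noteq> 0" "Re w \<le> r"
  shows "set_integrable lborel {0..} (\<lambda>t. exp (- r * t) * K t)"
proof -
  have "set_integrable lborel {0..} (\<lambda>t. exp (- w * of_real t) * complex_of_real (K t))"
    using w by (simp add: char_domain_def)
  then have i: "set_integrable lborel {0..} (\<lambda>t. norm (exp (- w * of_real t) * complex_of_real (K t)))"
    by (rule set_integrable_norm)
  show ?thesis
  proof (rule set_integrable_dominated[OF i])
    show "(\<lambda>t. indicator {0..} t *\<^sub>R (exp (- r * t) * K t)) \<in> borel_measurable lborel"
      using measurable_weighted_kernel[OF K, of "\<lambda>t. exp (- r * t)"] by simp
    fix t :: real assume "t \<in> {0..}"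
    then have "exp (- r * t) \<le> exp (- Re w * t)" using w(3) by (simp add: mult_right_mono)
    then show "norm (exp (- r * t) * K t) \<le> norm (exp (- w * of_real t) * complex_of_real (K t))"
      by (simp add: norm_mult abs_mult mult_right_mono)
  qed
qed

text \<open>A root lies in \<open>char_domain\<close> by definition and strictly to the left of
  \<alpha>, which makes the transform of \<open>K\<close> converge on Re z \<ge> \<alpha>. Without
  roots the supremum is -\<infinity> and says nothing about convergence; \<open>dom\<close> then
  provides it.\<close>

lemma fundamental_solution_spectral_bound:
  assumes X: "fundamental_solution a b K X" and K: "set_integrable lborel {0..} K"
    and \<alpha>: "spectral_abscissa a b K < ereal \<alpha>"
    and dom: "char_roots a b K = {} \<Longrightarrow> complex_of_real \<alpha> \<in> char_domain b K"
  shows "\<exists>C>0. \<forall>t\<ge>0. \<bar>X t\<bar> \<le> C * exp (\<alpha> * t)"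
proof -
  have root: "Re z < \<alpha>" if "z \<in> char_roots a b K" for z
  proof -
    have "ereal (Re z) \<le> spectral_abscissa a b K"
      unfolding spectral_abscissa_def using that by (rule SUP_upper)
    then have "ereal (Re z) < ereal \<alpha>" using \<alpha> by (rule le_less_trans)
    then show ?thesis by simp
  qed
  show ?thesis
  proof (cases "b = 0")
    case True
    \<comment> \<open>For b = 0 the equation does not see the kernel; it is replaced by 0 because
      the transform of \<open>K\<close> may diverge at \<alpha>.\<close>
    have "fundamental_solution a 0 (\<lambda>_. 0) X" using X True by (simp add: fundamental_solution_def)
    then show ?thesis
    proof (rule fundamental_solution_exp_bound)
      show "char_fun a 0 (\<lambda>_. 0) z \<noteq> 0" if "\<alpha> \<le> Re z" for z
        using root[of z] that True by (auto simp: char_roots_def char_domain_def char_fun_def)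
    qed (simp add: set_integrable_def)
  next
    case False
    obtain w where w: "w \<in> char_domain b K" "Re w \<le> \<alpha>"
    proof (cases "char_roots a b K = {}")
      case True
      then show ?thesis using dom that[of "complex_of_real \<alpha>"] by simp
    next
      case False
      then obtain z where "z \<in> char_roots a b K" by blast
      then show ?thesis using root[of z] that[of z] by (simp add: char_roots_def)
    qed
    show ?thesis
    proof (rule fundamental_solution_exp_bound[OF X char_domain_halfplane[OF K w(1) False w(2)]])
      fix z assume z: "\<alpha> \<le> Re z"
      have "set_integrable lborel {0..} (\<lambda>t. exp (- Re z * t) * K t)"
        using z w(2) by (intro char_domain_halfplane[OF K w(1) False]) simp
      then have "z \<in> char_domain b K"
        unfolding char_domain_def by (blast intro: set_integrable_laplace)
      then show "char_fun a b K z \<noteq> 0" using root[of z] z by (auto simp: char_roots_def)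
    qed
  qed
qed

text \<open>The rate is picked between the larger of the spectral abscissa and -\<mu> and 0: the
  exponential moment of \<open>K\<close> gives convergence at -\<mu>, hence at \<alpha>.\<close>

lemma spectral_rate_exists:
  assumes K: "delay_kernel K" and neg: "spectral_abscissa a b K < 0"
  obtains \<alpha> where "spectral_abscissa a b K < ereal \<alpha>" "\<alpha> < 0" "complex_of_real \<alpha> \<in> char_domain b K"
proof -
  obtain \<mu> where \<mu>: "0 < \<mu>" "set_integrable lborel {0..} (\<lambda>s. exp (\<mu> * s) * K s)"
    using K by (auto simp: delay_kernel_def)
  have K1: "set_integrable lborel {0..} K" using K by (simp add: delay_kernel_def)
  have "max (spectral_abscissa a b K) (ereal (- \<mu>)) < ereal 0" using neg \<mu>(1) by (simp add: zero_ereal_def)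
  then obtain \<alpha> where \<alpha>: "max (spectral_abscissa a b K) (ereal (- \<mu>)) < ereal \<alpha>" "ereal \<alpha> < ereal 0"
    using ereal_dense2 by blast
  have "set_integrable lborel {0..} (\<lambda>t. exp (- complex_of_real (- \<mu>) * of_real t) * complex_of_real (K t))"
    by (rule set_integrable_laplace) (use \<mu>(2) in simp)
  then have "complex_of_real (- \<mu>) \<in> char_domain b K" by (simp add: char_domain_def)
  then have "b \<noteq> 0 \<Longrightarrow> set_integrable lborel {0..} (\<lambda>t. exp (- \<alpha> * t) * K t)"
    using \<alpha>(1) by (intro char_domain_halfplane[OF K1]) auto
  then have "complex_of_real \<alpha> \<in> char_domain b K"
    using set_integrable_laplace[of "complex_of_real \<alpha>" K] by (auto simp: char_domain_def)
  then show ?thesis using that[of \<alpha>] \<alpha> by simp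
qed

section \<open>Square integrability of the fundamental solution\<close>

lemma exp_bound_square_integral:
  assumes X: "fundamental_solution a b K X" and \<alpha>: "\<alpha> < 0"
    and bound: "\<And>t. 0 \<le> t \<Longrightarrow> \<bar>X t\<bar> \<le> C * exp (\<alpha> * t)"
  shows "set_integrable lborel {0..} (\<lambda>s. (X s)\<^sup>2)"
    and "0 \<le> t \<Longrightarrow> (LBINT s:{0..}. (X s)\<^sup>2) - (LBINT s:{0..t}. (X s)\<^sup>2) \<in> {0..C\<^sup>2 * exp (2 * \<alpha> * t) / \<bar>2 * \<alpha>\<bar>}"
    and "(LBINT s:{0..}. (X s)\<^sup>2) \<le> C\<^sup>2 / \<bar>2 * \<alpha>\<bar>"
proof -
  note [measurable] = fundamental_solution_measurable[OF X]
  have sq: "(X s)\<^sup>2 \<le> C\<^sup>2 * exp (2 * \<alpha> * s)" if "0 \<le> s" for s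
  proof -
    have "\<bar>X s\<bar>\<^sup>2 \<le> (C * exp (\<alpha> * s))\<^sup>2" by (rule power_mono[OF bound[OF that]]) simp
    then show ?thesis by (simp add: power_mult_distrib mult.assoc exp_double)
  qed
  have e: "set_integrable lborel {r..} (\<lambda>s. C\<^sup>2 * exp (2 * \<alpha> * s))"
    "(LBINT s:{r..}. C\<^sup>2 * exp (2 * \<alpha> * s)) = C\<^sup>2 * exp (2 * \<alpha> * r) / \<bar>2 * \<alpha>\<bar>" for r
    using exp_decay_integral[of "2 * \<alpha>" r] \<alpha> by simp_all
  show int: "set_integrable lborel {0..} (\<lambda>s. (X s)\<^sup>2)"
    by (rule set_integrable_dominated[OF e(1)[of 0]]) (measurable, use sq in simp)
  have tail: "0 \<le> (LBINT s:{r..}. (X s)\<^sup>2) \<and> (LBINT s:{r..}. (X s)\<^sup>2) \<le> C\<^sup>2 * exp (2 * \<alpha> * r) / \<bar>2 * \<alpha>\<bar>" if r: "0 \<le> r" for r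
  proof
    show "0 \<le> (LBINT s:{r..}. (X s)\<^sup>2)"
      unfolding set_lebesgue_integral_def by (rule integral_nonneg_AE) auto
    have "set_integrable lborel {r..} (\<lambda>s. (X s)\<^sup>2)"
      by (rule set_integrable_subset[OF int]) (use r in auto)
    then have "(LBINT s:{r..}. (X s)\<^sup>2) \<le> (LBINT s:{r..}. C\<^sup>2 * exp (2 * \<alpha> * s))"
      by (rule set_integral_mono[OF _ e(1)]) (use sq r in auto)
    then show "(LBINT s:{r..}. (X s)\<^sup>2) \<le> C\<^sup>2 * exp (2 * \<alpha> * r) / \<bar>2 * \<alpha>\<bar>" by (simp only: e(2))
  qed
  show "(LBINT s:{0..}. (X s)\<^sup>2) \<le> C\<^sup>2 / \<bar>2 * \<alpha>\<bar>" using tail[of 0] by simp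
  show "(LBINT s:{0..}. (X s)\<^sup>2) - (LBINT s:{0..t}. (X s)\<^sup>2) \<in> {0..C\<^sup>2 * exp (2 * \<alpha> * t) / \<bar>2 * \<alpha>\<bar>}" if t: "0 \<le> t"
  proof -
    have un: "{0..} = {0..<t} \<union> {t..}" "{0..<t} \<inter> {t..} = {}" using t by auto
    have i: "set_integrable lborel {0..<t} (\<lambda>s. (X s)\<^sup>2)" "set_integrable lborel {t..} (\<lambda>s. (X s)\<^sup>2)"
      by (rule set_integrable_subset[OF int]; use t in auto)+
    have "(LBINT s:{0..}. (X s)\<^sup>2) = (LBINT s:{0..<t}. (X s)\<^sup>2) + (LBINT s:{t..}. (X s)\<^sup>2)"
      using set_integral_Un[OF un(2) i] un(1) by simp
    moreover have "(LBINT s:{0..<t}. (X s)\<^sup>2) = (LBINT s:{0..t}. (X s)\<^sup>2)"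
      unfolding set_lebesgue_integral_def
    proof (rule integral_cong_AE)
      show "AE s in lborel. indicator {0..<t} s *\<^sub>R (X s)\<^sup>2 = indicator {0..t} s *\<^sub>R (X s)\<^sup>2"
        using AE_lborel_singleton[of t] by eventually_elim (auto simp: indicator_def)
    qed measurable
    ultimately have "(LBINT s:{0..}. (X s)\<^sup>2) - (LBINT s:{0..t}. (X s)\<^sup>2) = (LBINT s:{t..}. (X s)\<^sup>2)"
      by linarith
    then show ?thesis using tail[OF t] by (simp only: atLeastAtMost_iff)
  qed
qed

text \<open>The inequality 2uv \<le> u^2 + v^2, with u = exp(-Re z t) and v = |X(t)|, turns square
  integrability into convergence of the transform of \<open>X\<close> at \<open>z\<close>; the
  identity h L(X) = 1 then excludes a root there.\<close>

lemma unstable_not_square_integrable: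
  assumes X: "fundamental_solution a b K X" and K: "set_integrable lborel {0..} K"
    and z: "z \<in> char_roots a b K" "0 < Re z"
  shows "\<not> set_integrable lborel {0..} (\<lambda>s. (X s)\<^sup>2)"
proof
  assume sq: "set_integrable lborel {0..} (\<lambda>s. (X s)\<^sup>2)"
  note [measurable] = fundamental_solution_measurable[OF X]
  have e: "set_integrable lborel {0..} (\<lambda>s. exp (- 2 * Re z * s))"
    using exp_decay_integral(1)[of "- 2 * Re z" 0] z(2) by simp
  have "set_integrable lborel {0..} (\<lambda>t. exp (- Re z * t) * X t)"
  proof (rule set_integrable_dominated[OF set_integral_add(1)[OF sq e]])
    fix t :: real
    have "2 * (exp (- Re z * t) * \<bar>X t\<bar>) \<le> (exp (- Re z * t))\<^sup>2 + \<bar>X t\<bar>\<^sup>2"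
      using sum_squares_bound[of "exp (- Re z * t)" "\<bar>X t\<bar>"] by (simp add: mult.assoc)
    moreover have "(exp (- Re z * t))\<^sup>2 = exp (- 2 * Re z * t)" by (simp add: exp_double[symmetric] mult.assoc)
    moreover have "0 \<le> exp (- Re z * t) * \<bar>X t\<bar>" by simp
    ultimately have "exp (- Re z * t) * \<bar>X t\<bar> \<le> (X t)\<^sup>2 + exp (- 2 * Re z * t)"
      unfolding power2_abs by linarith
    then show "norm (exp (- Re z * t) * X t) \<le> (X t)\<^sup>2 + exp (- 2 * Re z * t)"
      by (simp add: abs_mult)
  qed measurable
  from laplace_fundamental_solution[OF X K set_integrable_laplace_halfplane[OF K] this] z
  show False by (simp add: char_roots_def)
qed

text \<open>Monotone convergence along integer endpoints; it converts a bound on the second moments,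
  uniform in time, into square integrability of \<open>X\<close>.\<close>

lemma bounded_square_integral_imp_integrable:
  fixes f :: "real \<Rightarrow> real"
  assumes [measurable]: "f \<in> borel_measurable borel"
    and i: "\<And>t. 0 \<le> t \<Longrightarrow> set_integrable lborel {0..t} (\<lambda>s. (f s)\<^sup>2)"
    and B: "\<And>t. 0 \<le> t \<Longrightarrow> (LBINT s:{0..t}. (f s)\<^sup>2) \<le> B"
  shows "set_integrable lborel {0..} (\<lambda>s. (f s)\<^sup>2)"
proof -
  define g where "g n s = indicator {0..real n} s *\<^sub>R (f s)\<^sup>2" for n s
  have gi: "integrable lborel (g n)" for n
    using i[of "real n"] by (simp add: set_integrable_def g_def[abs_def])
  have mono: "mono (\<lambda>n. g n s)" for s
    by (rule monoI) (auto simp: g_def indicator_def)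
  have "incseq (\<lambda>n. integral\<^sup>L lborel (g n))"
    by (intro monoI integral_mono gi) (rule monoD[OF mono])
  moreover have "\<forall>n. integral\<^sup>L lborel (g n) \<le> B"
    using B[of "real _"] by (simp add: set_lebesgue_integral_def g_def[abs_def])
  ultimately obtain L where L: "(\<lambda>n. integral\<^sup>L lborel (g n)) \<longlonglongrightarrow> L"
    by (rule incseq_convergent)
  have "integrable lborel (\<lambda>s. indicator {0..} s *\<^sub>R (f s)\<^sup>2)"
  proof (rule integrable_monotone_convergence[OF gi _ _ L])
    show "AE s in lborel. (\<lambda>n. g n s) \<longlonglongrightarrow> indicator {0..} s *\<^sub>R (f s)\<^sup>2"
    proof (intro AE_I2 tendsto_eventually)
      fix s
      show "\<forall>\<^sub>F n in sequentially. g n s = indicator {0..} s *\<^sub>R (f s)\<^sup>2"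
        using eventually_ge_at_top[of "nat \<lceil>s\<rceil>"]
      proof eventually_elim
        case (elim n)
        have "s \<le> real n" using real_nat_ceiling_ge[of s] elim by linarith
        then show ?case by (auto simp: g_def indicator_def)
      qed
    qed
  qed (use mono in auto)
  then show ?thesis by (simp add: set_integrable_def)
qed

theorem theorem3p4:
  fixes a b \<sigma>0 \<sigma>1 \<sigma>2 :: real
    and K X :: "real \<Rightarrow> real"
    and M :: "'w measure" and F :: "real \<Rightarrow> 'w measure" and W :: "real \<Rightarrow> 'w \<Rightarrow> real"
    and x :: "(real \<Rightarrow> real) \<Rightarrow> real \<Rightarrow> 'w \<Rightarrow> real"
  assumes "\<not> (\<sigma>0 = 0 \<and> \<sigma>1 = 0 \<and> \<sigma>2 = 0)"
    and "delay_kernel K"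
    and "fundamental_solution a b K X"
    and "wiener_process M F W"
    and "\<forall>\<phi>\<in>BC_init. sde_solution a b \<sigma>0 \<sigma>1 \<sigma>2 K M F W \<phi> (x \<phi>)"
    and "\<sigma>1 = 0" and "\<sigma>2 = 0"
  shows "(spectral_abscissa a b K < 0 \<longrightarrow>
            second_moment_bounded M x \<and>
            (let M1 = \<sigma>0\<^sup>2 * (LBINT s:{0..}. (X s)\<^sup>2) in
               set_integrable lborel {0..} (\<lambda>s. (X s)\<^sup>2) \<and>
               (\<forall>\<phi>\<in>BC_init. ((\<lambda>t. second_moment M (x \<phi> t)) \<longlongrightarrow> M1) at_top) \<and>
               (\<forall>\<alpha>::real. spectral_abscissa a b K < ereal \<alpha> \<and> \<alpha> < 0 \<and>
                    (char_roots a b K = {} \<longrightarrow> complex_of_real \<alpha> \<in> char_domain b K) \<longrightarrow>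
                  (\<exists>C1>0. (\<forall>t\<ge>0. \<bar>X t\<bar> \<le> C1 * exp (\<alpha> * t)) \<and>
                     M1 \<le> C1\<^sup>2 * \<sigma>0\<^sup>2 / \<bar>2 * \<alpha>\<bar> \<and>
                     (\<forall>\<phi>\<in>BC_init. \<forall>t\<ge>0.
                        \<bar>second_moment M (x \<phi> t) - M1\<bar>
                          \<le> C1\<^sup>2 * \<sigma>0\<^sup>2 * exp (2 * \<alpha> * t) / \<bar>2 * \<alpha>\<bar>)))))
       \<and> (spectral_abscissa a b K > 0 \<longrightarrow> \<not> second_moment_bounded M x)"
proof -
  have K: "set_integrable lborel {0..} K" using assms(2) by (simp add: delay_kernel_def)
  note X = assms(3) and W = assms(4)
  have \<sigma>: "\<sigma>0 \<noteq> 0" using assms(1,6,7) by simp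
  have sol: "sde_solution a b \<sigma>0 0 0 K M F W \<phi> (x \<phi>)" if "\<phi> \<in> BC_init" for \<phi>
    using assms(5-7) that by simp
  note moment = additive_noise_second_moment[OF W K X _ sol]
  define M1 where "M1 = \<sigma>0\<^sup>2 * (LBINT s:{0..}. (X s)\<^sup>2)"
  show ?thesis
  proof ((rule conjI; rule impI), goal_cases)
    case neg: 1
    show ?case
      unfolding Let_def M1_def[symmetric]
    proof (intro conjI allI impI)
      \<comment> \<open>Boundedness and the limit come without a prescribed rate, so an admissible
        one is produced here; the rate \<alpha> of the estimate is treated separately below.\<close>
      obtain \<beta> where \<beta>: "spectral_abscissa a b K < ereal \<beta>" "\<beta> < 0" "complex_of_real \<beta> \<in> char_domain b K"
        using spectral_rate_exists[OF assms(2) neg] .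
      obtain C where C: "\<And>t. 0 \<le> t \<Longrightarrow> \<bar>X t\<bar> \<le> C * exp (\<beta> * t)"
        using fundamental_solution_spectral_bound[OF X K \<beta>(1) \<beta>(3)] by blast
      note sq = exp_bound_square_integral[OF X \<beta>(2) C]
      show sqi: "set_integrable lborel {0..} (\<lambda>s. (X s)\<^sup>2)" by (rule sq(1))
      have le: "second_moment M (x \<phi> t) \<le> M1" if "\<phi> \<in> BC_init" "0 \<le> t" for \<phi> t
        unfolding moment(3)[OF that(1,1,2)] M1_def
        using sq(2)[OF _ that(2)] by (intro mult_left_mono) auto
      show "second_moment_bounded M x"
        unfolding second_moment_bounded_def
      proof (intro exI[of _ "\<lambda>_. \<bar>M1\<bar> + 1"] conjI allI ballI impI)
        fix \<phi> t assume h: "\<phi> \<in> BC_init" "(0::real) \<le> t"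
        show "integrable M (x \<phi> t)" "integrable M (\<lambda>\<omega>. (x \<phi> t \<omega>)\<^sup>2)"
          using moment(1,2)[OF h(1,1,2)] by auto
        show "second_moment M (x \<phi> t) \<le> \<bar>M1\<bar> + 1" using le[OF h] by linarith
      qed simp
      show "\<forall>\<phi>\<in>BC_init. ((\<lambda>t. second_moment M (x \<phi> t)) \<longlongrightarrow> M1) at_top"
      proof
        fix \<phi> assume \<phi>: "\<phi> \<in> BC_init"
        have "((\<lambda>t. \<sigma>0\<^sup>2 * (LBINT s:{0..t}. (X s)\<^sup>2)) \<longlongrightarrow> M1) at_top"
          unfolding M1_def
          by (intro tendsto_mult_left tendsto_set_lebesgue_integral_at_top[OF _ sqi]) auto
        moreover have "\<forall>\<^sub>F t in at_top. \<sigma>0\<^sup>2 * (LBINT s:{0..t}. (X s)\<^sup>2) = second_moment M (x \<phi> t)"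
          using eventually_ge_at_top[of 0] by eventually_elim (simp add: moment(3)[OF \<phi> \<phi>])
        ultimately show "((\<lambda>t. second_moment M (x \<phi> t)) \<longlongrightarrow> M1) at_top"
          by (rule Lim_transform_eventually)
      qed
      fix \<alpha> :: real
      assume "spectral_abscissa a b K < ereal \<alpha> \<and> \<alpha> < 0 \<and>
          (char_roots a b K = {} \<longrightarrow> complex_of_real \<alpha> \<in> char_domain b K)"
      then have \<alpha>: "spectral_abscissa a b K < ereal \<alpha>" "\<alpha> < 0"
        "char_roots a b K = {} \<Longrightarrow> complex_of_real \<alpha> \<in> char_domain b K" by auto
      obtain C1 where C1: "0 < C1" "\<And>t. 0 \<le> t \<Longrightarrow> \<bar>X t\<bar> \<le> C1 * exp (\<alpha> * t)"
        using fundamental_solution_spectral_bound[OF X K \<alpha>(1,3)] by blast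
      note sq1 = exp_bound_square_integral[OF X \<alpha>(2) C1(2)]
      show "\<exists>C1>0. (\<forall>t\<ge>0. \<bar>X t\<bar> \<le> C1 * exp (\<alpha> * t)) \<and>
           M1 \<le> C1\<^sup>2 * \<sigma>0\<^sup>2 / \<bar>2 * \<alpha>\<bar> \<and>
           (\<forall>\<phi>\<in>BC_init. \<forall>t\<ge>0.
              \<bar>second_moment M (x \<phi> t) - M1\<bar> \<le> C1\<^sup>2 * \<sigma>0\<^sup>2 * exp (2 * \<alpha> * t) / \<bar>2 * \<alpha>\<bar>)"
      proof (intro exI[of _ C1] conjI allI ballI impI)
        have "M1 \<le> \<sigma>0\<^sup>2 * (C1\<^sup>2 / \<bar>2 * \<alpha>\<bar>)"
          unfolding M1_def by (intro mult_left_mono sq1(3)) auto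
        then show "M1 \<le> C1\<^sup>2 * \<sigma>0\<^sup>2 / \<bar>2 * \<alpha>\<bar>" by (simp add: mult.commute)
        fix \<phi> t assume h: "\<phi> \<in> BC_init" "(0::real) \<le> t"
        \<comment> \<open>The tail of the integral of X^2 beyond \<open>t\<close>: the second moment
          increases to \<open>M1\<close>, and the deviation is \<open>\<sigma>0\<^sup>2\<close>
          times this tail.\<close>
        define \<delta> where "\<delta> = (LBINT s:{0..}. (X s)\<^sup>2) - (LBINT s:{0..t}. (X s)\<^sup>2)"
        have \<delta>: "0 \<le> \<delta>" "\<delta> \<le> C1\<^sup>2 * exp (2 * \<alpha> * t) / \<bar>2 * \<alpha>\<bar>"
          using sq1(2)[OF _ h(2)] by (auto simp: \<delta>_def)
        have "\<bar>second_moment M (x \<phi> t) - M1\<bar> = \<bar>- (\<sigma>0\<^sup>2 * \<delta>)\<bar>"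
          unfolding moment(3)[OF h(1,1,2)] M1_def \<delta>_def by (simp add: algebra_simps)
        also have "\<dots> = \<sigma>0\<^sup>2 * \<delta>" using \<delta>(1) by simp
        also have "\<dots> \<le> \<sigma>0\<^sup>2 * (C1\<^sup>2 * exp (2 * \<alpha> * t) / \<bar>2 * \<alpha>\<bar>)"
          by (intro mult_left_mono \<delta>(2)) simp
        finally show "\<bar>second_moment M (x \<phi> t) - M1\<bar> \<le> C1\<^sup>2 * \<sigma>0\<^sup>2 * exp (2 * \<alpha> * t) / \<bar>2 * \<alpha>\<bar>"
          by (simp add: mult_ac)
      qed (use C1 in auto)
    qed
  next
    case pos: 2
    show ?case
    proof
      assume "second_moment_bounded M x"
      then obtain R where R: "\<And>\<phi> t. \<phi> \<in> BC_init \<Longrightarrow> 0 \<le> t \<Longrightarrow> second_moment M (x \<phi> t) \<le> R ((init_norm \<phi>)\<^sup>2)"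
        unfolding second_moment_bounded_def by blast
      obtain z where z: "z \<in> char_roots a b K" "0 < Re z"
        using pos by (auto simp: spectral_abscissa_def less_SUP_iff)
      \<comment> \<open>One initial function suffices: along the zero history the assumed bound is a
        single number, so the integrals of X^2 over [0, t] stay bounded in \<open>t\<close>.\<close>
      have \<phi>: "(\<lambda>_. 0) \<in> BC_init" by (auto simp: BC_init_def bounded_def)
      have "set_integrable lborel {0..} (\<lambda>s. (X s)\<^sup>2)"
      proof (rule bounded_square_integral_imp_integrable[OF fundamental_solution_measurable[OF X]])
        fix t :: real assume t: "0 \<le> t"
        show "set_integrable lborel {0..t} (\<lambda>s. (X s)\<^sup>2)"
          by (intro borel_integrable_atLeastAtMost' continuous_intros
              continuous_on_subset[OF fundamental_solution_continuous[OF X]]) auto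
        have "\<sigma>0\<^sup>2 * (LBINT s:{0..t}. (X s)\<^sup>2) \<le> R ((init_norm (\<lambda>_. 0))\<^sup>2)"
          using R[OF \<phi> t] moment(3)[OF \<phi> \<phi> t] by simp
        then show "(LBINT s:{0..t}. (X s)\<^sup>2) \<le> R ((init_norm (\<lambda>_. 0))\<^sup>2) / \<sigma>0\<^sup>2"
          using \<sigma> by (simp add: field_simps)
      qed
      then show False using unstable_not_square_integrable[OF X K z] by simp
    qed
  qed
qed

end
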